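(* Let $(x_n)$ be the AR($p$) process defined below, driven by i.i.d. noise $(\varepsilon_n)$ with $\mathbf{E}\varepsilon_1=0$ and $0<\mathbf{E}\varepsilon_1^2=\sigma^2<\infty$. For $h>0$ let $\tau(h)=\inf\{n\ge1:\operatorname{tr}M_n\ge h\sigma^2\}$ and let $\theta(\tau(h))=M_{\tau(h)}^{-1}\sum_{k=1}^{\tau(h)}X_{k-1}x_k$ be the sequential least squares estimate. Then for every compact set $K\subset\tilde\Lambda_p$, $$\lim_{h\to\infty}\sup_{\theta\in K}\sup_{t\in\mathbb{R}^p}\Big|\mathbf{P}_\theta\big(M_{\tau(h)}^{1/2}(\theta(\tau(h))-\theta)\le t\big)-\Phi_p(t/\sigma)\Big|=0,$$ where the inequality between vectors is componentwise, $M^{1/2}$ is the symmetric positive semidefinite square root, and $\Phi_p(t/\sigma)=\prod_{i=1}^p\Phi(t_i/\sigma)$ with $\Phi$ the standard normal distribution function.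
   Context: Model: $x_n=\theta_1x_{n-1}+\dots+\theta_px_{n-p}+\varepsilon_n$, $n\ge1$, with $x_0=x_{-1}=\dots=x_{1-p}=0$, where $(\varepsilon_n)_{n\ge1}$ are i.i.d. with $\mathbf{E}\varepsilon_1=0$, $0<\mathbf{E}\varepsilon_1^2=\sigma^2<\infty$ ($\sigma^2$ known), and $\theta=(\theta_1,\dots,\theta_p)'\in\mathbb{R}^p$ is unknown; $\mathbf{P}_\theta$ denotes the law of the process under parameter $\theta$ (the noise law does not depend on $\theta$). Set $X_n=(x_n,x_{n-1},\dots,x_{n-p+1})'$ and $M_n=\sum_{k=1}^nX_{k-1}X_{k-1}'$; $M_n^{-1}$ is the inverse if $\det M_n>0$ and $0$ otherwise. The characteristic polynomial is $\mathcal P(z)=z^p-\theta_1z^{p-1}-\dots-\theta_p$ with roots $z_i(\theta)$. Condition 1: all roots of $\mathcal P$ satisfy $|z_i(\theta)|\le1$. Condition 2: all roots of $\mathcal P$ of modulus one are simple. Condition 3: the linear system in $Y_1,\dots,Y_{p-1}$ $$Y_1-\sum_{l=2}^p\theta_lY_{l-1}=\theta_1,\qquad -\sum_{k=1}^{j-1}\theta_{j-k}Y_k+Y_j-\sum_{k=1}^{p-j}\theta_{k+j}Y_k=\theta_j\ (2\le j\le p-1)$$ has a unique solution $Y_i=\kappa_i(\theta)$, and the symmetric Toeplitz matrix $L(\theta)$ with entries $L_{ij}=\kappa_{|i-j|}(\theta)$ ($\kappa_0:=1$) is positive definite. $\tilde\Lambda_p$ is the set of $\theta$ satisfying Conditions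 1–3. *)

theory Defs
  imports "HOL-Analysis.Analysis" "HOL-Probability.Probability"
    "HOL-Computational_Algebra.Polynomial"
begin

text \<open>Coordinates of R^p are indexed by a finite well-ordered type 'p; the
  position (1-based) of a coordinate in this order identifies 'p with {1..p}.\<close>

definition pos :: "'p::{finite,wellorder} \<Rightarrow> nat" where
  "pos i = card {j. j < i} + 1"

definition coef :: "real^'p::{finite,wellorder} \<Rightarrow> nat \<Rightarrow> real" where
  "coef \<theta> j = (if j \<in> {1..CARD('p::{finite,wellorder})} then \<theta> $ (THE i. pos i = j) else 0)"

text \<open>History list [x_n, x_(n-1), ..., x_1] of the AR(p) recursion driven by
  the noise values e 1, e 2, ...; initial values are zero.\<close>
primrec ar_hist :: "real^'p::{finite,wellorder} \<Rightarrow> (nat \<Rightarrow> real) \<Rightarrow> nat \<Rightarrow> real list" where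
  "ar_hist \<theta> e 0 = []"
| "ar_hist \<theta> e (Suc n) =
     (e (Suc n) + (\<Sum>j=1..CARD('p::{finite,wellorder}). coef \<theta> j * nth_default 0 (ar_hist \<theta> e n) (j - 1)))
       # ar_hist \<theta> e n"

text \<open>x_n (with x_0 = x_(-1) = ... = 0); x_(n-k) = nth_default 0 (ar_hist n) k.\<close>
definition ar_x :: "real^'p::{finite,wellorder} \<Rightarrow> (nat \<Rightarrow> real) \<Rightarrow> nat \<Rightarrow> real" where
  "ar_x \<theta> e n = nth_default 0 (ar_hist \<theta> e n) 0"

definition ar_X :: "real^'p::{finite,wellorder} \<Rightarrow> (nat \<Rightarrow> real) \<Rightarrow> nat \<Rightarrow> real^'p::{finite,wellorder}" where
  "ar_X \<theta> e n = (\<chi> i. nth_default 0 (ar_hist \<theta> e n) (pos i - 1))"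

definition ar_M :: "real^'p::{finite,wellorder} \<Rightarrow> (nat \<Rightarrow> real) \<Rightarrow> nat \<Rightarrow> real^'p::{finite,wellorder}^'p::{finite,wellorder}" where
  "ar_M \<theta> e n = (\<chi> i j. \<Sum>k=1..n. ar_X \<theta> e (k - 1) $ i * ar_X \<theta> e (k - 1) $ j)"

definition pinv :: "real^'p::{finite,wellorder}^'p::{finite,wellorder} \<Rightarrow> real^'p::{finite,wellorder}^'p::{finite,wellorder}" where
  "pinv A = (if det A > 0 then matrix_inv A else 0)"

definition psd_matrix :: "real^'p::{finite,wellorder}^'p::{finite,wellorder} \<Rightarrow> bool" where
  "psd_matrix A \<longleftrightarrow> (\<forall>v. 0 \<le> v \<bullet> (A *v v))"

definition pd_matrix :: "real^'p::{finite,wellorder}^'p::{finite,wellorder} \<Rightarrow> bool" where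
  "pd_matrix A \<longleftrightarrow> (\<forall>v. v \<noteq> 0 \<longrightarrow> 0 < v \<bullet> (A *v v))"

definition msqrt :: "real^'p::{finite,wellorder}^'p::{finite,wellorder} \<Rightarrow> real^'p::{finite,wellorder}^'p::{finite,wellorder}" where
  "msqrt A = (THE S. transpose S = S \<and> psd_matrix S \<and> S ** S = A)"

definition ar_tau :: "real^'p::{finite,wellorder} \<Rightarrow> (nat \<Rightarrow> real) \<Rightarrow> real \<Rightarrow> real \<Rightarrow> nat" where
  "ar_tau \<theta> e \<sigma> h = (LEAST n. 1 \<le> n \<and> trace (ar_M \<theta> e n) \<ge> h * \<sigma>\<^sup>2)"

definition ar_lse :: "real^'p::{finite,wellorder} \<Rightarrow> (nat \<Rightarrow> real) \<Rightarrow> nat \<Rightarrow> real^'p::{finite,wellorder}" where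
  "ar_lse \<theta> e n = pinv (ar_M \<theta> e n) *v (\<Sum>k=1..n. ar_x \<theta> e k *\<^sub>R ar_X \<theta> e (k - 1))"

definition char_poly :: "real^'p::{finite,wellorder} \<Rightarrow> complex poly" where
  "char_poly \<theta> = monom 1 CARD('p::{finite,wellorder}) - (\<Sum>j=1..CARD('p::{finite,wellorder}). monom (complex_of_real (coef \<theta> j)) (CARD('p::{finite,wellorder}) - j))"

definition cond1 :: "real^'p::{finite,wellorder} \<Rightarrow> bool" where
  "cond1 \<theta> \<longleftrightarrow> (\<forall>z. poly (char_poly \<theta>) z = 0 \<longrightarrow> cmod z \<le> 1)"

definition cond2 :: "real^'p::{finite,wellorder} \<Rightarrow> bool" where
  "cond2 \<theta> \<longleftrightarrow> (\<forall>z. poly (char_poly \<theta>) z = 0 \<and> cmod z = 1 \<longrightarrow> order z (char_poly \<theta>) = 1)"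

text \<open>Y (values Y_1..Y_(p-1)) solves the linear system of Condition 3
  (the equation for j = 1 is the case j = 1 of the general one).\<close>
definition yw_solves :: "real^'p::{finite,wellorder} \<Rightarrow> (nat \<Rightarrow> real) \<Rightarrow> bool" where
  "yw_solves \<theta> Y \<longleftrightarrow> (\<forall>j\<in>{1..CARD('p::{finite,wellorder}) - 1}.
      - (\<Sum>k=1..j-1. coef \<theta> (j - k) * Y k) + Y j
      - (\<Sum>k=1..CARD('p::{finite,wellorder}) - j. coef \<theta> (k + j) * Y k) = coef \<theta> j)"

definition toeplitz_L :: "(nat \<Rightarrow> real) \<Rightarrow> real^'p::{finite,wellorder}^'p::{finite,wellorder}" where
  "toeplitz_L \<kappa> = (\<chi> i j. let d = nat \<bar>int (pos i) - int (pos j)\<bar> in if d = 0 then 1 else \<kappa> d)"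

definition cond3 :: "real^'p::{finite,wellorder} \<Rightarrow> bool" where
  "cond3 \<theta> \<longleftrightarrow> (\<exists>\<kappa>. yw_solves \<theta> \<kappa>
      \<and> (\<forall>Y. yw_solves \<theta> Y \<longrightarrow> (\<forall>i\<in>{1..CARD('p::{finite,wellorder}) - 1}. Y i = \<kappa> i))
      \<and> pd_matrix (toeplitz_L \<kappa> :: real^'p::{finite,wellorder}^'p::{finite,wellorder}))"

definition Lambda_tilde :: "(real^'p::{finite,wellorder}) set" where
  "Lambda_tilde = {\<theta>. cond1 \<theta> \<and> cond2 \<theta> \<and> cond3 \<theta>}"

definition Phi :: "real \<Rightarrow> real" where
  "Phi x = cdf (density lborel std_normal_density) x"

end

(*
  Let A be the companion matrix and L the Toeplitz matrix of the Yule-Walker solution. The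
  Yule-Walker equations say A L A' = L - d e_1 e_1' with d = 1 - \<theta>' L \<theta>, and d \<ge> 0 because the
  characteristic polynomial has a root in the closed unit disc. Hence the powers of A are bounded,
  uniformly over K by compactness. Writing X_n = A^m X_(n-m) + (m noise terms) and averaging over m
  gives max_(n \<le> \<tau>) |X_n|^2 = o(h) in probability. Multiplying the recursion by X_(k-1) and summing,
  the sample autocovariances solve the Yule-Walker system up to o(h), so M_\<tau> / h is close to
  (\<sigma>^2 / p) L by uniqueness of its solution. A martingale argument with weights truncated so that
  their total energy is bounded shows that the characteristic function of the normalised score is
  nearly Gaussian, and the inverse square root of M_\<tau> / h may be replaced by its deterministic limit.
  All estimates are uniform over K. Uniformity in t comes from approximating shifted ramps by
  trigonometric polynomials, whose coefficients change only by a phase under shifts.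
*)
theory Submission
  imports Defs "HOL-Computational_Algebra.Fundamental_Theorem_Algebra"
begin

section \<open>Square roots of positive semidefinite matrices\<close>

text \<open>The growth rate of \<open>ar_M\<close> differs between stable parameters and parameters
  with roots on the unit circle, so no deterministic normalisation is uniform over K. Stopping when
  the trace reaches h sigma^2 removes the rate and leaves only the shape of the matrix, which the
  Yule-Walker system determines in both regimes. The stopping time is not bounded by a function of
  h, and sums stopped there are not open to independence arguments. It is replaced by the
  deterministic horizon \<open>m * nat \<lceil>h\<rceil> + 1\<close>, long enough with high
  probability because the noise energy grows linearly, together with predictable weights that vanish
  once the threshold is passed. The compensator V is then bounded on every path, so exp (i S + V) is
  integrable and its mean can be followed step by step. With only two noise moments, the tools are
  Chebyshev for the score, a truncated second moment for the largest noise and a Chernoff bound for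
  the energy. No sequence of parameters is ever extracted: all constants depend on K and the noise
  alone, and uniformity in the parameter is convergence along a product filter.\<close>

lemma inner_symmetric_matrix:
  fixes A :: "real^'n^'n"
  assumes "transpose A = A"
  shows "u \<bullet> (A *v w) = (A *v u) \<bullet> w"
  by (metis assms dot_lmul_matrix transpose_matrix_vector)

text \<open>Moving from v by - s A v changes the form by s^2 c - 2 s |A v|^2; nonnegativity for
  small s > 0 leaves no room unless A v = 0.\<close>

lemma psd_inner_eq_0_iff:
  fixes A :: "real^'p::{finite,wellorder}^'p::{finite,wellorder}"
  assumes A: "transpose A = A" "psd_matrix A"
  shows "v \<bullet> (A *v v) = 0 \<longleftrightarrow> A *v v = 0"
proof
  assume 0: "v \<bullet> (A *v v) = 0"
  define w where "w = A *v v"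
  define c where "c = w \<bullet> (A *v w)"
  define a where "a = w \<bullet> w"
  have c: "c \<ge> 0" using A(2) by (simp add: c_def psd_matrix_def)
  have exp: "(v - s *\<^sub>R w) \<bullet> (A *v (v - s *\<^sub>R w)) = s\<^sup>2 * c - 2 * s * a" for s
  proof -
    have "v \<bullet> (A *v w) = a"
      using inner_symmetric_matrix[OF A(1), of v w] by (simp add: a_def w_def)
    then show ?thesis using 0
      by (simp add: matrix_vector_mult_diff_distrib inner_diff_left inner_diff_right
          matrix_vector_mult_scaleR c_def a_def w_def[symmetric] power2_eq_square algebra_simps)
  qed
  have a0: "a \<ge> 0" by (simp add: a_def)
  have "0 \<le> (a / (c + 1))\<^sup>2 * c - 2 * (a / (c + 1)) * a"
    using A(2) exp[of "a / (c + 1)"] unfolding psd_matrix_def by metis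
  also have "(a / (c + 1))\<^sup>2 * c - 2 * (a / (c + 1)) * a = - a\<^sup>2 * (c + 2) / (c + 1)\<^sup>2"
    using c by (simp add: divide_simps power2_eq_square) (simp add: algebra_simps)
  finally have "a\<^sup>2 * (c + 2) / (c + 1)\<^sup>2 \<le> 0" by simp
  then have "a = 0"
    using c by (simp add: divide_le_0_iff mult_le_0_iff power2_eq_square zero_le_mult_iff) (auto simp: mult_le_0_iff add_nonneg_eq_0_iff)
  then show "A *v v = 0" by (simp add: a_def w_def)
qed simp

text \<open>\<open>psd_matrix\<close> constrains only the quadratic form, hence only the symmetric
  part of a matrix; the roots selected by \<open>msqrt\<close> are symmetric as well.\<close>

definition psd_cone :: "(real^'p::{finite,wellorder}^'p::{finite,wellorder}) set" where
  "psd_cone = {A. transpose A = A \<and> psd_matrix A}"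

text \<open>Stands in for the spectral theorem. If c is the minimum of the form on the unit sphere,
  A - c I is positive semidefinite and its form vanishes at the minimiser v, so v lies in its
  kernel.\<close>

lemma psd_rayleigh_min:
  fixes A :: "real^'p::{finite,wellorder}^'p::{finite,wellorder}"
  assumes "transpose A = A"
  obtains v c where "norm v = 1" "A *v v = c *\<^sub>R v" "\<And>u. c * (u \<bullet> u) \<le> u \<bullet> (A *v u)"
proof -
  have "continuous_on (sphere 0 1) (\<lambda>v::real^'p::{finite,wellorder}. v \<bullet> (A *v v))"
    by (intro continuous_intros matrix_vector_mult_linear_continuous_on linear_continuous_on)
  moreover have "sphere (0::real^'p::{finite,wellorder}) 1 \<noteq> {}" by (simp)
  ultimately obtain v where v: "v \<in> sphere 0 1"
    and min: "\<And>u. u \<in> sphere 0 1 \<Longrightarrow> v \<bullet> (A *v v) \<le> u \<bullet> (A *v u)"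
    using continuous_attains_inf[OF compact_sphere] by blast
  define c where "c = v \<bullet> (A *v v)"
  have nv: "norm v = 1" using v by simp
  have low: "c * (u \<bullet> u) \<le> u \<bullet> (A *v u)" for u
  proof (cases "u = 0")
    case False
    define w where "w = (1 / norm u) *\<^sub>R u"
    have u: "u = norm u *\<^sub>R w" using False by (simp add: w_def)
    have "c \<le> w \<bullet> (A *v w)" unfolding c_def using False by (intro min) (simp add: w_def)
    then have "(norm u)\<^sup>2 * c \<le> (norm u)\<^sup>2 * (w \<bullet> (A *v w))" by (intro mult_left_mono) auto
    also have "\<dots> = u \<bullet> (A *v u)"
      by (subst (2 3) u) (simp add: matrix_vector_mult_scaleR power2_eq_square)
    finally show ?thesis by (simp add: power2_norm_eq_inner mult.commute)
  qed simp
  define B where "B = A - mat c"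
  have mc: "mat c *v u = c *\<^sub>R u" for u :: "real^'p::{finite,wellorder}"
    by (simp add: vec_eq_iff matrix_vector_mult_def mat_def if_distrib if_distribR cong: if_cong)
  have Bu: "B *v u = A *v u - c *\<^sub>R u" for u
    by (simp add: B_def matrix_vector_mult_diff_rdistrib mc)
  have "transpose B = B"
    using assms by (auto simp: B_def transpose_def mat_def vec_eq_iff)
  moreover have "psd_matrix B"
    using low by (simp add: psd_matrix_def Bu inner_diff_right)
  moreover have "v \<bullet> (B *v v) = 0"
    using nv by (simp add: Bu inner_diff_right c_def flip: power2_norm_eq_inner)
  ultimately have "B *v v = 0" using psd_inner_eq_0_iff by blast
  then have "A *v v = c *\<^sub>R v" by (simp add: Bu)
  with nv low show ?thesis using that by blast
qed

text \<open>Induction on the rank, p minus the dimension of the kernel. Subtracting l v v' for the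
  largest eigenvalue l enlarges the kernel, and adding sqrt l v v' to a root of the remainder gives
  a root of A.\<close>

lemma psd_sqrt_exists:
  fixes A :: "real^'p::{finite,wellorder}^'p::{finite,wellorder}"
  assumes "A \<in> psd_cone"
  shows "\<exists>S\<in>psd_cone. S ** S = A"
  using assms
proof (induction "CARD('p) - dim {v. A *v v = 0}" arbitrary: A rule: less_induct)
  case less
  note A = less.prems[unfolded psd_cone_def, simplified]
  \<comment> \<open>The minimum for - A is the largest eigenvalue of A, so that l = 0 already forces
    A = 0.\<close>
  have "transpose (- A) = - A" using A by (simp add: transpose_def vec_eq_iff)
  then obtain v c where v: "norm v = 1" "(- A) *v v = c *\<^sub>R v"
    and low: "\<And>u. c * (u \<bullet> u) \<le> u \<bullet> ((- A) *v u)"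
    using psd_rayleigh_min[of "- A"] by blast
  define l where "l = - c"
  have neg: "(- A) *v u = - (A *v u)" for u
    by (simp add: vec_eq_iff matrix_vector_mult_def sum_negf)
  have Av: "A *v v = l *\<^sub>R v" using v(2) unfolding neg by (simp add: l_def) (metis minus_equation_iff scaleR_minus_left)
  have up: "u \<bullet> (A *v u) \<le> l * (u \<bullet> u)" for u using low[of u] unfolding neg by (simp add: l_def)
  have vv: "v \<bullet> v = 1" using v(1) by (simp flip: power2_norm_eq_inner)
  have l0: "l \<ge> 0"
    using A Av vv unfolding psd_matrix_def by (metis inner_scaleR_right mult.right_neutral)
  show ?case
  proof (cases "l = 0")
    case True
    have "u \<bullet> (A *v u) = 0" for u
      using up[of u] A True unfolding psd_matrix_def by (simp add: order_antisym)
    then have "A *v u = 0" for u using psd_inner_eq_0_iff A by blast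
    then have "A = 0" by (metis matrix_eq matrix_vector_mult_0)
    then have "A \<in> psd_cone \<and> A ** A = A"
      using less.prems by (simp add: matrix_matrix_mult_def vec_eq_iff)
    then show ?thesis by blast
  next
    case False
    define P where "P = (\<chi> i j. v $ i * v $ j)"
    have Pu: "P *v u = (v \<bullet> u) *\<^sub>R v" for u
      by (simp add: P_def vec_eq_iff matrix_vector_mult_def inner_vec_def sum_distrib_left sum_distrib_right mult_ac)
    have trP: "transpose P = P" by (simp add: P_def transpose_def mult.commute)
    define B where "B = A - l *\<^sub>R P"
    have Bu: "B *v u = A *v u - (l * (v \<bullet> u)) *\<^sub>R v" for u
      by (simp add: B_def matrix_vector_mult_diff_rdistrib Pu flip: scaleR_matrix_vector_assoc)
    have trB: "transpose B = B"
      using A trP by (simp add: B_def transpose_def vec_eq_iff)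
    have vA: "v \<bullet> (A *v u) = l * (v \<bullet> u)" for u
      using inner_symmetric_matrix[of A v u] A Av by simp
    have psdB: "psd_matrix B"
      unfolding psd_matrix_def
    proof
      fix u
      define w where "w = u - (v \<bullet> u) *\<^sub>R v"
      have "w \<bullet> (A *v w) = u \<bullet> (B *v u)"
        by (simp add: w_def Bu matrix_vector_mult_diff_distrib matrix_vector_mult_scaleR Av vA vv
            inner_diff_left inner_diff_right inner_commute[of u v] algebra_simps)
      then show "0 \<le> u \<bullet> (B *v u)" using A unfolding psd_matrix_def by metis
    qed
    have Bv: "B *v v = 0" by (simp add: Bu Av vv)
    have sub: "{u. A *v u = 0} \<subseteq> {u. B *v u = 0}"
    proof
      fix u assume "u \<in> {u. A *v u = 0}"
      then have 1: "A *v u = 0" by simp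
      then have "l * (v \<bullet> u) = 0" using vA[of u] by simp
      then show "u \<in> {u. B *v u = 0}" using 1 by (simp add: Bu)
    qed
    have sp: "span {u. C *v u = 0} = {u. C *v u = 0}" for C :: "real^'p::{finite,wellorder}^'p::{finite,wellorder}"
      by (auto simp: subspace_def matrix_vector_right_distrib matrix_vector_mult_scaleR)
    have "v \<notin> {u. A *v u = 0}" using Av False v(1) by auto
    then have "{u. A *v u = 0} \<subset> {u. B *v u = 0}" using sub Bv by blast
    then have "dim {u. A *v u = 0} < dim {u. B *v u = 0}"
      by (intro dim_psubset) (simp add: sp)
    moreover have "dim {u. B *v u = 0} \<le> CARD('p)"
      by (metis dim_subset_UNIV DIM_cart DIM_real mult.right_neutral)
    ultimately have "CARD('p) - dim {u. B *v u = 0} < CARD('p) - dim {u. A *v u = 0}" by linarith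
    moreover have "B \<in> psd_cone" using trB psdB by (simp add: psd_cone_def)
    ultimately obtain T where T: "T \<in> psd_cone" "T ** T = B" using less.hyps by blast
    have trT: "transpose T = T" "psd_matrix T" using T(1) by (auto simp: psd_cone_def)
    \<comment> \<open>The root T of the remainder kills v, because |T v|^2 is the form of B at v.
      Hence the mixed products in S ** S vanish.\<close>
    have "(T *v v) \<bullet> (T *v v) = v \<bullet> (B *v v)"
      by (simp add: T(2)[symmetric] inner_symmetric_matrix[OF trT(1)] flip: matrix_vector_mul_assoc)
    then have Tv: "T *v v = 0" by (simp add: Bv)
    have vT: "v \<bullet> (T *v u) = 0" for u using inner_symmetric_matrix[OF trT(1), of v u] Tv by simp
    define S where "S = T + sqrt l *\<^sub>R P"
    have Su: "S *v u = T *v u + (sqrt l * (v \<bullet> u)) *\<^sub>R v" for u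
      by (simp add: S_def matrix_vector_mult_add_rdistrib Pu flip: scaleR_matrix_vector_assoc)
    have "transpose S = S" using trT trP by (simp add: S_def transpose_def vec_eq_iff)
    moreover have "psd_matrix S"
      using trT(2) l0 unfolding psd_matrix_def Su
      by (auto simp: inner_add_right inner_commute mult.assoc intro!: add_nonneg_nonneg)
    moreover have "S ** S = A"
    proof -
      have "(S ** S) *v u = A *v u" for u
      proof -
        have "(S ** S) *v u = T *v (T *v u) + l *\<^sub>R ((v \<bullet> u) *\<^sub>R v)"
          using l0 by (simp add: Su matrix_vector_right_distrib matrix_vector_mult_scaleR Tv vT vv
              inner_add_right flip: matrix_vector_mul_assoc)
        also have "T *v (T *v u) = B *v u" by (simp add: matrix_vector_mul_assoc T(2))
        finally show ?thesis by (simp add: Bu)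
      qed
      then show ?thesis by (simp add: matrix_eq)
    qed
    ultimately show ?thesis by (auto simp: psd_cone_def)
  qed
qed

lemma norm_matrix_squared:
  fixes D :: "real^'n^'m"
  shows "(norm D)\<^sup>2 = (\<Sum>i\<in>UNIV. (norm (D $ i))\<^sup>2)"
  by (simp add: power2_norm_eq_inner inner_vec_def[of D])

lemma trace_sandwich:
  fixes D S :: "real^'n^'n"
  assumes "transpose D = D"
  shows "trace (D ** S ** D) = (\<Sum>i\<in>UNIV. D $ i \<bullet> (S *v D $ i))"
proof -
  have D: "D $ l $ i = D $ i $ l" for i l using assms by (metis transpose_def vec_lambda_beta)
  show ?thesis
    unfolding matrix_mul_assoc[symmetric]
    by (simp add: trace_def matrix_matrix_mult_def inner_vec_def matrix_vector_mult_def)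
      (simp add: D[of _ ])
qed

text \<open>With D = S - T one has S^2 - T^2 = S D + D T, and the Frobenius product with D gives
  trace (D S D) + trace (D T D). For semidefinite S and T both terms are nonnegative; uniqueness and
  the Lipschitz bound for roots follow from this.\<close>

lemma psd_sqrt_difference:
  fixes S T :: "real^'p::{finite,wellorder}^'p::{finite,wellorder}"
  assumes "transpose S = S" "transpose T = T"
  shows "(\<Sum>i\<in>UNIV. (S - T) $ i \<bullet> (S *v (S - T) $ i)) + (\<Sum>i\<in>UNIV. (S - T) $ i \<bullet> (T *v (S - T) $ i))
    = (S - T) \<bullet> (S ** S - T ** T)"
proof -
  define D where "D = S - T"
  have trD: "transpose D = D" using assms by (simp add: D_def transpose_def vec_eq_iff)
  have D: "D $ l $ i = D $ i $ l" for i l using trD by (metis transpose_def vec_lambda_beta)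
  have eq: "S ** S - T ** T = S ** D + D ** T"
    by (simp add: matrix_eq D_def matrix_vector_mult_diff_rdistrib matrix_vector_mult_add_rdistrib
        matrix_vector_mult_diff_distrib flip: matrix_vector_mul_assoc)
  have "D \<bullet> (S ** S - T ** T) = trace (D ** (S ** S - T ** T))"
    by (simp add: inner_vec_def trace_def matrix_matrix_mult_def)
      (subst sum.swap, simp add: D)
  also have "\<dots> = trace (D ** S ** D) + trace (D ** T ** D)"
    using trace_mul_sym[of D "D ** T"] by (simp add: eq matrix_add_ldistrib trace_add matrix_mul_assoc)
  finally show ?thesis unfolding trace_sandwich[OF trD] by (simp add: D_def)
qed

text \<open>Both nonnegative terms of \<open>psd_sqrt_difference\<close> vanish, so S and T
  annihilate every row of S - T. Then (S - T)^2 = 0, and a symmetric matrix with zero square is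
  zero.\<close>

lemma psd_sqrt_unique:
  fixes S T :: "real^'p::{finite,wellorder}^'p::{finite,wellorder}"
  assumes "S \<in> psd_cone" "T \<in> psd_cone" "S ** S = T ** T"
  shows "S = T"
proof -
  have *: "transpose S = S" "psd_matrix S" "transpose T = T" "psd_matrix T"
    using assms by (auto simp: psd_cone_def)
  define D where "D = S - T"
  have "(\<Sum>i\<in>UNIV. D $ i \<bullet> (S *v D $ i)) + (\<Sum>i\<in>UNIV. D $ i \<bullet> (T *v D $ i)) = 0"
    using psd_sqrt_difference[OF *(1,3)] assms(3) by (simp add: D_def)
  moreover have "(\<Sum>i\<in>UNIV. D $ i \<bullet> (S *v D $ i)) \<ge> 0" "(\<Sum>i\<in>UNIV. D $ i \<bullet> (T *v D $ i)) \<ge> 0"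
    using * by (auto intro!: sum_nonneg simp: psd_matrix_def)
  ultimately have "(\<Sum>i\<in>UNIV. D $ i \<bullet> (S *v D $ i)) = 0" "(\<Sum>i\<in>UNIV. D $ i \<bullet> (T *v D $ i)) = 0"
    by linarith+
  then have "D $ i \<bullet> (S *v D $ i) = 0" "D $ i \<bullet> (T *v D $ i) = 0" for i
    using * by (simp_all add: sum_nonneg_eq_0_iff psd_matrix_def)
  then have "S *v D $ i = 0" "T *v D $ i = 0" for i
    using psd_inner_eq_0_iff * by blast+
  then have "D *v D $ i = 0" for i by (simp add: D_def matrix_vector_mult_diff_rdistrib)
  moreover have trD: "transpose D = D" using * by (simp add: D_def transpose_def vec_eq_iff)
  ultimately have "(D *v D $ i) $ i = 0" for i by simp
  then have "D $ i \<bullet> D $ i = 0" for i by (simp add: matrix_vector_mult_def inner_vec_def)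
  then have "D = 0" by (simp add: vec_eq_iff)
  then show ?thesis by (simp add: D_def)
qed

lemma msqrt_eqI:
  assumes "S \<in> psd_cone" "S ** S = A"
  shows "msqrt A = S"
  unfolding msqrt_def
  by (rule the_equality) (use assms psd_sqrt_unique in \<open>auto simp: psd_cone_def\<close>)

lemma msqrt_psd:
  assumes "A \<in> psd_cone"
  shows "msqrt A \<in> psd_cone" "msqrt A ** msqrt A = A"
proof -
  obtain S where "S \<in> psd_cone" "S ** S = A" using psd_sqrt_exists[OF assms] by blast
  with msqrt_eqI[OF this] show "msqrt A \<in> psd_cone" "msqrt A ** msqrt A = A" by auto
qed

lemma msqrt_scaleR:
  assumes "A \<in> psd_cone" "c \<ge> 0"
  shows "msqrt (c *\<^sub>R A) = sqrt c *\<^sub>R msqrt A"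
proof (rule msqrt_eqI)
  note S = msqrt_psd[OF assms(1)]
  show "sqrt c *\<^sub>R msqrt A \<in> psd_cone" using S(1) assms(2)
    by (auto simp: psd_cone_def psd_matrix_def transpose_def vec_eq_iff simp flip: scaleR_matrix_vector_assoc)
  show "sqrt c *\<^sub>R msqrt A ** (sqrt c *\<^sub>R msqrt A) = c *\<^sub>R A"
    using assms(2) by (simp add: matrix_eq matrix_vector_mult_scaleR
        flip: matrix_vector_mul_assoc scaleR_matrix_vector_assoc)
      (simp add: matrix_vector_mul_assoc S(2))
qed

text \<open>The least eigenvalue c of the root squares to an eigenvalue of A, so c^2 is at least
  g.\<close>

lemma msqrt_lower:
  assumes A: "A \<in> psd_cone" and low: "\<And>v. g * (v \<bullet> v) \<le> v \<bullet> (A *v v)" and g: "g \<ge> 0"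
  shows "sqrt g * (v \<bullet> v) \<le> v \<bullet> (msqrt A *v v)"
proof -
  note S = msqrt_psd[OF A]
  have tr: "transpose (msqrt A) = msqrt A" and psd: "psd_matrix (msqrt A)"
    using S(1) by (auto simp: psd_cone_def)
  obtain w c where w: "norm w = 1" "msqrt A *v w = c *\<^sub>R w"
    and c: "\<And>u. c * (u \<bullet> u) \<le> u \<bullet> (msqrt A *v u)"
    using psd_rayleigh_min[OF tr] by blast
  have ww: "w \<bullet> w = 1" using w(1) by (simp flip: power2_norm_eq_inner)
  have c0: "c \<ge> 0" using psd w(2) ww unfolding psd_matrix_def
    by (metis inner_scaleR_right mult.right_neutral)
  have "A *v w = c\<^sup>2 *\<^sub>R w"
    by (subst S(2)[symmetric])
      (simp add: w(2) matrix_vector_mult_scaleR power2_eq_square flip: matrix_vector_mul_assoc)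
  with low[of w] ww have "g \<le> c\<^sup>2" by simp
  then have "sqrt g \<le> c" using c0 by (simp add: real_le_lsqrt)
  then have "sqrt g * (v \<bullet> v) \<le> c * (v \<bullet> v)" by (intro mult_right_mono) auto
  also have "\<dots> \<le> v \<bullet> (msqrt A *v v)" by (rule c)
  finally show ?thesis .
qed

lemma msqrt_lipschitz:
  assumes A: "A \<in> psd_cone" and B: "B \<in> psd_cone" and s: "s > 0"
    and low: "\<And>v. s * (v \<bullet> v) \<le> v \<bullet> (msqrt B *v v)"
  shows "norm (msqrt A - msqrt B) \<le> norm (A - B) / s"
proof -
  note SA = msqrt_psd[OF A] and SB = msqrt_psd[OF B]
  define D where "D = msqrt B - msqrt A"
  have *: "transpose (msqrt A) = msqrt A" "psd_matrix (msqrt A)" "transpose (msqrt B) = msqrt B"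
    using SA SB by (auto simp: psd_cone_def)
  have "s * (norm D)\<^sup>2 = (\<Sum>i\<in>UNIV. s * (D $ i \<bullet> D $ i))"
    by (simp add: norm_matrix_squared sum_distrib_left power2_norm_eq_inner)
  also have "\<dots> \<le> (\<Sum>i\<in>UNIV. D $ i \<bullet> (msqrt B *v D $ i))" by (intro sum_mono low)
  also have "\<dots> \<le> (\<Sum>i\<in>UNIV. D $ i \<bullet> (msqrt B *v D $ i)) + (\<Sum>i\<in>UNIV. D $ i \<bullet> (msqrt A *v D $ i))"
    using *(2) by (auto intro!: sum_nonneg simp: psd_matrix_def)
  also have "\<dots> = D \<bullet> (B - A)"
    using psd_sqrt_difference[OF *(3,1)] SA SB by (simp add: D_def)
  also have "\<dots> \<le> norm D * norm (B - A)" by (rule norm_cauchy_schwarz)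
  finally have "norm D * (s * norm D) \<le> norm D * norm (B - A)"
    by (simp add: power2_eq_square algebra_simps)
  then have "s * norm D \<le> norm (B - A)"
    by (cases "D = 0") auto
  then show ?thesis using s
    by (simp add: D_def norm_minus_commute pos_le_divide_eq mult.commute)
qed

lemma closed_psd_cone: "closed (psd_cone :: (real^'p::{finite,wellorder}^'p::{finite,wellorder}) set)"
proof -
  have eq: "psd_cone = {A::real^'p::{finite,wellorder}^'p::{finite,wellorder}. transpose A = A} \<inter> (\<Inter>v. {A. 0 \<le> v \<bullet> (A *v v)})"
    by (auto simp: psd_cone_def psd_matrix_def)
  show ?thesis
    unfolding eq
    by (intro closed_Int closed_INT ballI closed_Collect_le closed_Collect_eq continuous_intros)
      (auto simp: transpose_def matrix_vector_mult_def intro!: continuous_intros continuous_on_vec_lambda)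
qed

lemma norm_msqrt:
  assumes "A \<in> psd_cone"
  shows "(norm (msqrt A))\<^sup>2 = trace A"
proof -
  note S = msqrt_psd[OF assms]
  define T where "T = msqrt A"
  have "transpose T = T" using S by (simp add: psd_cone_def T_def)
  then have D: "T $ l $ i = T $ i $ l" for i l by (metis transpose_def vec_lambda_beta)
  have "trace A = trace (T ** T)" by (simp add: S T_def)
  also have "\<dots> = T \<bullet> T" by (simp add: trace_def matrix_matrix_mult_def inner_vec_def D)
  finally show ?thesis by (simp add: power2_norm_eq_inner T_def)
qed

text \<open>The Lipschitz bound degenerates at singular matrices, so continuity comes from
  compactness: squaring is continuous and injective on the bounded part of the cone, hence has a
  continuous inverse. By \<open>norm_msqrt\<close> a trace bound on A is a norm bound on its
  root.\<close>

lemma continuous_on_msqrt_bounded: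
  "continuous_on {A \<in> psd_cone. trace A \<le> r} (msqrt :: real^'p::{finite,wellorder}^'p::{finite,wellorder} \<Rightarrow> _)"
proof (cases "r \<ge> 0")
  case True
  define C where "C = psd_cone \<inter> cball (0::real^'p::{finite,wellorder}^'p::{finite,wellorder}) (sqrt r)"
  have "continuous_on C (\<lambda>S. S ** S)"
    by (auto simp: matrix_matrix_mult_def intro!: continuous_intros continuous_on_vec_lambda)
  moreover have "compact C" by (simp add: C_def closed_Int_compact closed_psd_cone)
  moreover have "\<forall>S\<in>C. msqrt (S ** S) = S" by (auto simp: C_def intro: msqrt_eqI)
  ultimately have "continuous_on ((\<lambda>S. S ** S) ` C) msqrt" by (rule continuous_on_inv)
  moreover have "{A \<in> psd_cone. trace A \<le> r} \<subseteq> (\<lambda>S. S ** S) ` C"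
  proof
    fix A :: "real^'p::{finite,wellorder}^'p::{finite,wellorder}" assume "A \<in> {A \<in> psd_cone. trace A \<le> r}"
    then have A: "A \<in> psd_cone" "trace A \<le> r" by auto
    have "norm (msqrt A) \<le> sqrt r"
      using norm_msqrt[OF A(1)] A(2) by (simp add: real_le_rsqrt)
    then show "A \<in> (\<lambda>S. S ** S) ` C"
      using msqrt_psd[OF A(1)] by (auto simp: C_def image_iff intro!: bexI[of _ "msqrt A"])
  qed
  ultimately show ?thesis by (rule continuous_on_subset)
next
  case False
  have "{A \<in> psd_cone. trace A \<le> r} = ({} :: (real^'p::{finite,wellorder}^'p::{finite,wellorder}) set)"
    using False norm_msqrt by (smt (verit) Collect_empty_eq zero_le_power2)
  then show ?thesis by (metis continuous_on_empty)
qed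

lemma borel_measurable_msqrt:
  fixes f :: "'a \<Rightarrow> real^'p::{finite,wellorder}^'p::{finite,wellorder}"
  assumes [measurable]: "f \<in> borel_measurable M" and f: "\<And>x. x \<in> space M \<Longrightarrow> f x \<in> psd_cone"
  shows "(\<lambda>x. msqrt (f x)) \<in> borel_measurable M"
proof -
  define C where "C n = {A \<in> psd_cone. trace (A::real^'p::{finite,wellorder}^'p::{finite,wellorder}) \<le> real n}" for n
  define G where "G n A = (if A \<in> C n then msqrt A else 0)" for n and A :: "real^'p::{finite,wellorder}^'p::{finite,wellorder}"
  have ct: "continuous_on UNIV (trace :: real^'p::{finite,wellorder}^'p::{finite,wellorder} \<Rightarrow> real)"
    by (auto simp: trace_def[abs_def] intro!: continuous_intros)
  have closed: "closed (C n)" for n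
  proof -
    have "C n = psd_cone \<inter> {A. trace A \<le> real n}" by (auto simp: C_def)
    then show ?thesis by (simp add: closed_Int closed_psd_cone closed_Collect_le ct)
  qed
  have [measurable]: "G n \<in> borel_measurable borel" for n
    unfolding G_def using closed[of n] continuous_on_msqrt_bounded[of "real n"]
    by (intro borel_measurable_continuous_on_if) (auto simp: C_def)
  have [measurable]: "trace \<in> borel_measurable (borel :: (real^'p::{finite,wellorder}^'p::{finite,wellorder}) measure)"
    using ct by (rule borel_measurable_continuous_onI)
  \<comment> \<open>Countably many continuous pieces are glued; the index is itself measurable and
    picks the least n with f x in C n.\<close>
  have "(\<lambda>x. G (nat \<lceil>trace (f x)\<rceil>) (f x)) \<in> borel_measurable M"
    by (rule measurable_compose_countable) measurable
  moreover have "G (nat \<lceil>trace (f x)\<rceil>) (f x) = msqrt (f x)" if "x \<in> space M" for x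
    using f[OF that] by (simp add: G_def C_def) linarith
  ultimately show ?thesis by (simp cong: measurable_cong)
qed

section \<open>Uniform convergence of distribution functions on lower orthants\<close>

inductive trig_polynomial :: "(real^'n \<Rightarrow> complex) \<Rightarrow> bool" where
  exp: "trig_polynomial (\<lambda>x. c * iexp (l \<bullet> x))"
| add: "trig_polynomial f \<Longrightarrow> trig_polynomial g \<Longrightarrow> trig_polynomial (\<lambda>x. f x + g x)"

lemma trig_polynomial_mult:
  assumes "trig_polynomial f" "trig_polynomial g"
  shows "trig_polynomial (\<lambda>x. f x * g x)"
  using assms
proof (induction f)
  case (exp c l)
  from exp show ?case
  proof (induction g)
    case (exp d m)
    show ?case using trig_polynomial.exp[of "c * d" "l + m"]
      by (simp add: exp_add inner_add_left algebra_simps)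
  next
    case (add f g)
    then show ?case using trig_polynomial.add by (fastforce simp: distrib_left)
  qed
next
  case (add f g)
  then show ?case using trig_polynomial.add by (fastforce simp: distrib_right)
qed

lemma trig_polynomial_const: "trig_polynomial (\<lambda>x. c)"
  using trig_polynomial.exp[of c 0] by simp

lemma trig_polynomial_prod:
  assumes "finite I" "\<And>i. i \<in> I \<Longrightarrow> trig_polynomial (f i)"
  shows "trig_polynomial (\<lambda>x. \<Prod>i\<in>I. f i x)"
  using assms by (induction I) (auto intro: trig_polynomial_const trig_polynomial_mult)

lemma trig_polynomial_sin: "trig_polynomial (\<lambda>x::real^'n. complex_of_real (sin (x $ i / \<rho>)))"
proof -
  have "trig_polynomial (\<lambda>x::real^'n. (-\<i>/2) * iexp (axis i (1/\<rho>) \<bullet> x) + (\<i>/2) * iexp (axis i (-1/\<rho>) \<bullet> x))"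
    by (intro trig_polynomial.intros)
  also have "(\<lambda>x::real^'n. (-\<i>/2) * iexp (axis i (1/\<rho>) \<bullet> x) + (\<i>/2) * iexp (axis i (-1/\<rho>) \<bullet> x))
    = (\<lambda>x. complex_of_real (sin (x $ i / \<rho>)))"
    by (auto simp: fun_eq_iff inner_axis' complex_eq_iff Re_exp Im_exp)
  finally show ?thesis .
qed

lemma trig_polynomial_sin_poly:
  assumes "real_polynomial_function q"
  shows "trig_polynomial (\<lambda>x::real^'n. complex_of_real (q (sin (x $ i / \<rho>))))"
  using assms
proof (induction q)
  case (linear f)
  have "f s = f 1 * s" for s
    using linear_cmul[OF bounded_linear.linear[OF linear], of s 1] by simp
  then have "(\<lambda>x. complex_of_real (f (sin (x $ i / \<rho>))))
      = (\<lambda>x::real^'n. complex_of_real (f 1) * complex_of_real (sin (x $ i / \<rho>)))"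
    by (metis of_real_mult)
  then show ?case using trig_polynomial_mult[OF trig_polynomial_const trig_polynomial_sin] by simp
next
  case (const c)
  show ?case by (rule trig_polynomial_const)
next
  case (add f g)
  then show ?case using trig_polynomial.add by fastforce
next
  case (mult f g)
  then show ?case using trig_polynomial_mult by fastforce
qed

lemma trig_polynomial_continuous: "trig_polynomial f \<Longrightarrow> continuous_on UNIV f"
  by (induction rule: trig_polynomial.induct) (auto intro!: continuous_intros)

lemma trig_polynomial_measurable [measurable_dest]:
  "trig_polynomial f \<Longrightarrow> f \<in> borel_measurable borel"
  by (intro borel_measurable_continuous_onI trig_polynomial_continuous)

lemma trig_polynomial_bounded: "trig_polynomial f \<Longrightarrow> \<exists>B. \<forall>x. cmod (f x) \<le> B"
proof (induction rule: trig_polynomial.induct)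
  case (exp c l)
  then show ?case by (auto simp: norm_mult)
next
  case (add f g)
  then show ?case by (meson norm_triangle_le add_mono)
qed

lemma (in prob_space) trig_polynomial_integrable:
  assumes "trig_polynomial f" and [measurable]: "X \<in> borel_measurable M"
  shows "integrable M (\<lambda>\<omega>. f (X \<omega>))"
proof -
  note [measurable] = trig_polynomial_measurable[OF assms(1)]
  obtain B where "\<And>x. cmod (f x) \<le> B" using trig_polynomial_bounded[OF assms(1)] by blast
  then show ?thesis by (intro integrable_const_bound[of _ B]) auto
qed

lemma (in prob_space) trig_polynomial_convergence:
  fixes W :: "'i \<Rightarrow> 'a \<Rightarrow> real^'n" and N :: "(real^'n) measure"
  assumes N: "prob_space N" "sets N = sets borel"
    and W [measurable]: "\<And>i. W i \<in> borel_measurable M"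
    and cf: "\<And>l. ((\<lambda>i. \<integral>\<omega>. iexp (l \<bullet> W i \<omega>) \<partial>M) \<longlongrightarrow> (\<integral>x. iexp (l \<bullet> x) \<partial>N)) F"
    and f: "trig_polynomial f" and "\<epsilon> > 0"
  shows "\<forall>\<^sub>F i in F. \<forall>t. cmod ((\<integral>\<omega>. f (W i \<omega> - t) \<partial>M) - (\<integral>x. f (x - t) \<partial>N)) < \<epsilon>"
  using f \<open>\<epsilon> > 0\<close>
proof (induction arbitrary: \<epsilon>)
  case (exp c l)
  \<comment> \<open>The added 1 covers c = 0.\<close>
  have "\<epsilon> / (cmod c + 1) > 0" using exp by (simp add: add_nonneg_pos)
  then have "\<forall>\<^sub>F i in F. dist (\<integral>\<omega>. iexp (l \<bullet> W i \<omega>) \<partial>M) (\<integral>x. iexp (l \<bullet> x) \<partial>N) < \<epsilon> / (cmod c + 1)"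
    by (rule tendstoD[OF cf])
  then show ?case
  proof (eventually_elim, intro allI)
    fix i and t :: "real^'n"
    assume *: "dist (\<integral>\<omega>. iexp (l \<bullet> W i \<omega>) \<partial>M) (\<integral>x. iexp (l \<bullet> x) \<partial>N) < \<epsilon> / (cmod c + 1)"
    have eq: "c * iexp (l \<bullet> (x - t)) = (c * iexp (- (l \<bullet> t))) * iexp (l \<bullet> x)" for x
      by (simp add: inner_diff_right exp_diff exp_minus field_simps)
    have "cmod ((\<integral>\<omega>. c * iexp (l \<bullet> (W i \<omega> - t)) \<partial>M) - (\<integral>x. c * iexp (l \<bullet> (x - t)) \<partial>N))
      = cmod (c * iexp (- (l \<bullet> t)) * ((\<integral>\<omega>. iexp (l \<bullet> W i \<omega>) \<partial>M) - (\<integral>x. iexp (l \<bullet> x) \<partial>N)))"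
      unfolding eq by (simp add: right_diff_distrib)
    also have "\<dots> = cmod c * dist (\<integral>\<omega>. iexp (l \<bullet> W i \<omega>) \<partial>M) (\<integral>x. iexp (l \<bullet> x) \<partial>N)"
      by (simp add: norm_mult dist_norm)
    also have "\<dots> \<le> cmod c * (\<epsilon> / (cmod c + 1))" using * by (intro mult_left_mono) auto
    also have "\<dots> < \<epsilon>" using exp by (simp add: divide_simps add_nonneg_pos)
    finally show "cmod ((\<integral>\<omega>. c * iexp (l \<bullet> (W i \<omega> - t)) \<partial>M) - (\<integral>x. c * iexp (l \<bullet> (x - t)) \<partial>N)) < \<epsilon>" .
  qed
next
  case (add f g)
  interpret N: prob_space N by fact
  have [measurable]: "(\<lambda>x. x - t) \<in> borel_measurable N" for t
    using N(2) by (simp cong: measurable_cong_sets)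
  have int: "integrable M (\<lambda>\<omega>. h (W i \<omega> - t))" "integrable N (\<lambda>x. h (x - t))"
    if "trig_polynomial h" for h i t
    using trig_polynomial_integrable[OF that, of "\<lambda>\<omega>. W i \<omega> - t"]
      N.trig_polynomial_integrable[OF that, of "\<lambda>x. x - t"] by auto
  have "\<epsilon> / 2 > 0" using add by simp
  from add.IH(1)[OF this] add.IH(2)[OF this] show ?case
  proof (eventually_elim, intro allI)
    fix i and t :: "real^'n"
    assume *: "\<forall>t. cmod ((\<integral>\<omega>. f (W i \<omega> - t) \<partial>M) - (\<integral>x. f (x - t) \<partial>N)) < \<epsilon> / 2"
      "\<forall>t. cmod ((\<integral>\<omega>. g (W i \<omega> - t) \<partial>M) - (\<integral>x. g (x - t) \<partial>N)) < \<epsilon> / 2"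
    have "(\<integral>\<omega>. f (W i \<omega> - t) + g (W i \<omega> - t) \<partial>M) - (\<integral>x. f (x - t) + g (x - t) \<partial>N)
      = ((\<integral>\<omega>. f (W i \<omega> - t) \<partial>M) - (\<integral>x. f (x - t) \<partial>N)) + ((\<integral>\<omega>. g (W i \<omega> - t) \<partial>M) - (\<integral>x. g (x - t) \<partial>N))"
      using int add.hyps by simp
    also have "cmod \<dots> < \<epsilon> / 2 + \<epsilon> / 2"
      using * by (intro norm_triangle_lt add_strict_mono) auto
    finally show "cmod ((\<integral>\<omega>. f (W i \<omega> - t) + g (W i \<omega> - t) \<partial>M) - (\<integral>x. f (x - t) + g (x - t) \<partial>N)) < \<epsilon>"
      by simp
  qed
qed

text \<open>Composing with \<open>\<rho> * arcsin (sin (y / \<rho>))\<close> turns a ramp into a function that is uniformly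
  approximable by polynomials in \<open>sin (y / \<rho>)\<close> and agrees with the ramp on a large interval.\<close>

definition periodic_ramp :: "real \<Rightarrow> real \<Rightarrow> real \<Rightarrow> real" where
  "periodic_ramp \<delta> \<rho> y = max 0 (min 1 (1 - \<rho> * arcsin (sin (y / \<rho>)) / \<delta>))"

lemma periodic_ramp_bounds: "0 \<le> periodic_ramp \<delta> \<rho> y" "periodic_ramp \<delta> \<rho> y \<le> 1"
  by (auto simp: periodic_ramp_def)

lemma periodic_ramp_eq:
  assumes "\<bar>y\<bar> \<le> \<rho>" "\<rho> > 0"
  shows "periodic_ramp \<delta> \<rho> y = max 0 (min 1 (1 - y / \<delta>))"
proof -
  have "\<bar>y / \<rho>\<bar> \<le> 1" using assms by simp
  also have "1 \<le> pi / 2" using pi_ge_two by simp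
  finally have "arcsin (sin (y / \<rho>)) = y / \<rho>" by (intro arcsin_sin) linarith+
  then show ?thesis using assms by (simp add: periodic_ramp_def)
qed

text \<open>Weierstrass approximation of the clipped ramp in the variable s = sin (y / rho) on
  [-1, 1]. Dividing by 1 + eta / 2 brings the polynomial back to modulus at most 1, which the
  factorwise comparison of products over coordinates requires; half of eta is reserved for this
  division.\<close>

lemma periodic_ramp_approx:
  assumes "\<eta> > 0" "\<delta> > 0"
  obtains q where "real_polynomial_function q"
    "\<And>y. \<bar>q (sin (y / \<rho>))\<bar> \<le> 1" "\<And>y. \<bar>periodic_ramp \<delta> \<rho> y - q (sin (y / \<rho>))\<bar> \<le> \<eta>"
proof -
  define g where "g s = max 0 (min 1 (1 - \<rho> * arcsin s / \<delta>))" for s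
  have "continuous_on {-1..1} g" unfolding g_def using assms
    by (intro continuous_intros) auto
  then obtain q where q: "real_polynomial_function q" "\<And>s. s \<in> {-1..1} \<Longrightarrow> \<bar>g s - q s\<bar> < \<eta> / 2"
    using Stone_Weierstrass_real_polynomial_function[of "{-1..1}" g "\<eta> / 2"] assms by auto
  define r where "r = (\<lambda>s. (1 / (1 + \<eta> / 2)) * q s)"
  have r: "real_polynomial_function r" unfolding r_def
    by (intro real_polynomial_function.intros(4) real_polynomial_function.intros(2) q)
  have b: "\<bar>r s\<bar> \<le> 1 \<and> \<bar>g s - r s\<bar> \<le> \<eta>" if "s \<in> {-1..1}" for s
  proof -
    have g: "0 \<le> g s" "g s \<le> 1" by (auto simp: g_def)
    have q1: "\<bar>q s\<bar> \<le> 1 + \<eta> / 2" using q(2)[OF that] g by linarith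
    then have r1: "\<bar>r s\<bar> \<le> 1" using assms by (simp add: r_def abs_mult divide_simps)
    have "q s = (1 + \<eta> / 2) * r s" using assms by (simp add: r_def)
    then have "q s = r s + r s * (\<eta> / 2)" by (simp add: algebra_simps)
    moreover have "\<bar>r s * (\<eta> / 2)\<bar> \<le> \<eta> / 2" using r1 assms by (simp add: abs_mult)
    ultimately show ?thesis using r1 q(2)[OF that] by linarith
  qed
  show ?thesis
  proof (rule that[OF r])
    fix y :: real
    have "sin (y / \<rho>) \<in> {-1..1}" by simp
    from b[OF this] show "\<bar>r (sin (y / \<rho>))\<bar> \<le> 1" "\<bar>periodic_ramp \<delta> \<rho> y - r (sin (y / \<rho>))\<bar> \<le> \<eta>"
      by (auto simp: g_def periodic_ramp_def)
  qed
qed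

lemma periodic_ramp_measurable [measurable]: "periodic_ramp \<delta> \<rho> \<in> borel_measurable borel"
proof -
  have "continuous_on UNIV (\<lambda>y. arcsin (sin (y / \<rho>)))"
    unfolding divide_inverse by (intro continuous_intros) auto
  then have [measurable]: "(\<lambda>y. arcsin (sin (y / \<rho>))) \<in> borel_measurable borel"
    by (rule borel_measurable_continuous_onI)
  show ?thesis unfolding periodic_ramp_def by measurable
qed

lemma borel_measurable_vec_component [measurable (raw)]:
  fixes f :: "'a \<Rightarrow> real^'n"
  shows "f \<in> borel_measurable M \<Longrightarrow> (\<lambda>x. f x $ i) \<in> borel_measurable M"
  by (rule measurable_compose[OF _ borel_measurable_nth])

section \<open>Ramp bounds for lower orthants and uniform convergence\<close>

definition lower_orthant :: "real^'n \<Rightarrow> (real^'n) set" where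
  "lower_orthant t = {x. \<forall>i. x $ i \<le> t $ i}"

lemma lower_orthant_measurable [measurable]: "lower_orthant t \<in> sets (borel :: (real^'n) measure)"
proof -
  have "lower_orthant t = (\<Inter>i. {x. x $ i \<le> t $ i})" by (auto simp: lower_orthant_def)
  also have "closed \<dots>" by (intro closed_INT ballI closed_Collect_le continuous_intros)
  finally show ?thesis by simp
qed

text \<open>Where |X| <= R the product of ramps lies between the indicators of the orthants at s and
  at s + delta; elsewhere at most the tail probability is lost. The value 2 R + 2 bounds |X_i - s_i|
  there, and up to that distance the periodic ramp is the true ramp.\<close>

lemma (in prob_space) orthant_ramp_bounds:
  fixes X :: "'a \<Rightarrow> real^'n"
  assumes [measurable]: "X \<in> borel_measurable M"
    and s: "\<And>i. \<bar>s $ i\<bar> \<le> R + 2" and R: "R \<ge> 0" and \<delta>: "\<delta> > 0"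
  defines "G \<equiv> \<lambda>x. \<Prod>i\<in>UNIV. periodic_ramp \<delta> (2 * R + 2) (x $ i)"
  shows "prob {\<omega> \<in> space M. X \<omega> \<in> lower_orthant s}
      \<le> expectation (\<lambda>\<omega>. G (X \<omega> - s)) + prob {\<omega> \<in> space M. norm (X \<omega>) > R}"
    and "expectation (\<lambda>\<omega>. G (X \<omega> - s))
      \<le> prob {\<omega> \<in> space M. X \<omega> \<in> lower_orthant (s + (\<chi> i. \<delta>))} + prob {\<omega> \<in> space M. norm (X \<omega>) > R}"
proof -
  have G01: "0 \<le> G x" "G x \<le> 1" for x
    unfolding G_def using periodic_ramp_bounds by (auto intro!: prod_nonneg prod_le_1)
  have [measurable]: "(\<lambda>\<omega>. G (X \<omega> - s)) \<in> borel_measurable M" unfolding G_def by measurable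
  have intG: "integrable M (\<lambda>\<omega>. G (X \<omega> - s))"
    using G01 by (intro integrable_const_bound[of _ 1]) auto
  have intI: "integrable M (indicator {\<omega> \<in> space M. X \<omega> \<in> lower_orthant r} :: 'a \<Rightarrow> real)"
    "integrable M (indicator {\<omega> \<in> space M. norm (X \<omega>) > R} :: 'a \<Rightarrow> real)" for r
    by (auto intro!: integrable_const_bound[of _ 1])
  have ind: "prob {\<omega> \<in> space M. P \<omega>} = expectation (\<lambda>\<omega>. indicator {\<omega> \<in> space M. P \<omega>} \<omega>)" for P
    by (simp add: Int_def cong: conj_cong)
  have in_window: "\<bar>(x - s) $ i\<bar> \<le> 2 * R + 2" if "norm x \<le> R" for x i
    using component_le_norm_cart[of x i] that s[of i] by simp
  have 1: "indicator (lower_orthant s) x \<le> G (x - s)" if "norm x \<le> R" for x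
  proof (cases "x \<in> lower_orthant s")
    case True
    have "periodic_ramp \<delta> (2 * R + 2) ((x - s) $ i) = 1" for i
      using periodic_ramp_eq[OF in_window[OF that, of i]] R \<delta> True
      by (auto simp: lower_orthant_def divide_nonpos_pos)
    then show ?thesis using True by (simp add: G_def)
  qed (simp add: G01)
  have 2: "G (x - s) \<le> indicator (lower_orthant (s + (\<chi> i. \<delta>))) x" if "norm x \<le> R" for x
  proof (cases "x \<in> lower_orthant (s + (\<chi> i. \<delta>))")
    case False
    then obtain i where "x $ i > s $ i + \<delta>" by (auto simp: lower_orthant_def not_le)
    then have "periodic_ramp \<delta> (2 * R + 2) ((x - s) $ i) = 0"
      using periodic_ramp_eq[OF in_window[OF that, of i]] R \<delta> by (auto simp: divide_simps)
    then have "G (x - s) = 0" unfolding G_def by (intro prod_zero) auto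
    then show ?thesis by simp
  qed (simp add: G01)
  have "prob {\<omega> \<in> space M. X \<omega> \<in> lower_orthant s}
    \<le> expectation (\<lambda>\<omega>. G (X \<omega> - s) + indicator {\<omega> \<in> space M. norm (X \<omega>) > R} \<omega>)"
    unfolding ind
  proof (intro integral_mono)
    fix \<omega> assume "\<omega> \<in> space M"
    then show "indicator {\<omega> \<in> space M. X \<omega> \<in> lower_orthant s} \<omega>
        \<le> G (X \<omega> - s) + indicator {\<omega> \<in> space M. norm (X \<omega>) > R} \<omega>"
      using 1[of "X \<omega>"] G01(1)[of "X \<omega> - s"] by (cases "norm (X \<omega>) > R") (auto simp: indicator_def)
  qed (intro intI intG Bochner_Integration.integrable_add)+
  also have "\<dots> = expectation (\<lambda>\<omega>. G (X \<omega> - s)) + prob {\<omega> \<in> space M. norm (X \<omega>) > R}"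
    unfolding ind by (rule Bochner_Integration.integral_add[OF intG intI(2)])
  finally show "prob {\<omega> \<in> space M. X \<omega> \<in> lower_orthant s}
      \<le> expectation (\<lambda>\<omega>. G (X \<omega> - s)) + prob {\<omega> \<in> space M. norm (X \<omega>) > R}" .
  have "expectation (\<lambda>\<omega>. G (X \<omega> - s)) \<le> expectation (\<lambda>\<omega>. indicator {\<omega> \<in> space M. X \<omega> \<in> lower_orthant (s + (\<chi> i. \<delta>))} \<omega>
      + indicator {\<omega> \<in> space M. norm (X \<omega>) > R} \<omega>)"
  proof (intro integral_mono)
    fix \<omega> assume "\<omega> \<in> space M"
    then show "G (X \<omega> - s) \<le> indicator {\<omega> \<in> space M. X \<omega> \<in> lower_orthant (s + (\<chi> i. \<delta>))} \<omega>
      + indicator {\<omega> \<in> space M. norm (X \<omega>) > R} \<omega>"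
      using 2[of "X \<omega>"] G01(2)[of "X \<omega> - s"] by (cases "norm (X \<omega>) > R") (auto simp: indicator_def)
  qed (intro intI intG Bochner_Integration.integrable_add)+
  also have "\<dots> = prob {\<omega> \<in> space M. X \<omega> \<in> lower_orthant (s + (\<chi> i. \<delta>))} + prob {\<omega> \<in> space M. norm (X \<omega>) > R}"
    unfolding ind by (rule Bochner_Integration.integral_add[OF intI])
  finally show "expectation (\<lambda>\<omega>. G (X \<omega> - s))
      \<le> prob {\<omega> \<in> space M. X \<omega> \<in> lower_orthant (s + (\<chi> i. \<delta>))} + prob {\<omega> \<in> space M. norm (X \<omega>) > R}" .
qed

text \<open>The filter is arbitrary so that the index can carry the parameter as well as h. Periodic
  approximants are wrong far from the origin; this is why both sides are assumed tight and t is
  first clamped to a bounded window.\<close>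

theorem (in prob_space) uniform_orthant_convergence:
  fixes W :: "'i \<Rightarrow> 'a \<Rightarrow> real^'n" and N :: "(real^'n) measure"
  assumes N: "prob_space N" "sets N = sets borel"
    and W [measurable]: "\<And>i. W i \<in> borel_measurable M"
    and cf: "\<And>l. ((\<lambda>i. \<integral>\<omega>. iexp (l \<bullet> W i \<omega>) \<partial>M) \<longlongrightarrow> (\<integral>x. iexp (l \<bullet> x) \<partial>N)) F"
    and tight: "\<And>\<epsilon>. \<epsilon> > 0 \<Longrightarrow> \<exists>R. \<forall>\<^sub>F i in F. prob {\<omega> \<in> space M. norm (W i \<omega>) > R} \<le> \<epsilon>"
    and tightN: "\<And>\<epsilon>. \<epsilon> > 0 \<Longrightarrow> \<exists>R. measure N {x. norm x > R} \<le> \<epsilon>"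
    and modN: "\<And>\<epsilon>. \<epsilon> > 0 \<Longrightarrow> \<exists>\<delta>>0. \<forall>t. measure N (lower_orthant (t + (\<chi> i. \<delta>))) \<le> measure N (lower_orthant t) + \<epsilon>"
    and "\<epsilon> > 0"
  shows "\<forall>\<^sub>F i in F. \<forall>t. \<bar>prob {\<omega> \<in> space M. W i \<omega> \<in> lower_orthant t} - measure N (lower_orthant t)\<bar> < \<epsilon>"
proof -
  interpret N: prob_space N by fact
  have spN: "space N = UNIV" using sets_eq_imp_space_eq[OF N(2)] by simp
  have [measurable]: "(\<lambda>x. x) \<in> borel_measurable N"
    using N(2) by (simp cong: measurable_cong_sets)
  \<comment> \<open>The losses below add up to 8 e.\<close>
  define e where "e = \<epsilon> / 10"
  have e: "e > 0" using \<open>\<epsilon> > 0\<close> by (simp add: e_def)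
  obtain R1 where R1: "\<forall>\<^sub>F i in F. prob {\<omega> \<in> space M. norm (W i \<omega>) > R1} \<le> e" using tight[OF e] by blast
  obtain R2 where R2: "measure N {x. norm x > R2} \<le> e" using tightN[OF e] by blast
  define R where "R = max 0 (max R1 R2)"
  have R0: "R \<ge> 0" by (simp add: R_def)
  have tW: "\<forall>\<^sub>F i in F. prob {\<omega> \<in> space M. norm (W i \<omega>) > R} \<le> e"
    using R1
  proof eventually_elim
    case (elim i)
    have "prob {\<omega> \<in> space M. norm (W i \<omega>) > R} \<le> prob {\<omega> \<in> space M. norm (W i \<omega>) > R1}"
      by (intro finite_measure_mono) (auto simp: R_def)
    with elim show ?case by simp
  qed
  have tN: "measure N {x. norm x > R} \<le> e"
  proof -
    have "measure N {x. norm x > R} \<le> measure N {x. norm x > R2}"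
      using N(2) by (intro N.finite_measure_mono) (auto simp: R_def)
    with R2 show ?thesis by simp
  qed
  obtain \<delta>0 where \<delta>0: "\<delta>0 > 0" "\<And>t. measure N (lower_orthant (t + (\<chi> i. \<delta>0))) \<le> measure N (lower_orthant t) + e"
    using modN[OF e] by blast
  define \<delta> where "\<delta> = min 1 \<delta>0"
  have \<delta>: "\<delta> > 0" "\<delta> \<le> 1" using \<delta>0 by (auto simp: \<delta>_def)
  have mod: "measure N (lower_orthant (t + (\<chi> i. \<delta>))) \<le> measure N (lower_orthant t) + e" for t
  proof -
    have "measure N (lower_orthant (t + (\<chi> i. \<delta>))) \<le> measure N (lower_orthant (t + (\<chi> i. \<delta>0)))"
      using N(2) by (intro N.finite_measure_mono) (auto simp: lower_orthant_def \<delta>_def intro: order_trans)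
    with \<delta>0(2)[of t] show ?thesis by simp
  qed
  define \<rho> where "\<rho> = 2 * R + 2"
  define G where "G x = (\<Prod>i\<in>UNIV. periodic_ramp \<delta> \<rho> (x $ i))" for x :: "real^'n"
  \<comment> \<open>Exchanging the factors of a product one by one costs one eta per
    coordinate.\<close>
  define \<eta> where "\<eta> = e / CARD('n)"
  have \<eta>: "\<eta> > 0" using e by (simp add: \<eta>_def)
  obtain q where q: "real_polynomial_function q" "\<And>y. \<bar>q (sin (y / \<rho>))\<bar> \<le> 1"
    "\<And>y. \<bar>periodic_ramp \<delta> \<rho> y - q (sin (y / \<rho>))\<bar> \<le> \<eta>"
    using periodic_ramp_approx[OF \<eta> \<delta>(1)] by blast
  define Q where "Q x = (\<Prod>i\<in>UNIV. q (sin (x $ i / \<rho>)))" for x :: "real^'n"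
  have trigQ: "trig_polynomial (\<lambda>x. complex_of_real (Q x))"
    unfolding Q_def of_real_prod using q(1) by (intro trig_polynomial_prod trig_polynomial_sin_poly) auto
  have GQ: "\<bar>G x - Q x\<bar> \<le> e" for x
  proof -
    have "\<bar>G x - Q x\<bar> \<le> (\<Sum>i\<in>(UNIV::'n set). \<bar>periodic_ramp \<delta> \<rho> (x $ i) - q (sin (x $ i / \<rho>))\<bar>)"
      unfolding G_def Q_def real_norm_def[symmetric]
      by (intro norm_prod_diff) (use q(2) periodic_ramp_bounds in auto)
    also have "\<dots> \<le> (\<Sum>i\<in>(UNIV::'n set). \<eta>)" by (intro sum_mono q(3))
    also have "\<dots> = e" by (simp add: \<eta>_def)
    finally show ?thesis .
  qed
  have [measurable]: "G \<in> borel_measurable borel" unfolding G_def by measurable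
  have [measurable]: "Q \<in> borel_measurable borel"
    using continuous_on_Re[OF trig_polynomial_continuous[OF trigQ]]
    by (intro borel_measurable_continuous_onI) simp
  have G01: "0 \<le> G x" "G x \<le> 1" for x
    unfolding G_def using periodic_ramp_bounds by (auto intro!: prod_nonneg prod_le_1)
  have Q1: "\<bar>Q x\<bar> \<le> 1" for x
    unfolding Q_def abs_prod using q(2) by (intro prod_le_1) auto
  \<comment> \<open>Stated for an arbitrary probability space because it is applied to M and to
    N.\<close>
  have approx: "\<bar>(\<integral>\<omega>. G (X \<omega> - s) \<partial>P) - (\<integral>\<omega>. Q (X \<omega> - s) \<partial>P)\<bar> \<le> e"
    if P: "prob_space P" and [measurable]: "X \<in> borel_measurable P" for P :: "'z measure" and X s
  proof -
    interpret P: prob_space P by fact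
    have iG: "integrable P (\<lambda>\<omega>. G (X \<omega> - s))" using G01 by (intro P.integrable_const_bound[of _ 1]) auto
    have iQ: "integrable P (\<lambda>\<omega>. Q (X \<omega> - s))" using Q1 by (intro P.integrable_const_bound[of _ 1]) auto
    have "\<bar>(\<integral>\<omega>. G (X \<omega> - s) - Q (X \<omega> - s) \<partial>P)\<bar> \<le> (\<integral>\<omega>. \<bar>G (X \<omega> - s) - Q (X \<omega> - s)\<bar> \<partial>P)"
      by (rule integral_abs_bound)
    also have "\<dots> \<le> (\<integral>\<omega>. e \<partial>P)" using iG iQ GQ by (intro integral_mono) auto
    finally show ?thesis using iG iQ by (simp add: P.prob_space)
  qed
  have "\<forall>\<^sub>F i in F. \<forall>t. cmod ((\<integral>\<omega>. complex_of_real (Q (W i \<omega> - t)) \<partial>M) - (\<integral>x. complex_of_real (Q (x - t)) \<partial>N)) < e"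
    by (rule trig_polynomial_convergence[OF N W cf trigQ e])
  then show ?thesis using tW
  proof (eventually_elim, intro allI)
    fix i and t :: "real^'n"
    assume elim: "\<forall>t. cmod ((\<integral>\<omega>. complex_of_real (Q (W i \<omega> - t)) \<partial>M) - (\<integral>x. complex_of_real (Q (x - t)) \<partial>N)) < e"
      "prob {\<omega> \<in> space M. norm (W i \<omega>) > R} \<le> e"
    have Wi: "\<bar>(\<integral>\<omega>. Q (W i \<omega> - s) \<partial>M) - (\<integral>x. Q (x - s) \<partial>N)\<bar> < e" for s
      using elim(1)[rule_format, of s] by (simp flip: of_real_diff)
    have close: "\<bar>(\<integral>\<omega>. G (W i \<omega> - s) \<partial>M) - (\<integral>x. G (x - s) \<partial>N)\<bar> \<le> 3 * e" for s
      using Wi[of s] approx[OF prob_space_axioms W, of i s] approx[OF N(1), of "\<lambda>x. x" s] by simp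
    define p where "p s = prob {\<omega> \<in> space M. W i \<omega> \<in> lower_orthant s}" for s
    define n where "n s = measure N (lower_orthant s)" for s
    have nN: "measure N {x \<in> space N. x \<in> lower_orthant s} = n s" "measure N {x \<in> space N. norm x > R} = measure N {x. norm x > R}" for s
      by (simp_all add: spN n_def)
    have b: "p s \<le> n (s + (\<chi> i. \<delta>)) + 5 * e" "n s \<le> p (s + (\<chi> i. \<delta>)) + 5 * e" if "\<And>j. \<bar>s $ j\<bar> \<le> R + 2" for s
      using orthant_ramp_bounds[OF W that R0 \<delta>(1), of i] N.orthant_ramp_bounds[OF _ that R0 \<delta>(1), of "\<lambda>x. x"]
        close[of s] elim(2) tN unfolding nN p_def[symmetric] G_def \<rho>_def by auto
    \<comment> \<open>Clamping at R + 1 rather than R leaves membership unchanged for every point of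
      norm at most R, and a further shift by delta <= 1 stays inside the window R + 2.\<close>
    define t' where "t' = (\<chi> j. max (- (R + 1)) (min (R + 1) (t $ j)))"
    have orth: "x \<in> lower_orthant t \<longleftrightarrow> x \<in> lower_orthant t'" if "norm x \<le> R" for x
    proof -
      have "x $ j \<le> t $ j \<longleftrightarrow> x $ j \<le> t' $ j" for j
      proof -
        have "- (R + 1) < x $ j" "x $ j < R + 1"
          using component_le_norm_cart[of x j] that by linarith+
        then show ?thesis by (auto simp: t'_def le_max_iff_disj)
      qed
      then show ?thesis by (simp add: lower_orthant_def)
    qed
    have clamp: "\<bar>measure P {\<omega> \<in> space P. X \<omega> \<in> lower_orthant t} - measure P {\<omega> \<in> space P. X \<omega> \<in> lower_orthant t'}\<bar> \<le> e"
      if P: "prob_space P" and [measurable]: "X \<in> borel_measurable P"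
        and tail: "measure P {\<omega> \<in> space P. norm (X \<omega>) > R} \<le> e" for P :: "'z measure" and X
    proof -
      interpret P: prob_space P by fact
      have "P.prob {\<omega> \<in> space P. X \<omega> \<in> lower_orthant a} \<le> P.prob {\<omega> \<in> space P. X \<omega> \<in> lower_orthant b} + e"
        if "\<And>x. norm x \<le> R \<Longrightarrow> x \<in> lower_orthant a \<longleftrightarrow> x \<in> lower_orthant b" for a b
      proof -
        have "P.prob {\<omega> \<in> space P. X \<omega> \<in> lower_orthant a}
          \<le> P.prob ({\<omega> \<in> space P. X \<omega> \<in> lower_orthant b} \<union> {\<omega> \<in> space P. norm (X \<omega>) > R})"
          using that by (intro P.finite_measure_mono) (auto simp: not_le[symmetric])
        also have "\<dots> \<le> P.prob {\<omega> \<in> space P. X \<omega> \<in> lower_orthant b} + P.prob {\<omega> \<in> space P. norm (X \<omega>) > R}"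
          by (intro measure_Un_le) auto
        finally show ?thesis using tail by simp
      qed
      from this[of t t'] this[of t' t] orth show ?thesis by force
    qed
    have c1: "\<bar>p t - p t'\<bar> \<le> e" using clamp[OF prob_space_axioms W elim(2)] by (simp add: p_def)
    have c2: "\<bar>n t - n t'\<bar> \<le> e" using clamp[OF N(1), of "\<lambda>x. x"] tN by (simp add: nN)
    have t': "\<bar>t' $ j\<bar> \<le> R + 1" for j using R0 by (simp add: t'_def)
    have "p t' \<le> n t' + 6 * e"
    proof -
      have "\<bar>t' $ j\<bar> \<le> R + 2" for j using t'[of j] by simp
      from b(1)[OF this] mod[of t'] show ?thesis by (simp add: n_def)
    qed
    moreover have "n t' \<le> p t' + 6 * e"
    proof -
      \<comment> \<open>The ramp bound moves the orthant up by delta, so the reverse inequality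
        starts from t' - delta and pays the modulus of continuity of N.\<close>
      have "\<bar>(t' - (\<chi> i. \<delta>)) $ j\<bar> \<le> R + 2" for j using t'[of j] \<delta> by simp
      from b(2)[OF this] mod[of "t' - (\<chi> i. \<delta>)"] show ?thesis by (simp add: n_def)
    qed
    ultimately have "\<bar>p t - n t\<bar> \<le> 8 * e" using c1 c2 by linarith
    also have "\<dots> < \<epsilon>" using e by (simp add: e_def)
    finally show "\<bar>prob {\<omega> \<in> space M. W i \<omega> \<in> lower_orthant t} - measure N (lower_orthant t)\<bar> < \<epsilon>"
      by (simp add: p_def n_def)
  qed
qed

section \<open>The standard normal law on vectors\<close>

definition std_normal_vec :: "(real^'n) measure" where
  "std_normal_vec = distr (PiM UNIV (\<lambda>_. std_normal_distribution)) borel (\<lambda>f. \<chi> i. f i)"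

lemma borel_measurable_vecI:
  fixes f :: "'a \<Rightarrow> real^'n"
  assumes "\<And>i. (\<lambda>x. f x $ i) \<in> borel_measurable M"
  shows "f \<in> borel_measurable M"
  using assms by (subst borel_measurable_euclidean_space) (auto simp: Basis_vec_def inner_axis)

lemma product_prob_space_std_normal: "finite_product_prob_space (\<lambda>_. std_normal_distribution) (UNIV :: 'n::finite set)"
proof -
  interpret real_distribution std_normal_distribution by (rule real_dist_normal_dist)
  show ?thesis
    by (intro finite_product_prob_space.intro finite_product_sigma_finite.intro product_prob_spaceI
        finite_product_sigma_finite_axioms.intro product_sigma_finite.intro)
      (auto intro: prob_space_axioms sigma_finite_measure_axioms)
qed

lemma measurable_vec_lambda [measurable]:
  "(\<lambda>f. \<chi> i::'n::finite. f i) \<in> borel_measurable (PiM UNIV (\<lambda>_. std_normal_distribution))"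
  by (rule borel_measurable_vecI) (simp add: measurable_component_singleton cong: measurable_cong_sets)

lemma sets_std_normal_vec [simp]: "sets std_normal_vec = sets borel"
  by (simp add: std_normal_vec_def)

lemma prob_space_std_normal_vec: "prob_space (std_normal_vec :: (real^'n) measure)"
proof -
  interpret finite_product_prob_space "\<lambda>_. std_normal_distribution" "UNIV :: 'n set"
    by (rule product_prob_space_std_normal)
  show ?thesis unfolding std_normal_vec_def by (rule prob_space_distr) measurable
qed

lemma char_std_normal_vec:
  "(\<integral>x. iexp (l \<bullet> x) \<partial>std_normal_vec) = complex_of_real (exp (- (l \<bullet> l) / 2))" for l :: "real^'n"
proof -
  interpret finite_product_prob_space "\<lambda>_. std_normal_distribution" "UNIV :: 'n set"
    by (rule product_prob_space_std_normal)
  have sn: "prob_space std_normal_distribution"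
    using real_dist_normal_dist by (simp add: real_distribution_def)
  have "(\<integral>x. iexp (l \<bullet> x) \<partial>std_normal_vec)
    = (\<integral>f. iexp (l \<bullet> (\<chi> i. f i)) \<partial>PiM UNIV (\<lambda>_. std_normal_distribution))"
    unfolding std_normal_vec_def by (rule integral_distr) measurable
  also have "\<dots> = (\<integral>f. (\<Prod>i\<in>UNIV. iexp (l $ i * f i)) \<partial>PiM UNIV (\<lambda>_. std_normal_distribution))"
    by (simp add: inner_vec_def sum_distrib_left exp_sum)
  also have "\<dots> = (\<Prod>i\<in>UNIV. char std_normal_distribution (l $ i))"
    unfolding char_def by (intro product_integral_prod) (auto intro!: prob_space.integrable_iexp[OF sn])
  also have "\<dots> = complex_of_real (\<Prod>i\<in>UNIV. exp (- (l $ i)\<^sup>2 / 2))"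
    by (simp add: char_std_normal_distribution)
  also have "(\<Prod>i\<in>UNIV. exp (- (l $ i)\<^sup>2 / 2)) = exp (- (l \<bullet> l) / 2)"
    by (simp add: exp_sum[symmetric] inner_vec_def sum_negf sum_divide_distrib power2_eq_square)
  finally show ?thesis .
qed

lemma measure_std_normal_vec_orthant:
  "measure std_normal_vec (lower_orthant t) = (\<Prod>i\<in>UNIV. Phi (t $ i))" for t :: "real^'n"
proof -
  interpret finite_product_prob_space "\<lambda>_. std_normal_distribution" "UNIV :: 'n set"
    by (rule product_prob_space_std_normal)
  have "measure std_normal_vec (lower_orthant t)
    = measure (PiM UNIV (\<lambda>_. std_normal_distribution)) ((\<lambda>f. \<chi> i. f i) -` lower_orthant t \<inter> space (PiM UNIV (\<lambda>_. std_normal_distribution)))"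
    unfolding std_normal_vec_def by (rule measure_distr) measurable
  also have "(\<lambda>f. \<chi> i. f i) -` lower_orthant t \<inter> space (PiM UNIV (\<lambda>_. std_normal_distribution)) = (\<Pi>\<^sub>E i\<in>UNIV. {..t $ i})"
    by (auto simp: lower_orthant_def space_PiM)
  also have "measure (PiM UNIV (\<lambda>_. std_normal_distribution)) (\<Pi>\<^sub>E i\<in>UNIV. {..t $ i}) = (\<Prod>i\<in>UNIV. measure std_normal_distribution {..t $ i})"
    by (rule prob_times) auto
  finally show ?thesis by (simp add: Phi_def cdf_def)
qed

lemma Phi_bounds: "0 \<le> Phi x" "Phi x \<le> 1"
proof -
  interpret real_distribution std_normal_distribution by (rule real_dist_normal_dist)
  show "0 \<le> Phi x" "Phi x \<le> 1" by (auto simp: Phi_def cdf_def)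
qed

text \<open>The standard normal density is at most 1 because sqrt (2 pi) >= 1, which makes the
  distribution function 1-Lipschitz.\<close>

lemma Phi_increment:
  assumes "\<delta> > 0"
  shows "Phi (x + \<delta>) - Phi x \<le> \<delta>" "Phi x \<le> Phi (x + \<delta>)"
proof -
  interpret real_distribution std_normal_distribution by (rule real_dist_normal_dist)
  have "emeasure std_normal_distribution {x<..x+\<delta>} = (\<integral>\<^sup>+y. ennreal (std_normal_density y) * indicator {x<..x+\<delta>} y \<partial>lborel)"
    by (subst emeasure_density) auto
  also have "\<dots> \<le> (\<integral>\<^sup>+y. indicator {x<..x+\<delta>} y \<partial>lborel)"
  proof (intro nn_integral_mono)
    fix y :: real
    have "1 \<le> 2 * pi" using pi_ge_two by linarith
    then have "1 \<le> sqrt (2 * pi)" by simp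
    moreover have "exp (- y\<^sup>2 / 2) \<le> 1" by simp
    ultimately have "std_normal_density y \<le> 1"
      unfolding std_normal_density_def by (smt (verit) mult_left_le_one_le divide_le_eq_1 divide_nonneg_nonneg exp_ge_zero mult_le_one)
    then show "ennreal (std_normal_density y) * indicator {x<..x+\<delta>} y \<le> indicator {x<..x+\<delta>} y"
      by (auto simp: indicator_def)
  qed
  also have "\<dots> = ennreal \<delta>" using assms by simp
  finally have "measure std_normal_distribution {x<..x+\<delta>} \<le> \<delta>"
    using assms by (simp add: emeasure_eq_measure)
  moreover have "Phi (x + \<delta>) - Phi x = measure std_normal_distribution {x<..x+\<delta>}"
    unfolding Phi_def using assms by (intro cdf_diff_eq) auto
  ultimately show "Phi (x + \<delta>) - Phi x \<le> \<delta>" "Phi x \<le> Phi (x + \<delta>)"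
    using measure_nonneg[of std_normal_distribution "{x<..x + \<delta>}"] by linarith+
qed

theorem (in prob_space) uniform_normal_convergence:
  fixes W :: "'i \<Rightarrow> 'a \<Rightarrow> real^'n"
  assumes W: "\<And>i. W i \<in> borel_measurable M"
    and cf: "\<And>l. ((\<lambda>i. \<integral>\<omega>. iexp (l \<bullet> W i \<omega>) \<partial>M) \<longlongrightarrow> complex_of_real (exp (- (l \<bullet> l) / 2))) F"
    and tight: "\<And>\<epsilon>. \<epsilon> > 0 \<Longrightarrow> \<exists>R. \<forall>\<^sub>F i in F. prob {\<omega> \<in> space M. norm (W i \<omega>) > R} \<le> \<epsilon>"
    and "\<epsilon> > 0"
  shows "\<forall>\<^sub>F i in F. \<forall>t. \<bar>prob {\<omega> \<in> space M. \<forall>j. W i \<omega> $ j \<le> t $ j} - (\<Prod>j\<in>UNIV. Phi (t $ j))\<bar> < \<epsilon>"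
proof -
  interpret N: prob_space "std_normal_vec :: (real^'n) measure" by (rule prob_space_std_normal_vec)
  have tightN: "\<exists>R. N.prob {x. norm x > R} \<le> e" if "e > 0" for e
  proof -
    have "(\<lambda>n. N.prob {x. norm x > real n}) \<longlonglongrightarrow> N.prob (\<Inter>n. {x. norm x > real n})"
      by (intro N.finite_Lim_measure_decseq) (auto simp: decseq_def)
    moreover have "(\<Inter>n. {x::real^'n. norm x > real n}) = {}"
      by (auto simp: not_less) (meson reals_Archimedean2 not_less_iff_gr_or_eq)
    ultimately have "(\<lambda>n. N.prob {x. norm x > real n}) \<longlonglongrightarrow> 0" by simp
    then have "\<forall>\<^sub>F n in sequentially. N.prob {x. norm x > real n} < e"
      using that by (rule order_tendstoD)
    then obtain n where "N.prob {x. norm x > real n} < e" using eventually_happens by force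
    then show ?thesis by (meson less_imp_le)
  qed
  have modN: "\<exists>\<delta>>0. \<forall>t::real^'n. N.prob (lower_orthant (t + (\<chi> i. \<delta>))) \<le> N.prob (lower_orthant t) + e" if "e > 0" for e
  proof (intro exI conjI allI)
    \<comment> \<open>Each factor is 1-Lipschitz with values in [0, 1], so moving every coordinate
      by e / n changes the product by at most e.\<close>
    let ?d = "e / CARD('n)"
    show d: "?d > 0" using that by simp
    fix t :: "real^'n"
    have "\<bar>(\<Prod>i\<in>UNIV. Phi (t $ i + ?d)) - (\<Prod>i\<in>UNIV. Phi (t $ i))\<bar>
        \<le> (\<Sum>i\<in>(UNIV::'n set). \<bar>Phi (t $ i + ?d) - Phi (t $ i)\<bar>)"
      unfolding real_norm_def[symmetric] using Phi_bounds by (intro norm_prod_diff) auto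
    also have "\<dots> \<le> (\<Sum>i\<in>(UNIV::'n set). ?d)"
      using Phi_increment[OF d] by (intro sum_mono) (simp add: abs_le_iff)
    also have "\<dots> = e" by simp
    finally show "N.prob (lower_orthant (t + (\<chi> i. ?d))) \<le> N.prob (lower_orthant t) + e"
      by (simp add: measure_std_normal_vec_orthant)
  qed
  have "((\<lambda>i. \<integral>\<omega>. iexp (l \<bullet> W i \<omega>) \<partial>M) \<longlongrightarrow> (\<integral>x. iexp (l \<bullet> x) \<partial>std_normal_vec)) F" for l
    using cf by (simp add: char_std_normal_vec)
  from uniform_orthant_convergence[OF N.prob_space_axioms sets_std_normal_vec W this tight tightN modN \<open>\<epsilon> > 0\<close>]
  show ?thesis
    by (simp add: measure_std_normal_vec_orthant) (simp add: lower_orthant_def)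
qed

section \<open>Martingale transforms of independent noise\<close>

locale iid_noise = prob_space M for M :: "'a measure" +
  fixes eps :: "nat \<Rightarrow> 'a \<Rightarrow> real" and \<sigma> :: real
  assumes eps_measurable: "n \<ge> 1 \<Longrightarrow> eps n \<in> borel_measurable M"
    and eps_indep: "indep_vars (\<lambda>_. borel) eps {1..}"
    and eps_distr: "n \<ge> 1 \<Longrightarrow> distr M borel (eps n) = distr M borel (eps 1)"
    and eps_mean: "integrable M (eps 1)" "expectation (eps 1) = 0"
    and eps_square: "integrable M (\<lambda>\<omega>. (eps 1 \<omega>)\<^sup>2)" "expectation (\<lambda>\<omega>. (eps 1 \<omega>)\<^sup>2) = \<sigma>\<^sup>2"
    and \<sigma>_pos: "\<sigma> > 0"
begin

text \<open>The natural filtration, trivial for n = 0 since {1..0} is empty. Generating it by a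
  single map into a product space matches the form in which independence of disjoint blocks of
  variables is available.\<close>

definition past :: "nat \<Rightarrow> 'a measure" where
  "past n = vimage_algebra (space M) (\<lambda>\<omega>. restrict (\<lambda>i. eps i \<omega>) {1..n}) (PiM {1..n} (\<lambda>_. borel))"

lemma eps_Suc_measurable [measurable]: "eps (Suc n) \<in> borel_measurable M"
  by (rule eps_measurable) simp

lemma space_past [simp]: "space (past n) = space M"
  by (simp add: past_def)

lemma eps_past: "1 \<le> i \<Longrightarrow> i \<le> n \<Longrightarrow> eps i \<in> borel_measurable (past n)"
proof -
  assume i: "1 \<le> i" "i \<le> n"
  have "(\<lambda>\<omega>. restrict (\<lambda>i. eps i \<omega>) {1..n}) \<in> measurable (past n) (PiM {1..n} (\<lambda>_. borel))"
    unfolding past_def by (rule measurable_vimage_algebra1) (auto simp: space_PiM)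
  then have "(\<lambda>\<omega>. (restrict (\<lambda>i. eps i \<omega>) {1..n}) i) \<in> borel_measurable (past n)"
    by (rule measurable_compose) (use i in \<open>auto intro!: measurable_component_singleton\<close>)
  then show ?thesis using i by simp
qed

lemma past_generator:
  "sigma_sets (space M) {(\<lambda>\<omega>. restrict (\<lambda>i. eps i \<omega>) {1..n}) -` A \<inter> space M | A. A \<in> sets (PiM {1..n} (\<lambda>_. borel))}
    = sets (past n)"
  by (simp add: past_def sets_vimage_algebra)

lemma past_subset: "sets (past n) \<subseteq> sets M"
proof -
  have "(\<lambda>\<omega>. restrict (\<lambda>i. eps i \<omega>) {1..n}) \<in> measurable M (PiM {1..n} (\<lambda>_. borel))"
    by (intro measurable_restrict eps_measurable) auto
  then show ?thesis
    unfolding past_generator[symmetric] by (intro sets.sigma_sets_subset) (auto intro: measurable_sets)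
qed

lemma past_measurable: "f \<in> measurable (past n) N \<Longrightarrow> f \<in> measurable M N"
  using past_subset[of n] by (auto simp: measurable_def)

lemma past_mono:
  assumes "m \<le> n" shows "f \<in> measurable (past m) N \<Longrightarrow> f \<in> measurable (past n) N"
proof -
  assume f: "f \<in> measurable (past m) N"
  have "(\<lambda>\<omega>. restrict (\<lambda>i. eps i \<omega>) {1..m}) \<in> measurable (past n) (PiM {1..m} (\<lambda>_. borel))"
    by (intro measurable_restrict eps_past) (use assms in auto)
  then have "sets (past m) \<subseteq> sets (past n)"
    unfolding past_generator[of m, symmetric]
    using sets.sigma_sets_subset[of _ "past n"] by (auto intro!: sets.sigma_sets_subset[of _ "past n", simplified] dest: measurable_sets)
  then show ?thesis using f by (auto simp: measurable_def)
qed

text \<open>The blocks {1..n} and {Suc n} of the noise generate independent sigma-algebras, and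
  variables measurable for them inherit independence. The target spaces are arbitrary, so pairs of
  past variables are covered.\<close>

lemma past_indep:
  assumes Z: "Z \<in> measurable (past n) S" and g: "g \<in> measurable borel T"
  shows "indep_var S Z T (\<lambda>\<omega>. g (eps (Suc n) \<omega>))"
proof -
  let ?R = "\<lambda>A \<omega>. restrict (\<lambda>i. eps i \<omega>) A"
  have "indep_var (PiM {1..n} (\<lambda>_. borel)) (?R {1..n}) (PiM {Suc n} (\<lambda>_. borel)) (?R {Suc n})"
    by (rule indep_var_restrict[OF eps_indep]) auto
  then have ind: "indep_set (sets (past n)) (sigma_sets (space M) {?R {Suc n} -` A \<inter> space M | A. A \<in> sets (PiM {Suc n} (\<lambda>_. borel))})"
    unfolding indep_var_eq past_generator by blast
  have ge: "(\<lambda>x. g (x (Suc n))) \<in> measurable (PiM {Suc n} (\<lambda>_. borel)) T"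
    by (rule measurable_compose[OF _ g]) (rule measurable_component_singleton, simp)
  have 1: "sigma_sets (space M) {Z -` A \<inter> space M | A. A \<in> sets S} \<subseteq> sets (past n)"
    by (intro sets.sigma_sets_subset[of _ "past n", unfolded space_past])
      (use measurable_sets[OF Z] in auto)
  have 2: "sigma_sets (space M) {(\<lambda>\<omega>. g (eps (Suc n) \<omega>)) -` A \<inter> space M | A. A \<in> sets T}
    \<subseteq> sigma_sets (space M) {?R {Suc n} -` A \<inter> space M | A. A \<in> sets (PiM {Suc n} (\<lambda>_. borel))}"
  proof (rule sigma_sets_mono', safe)
    fix A assume A: "A \<in> sets T"
    let ?B = "(\<lambda>x. g (x (Suc n))) -` A \<inter> space (PiM {Suc n} (\<lambda>_. borel))"
    show "\<exists>B. (\<lambda>\<omega>. g (eps (Suc n) \<omega>)) -` A \<inter> space M = ?R {Suc n} -` B \<inter> space M \<and> B \<in> sets (PiM {Suc n} (\<lambda>_. borel))"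
      by (rule exI[of _ ?B]) (use measurable_sets[OF ge A] in \<open>auto simp: space_PiM\<close>)
  qed
  have "indep_set (sigma_sets (space M) {Z -` A \<inter> space M | A. A \<in> sets S}) (sigma_sets (space M) {(\<lambda>\<omega>. g (eps (Suc n) \<omega>)) -` A \<inter> space M | A. A \<in> sets T})"
    using ind unfolding indep_set_def
    by (rule indep_sets_mono_sets) (use 1 2 in \<open>auto split: bool.split\<close>)
  then show ?thesis
    unfolding indep_var_eq using past_measurable[OF Z] measurable_compose[OF eps_Suc_measurable g] by simp
qed

abbreviation noise :: "real measure" where "noise \<equiv> distr M borel (eps 1)"

lemma real_distribution_noise: "real_distribution noise"
  by (rule real_distribution_distr) (rule eps_measurable, simp)

lemma eps_integral:
  fixes g :: "real \<Rightarrow> 'b::{banach, second_countable_topology}"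
  assumes "n \<ge> 1" and [measurable]: "g \<in> borel_measurable borel"
  shows "(\<integral>\<omega>. g (eps n \<omega>) \<partial>M) = (\<integral>\<omega>. g (eps 1 \<omega>) \<partial>M)"
    and "integrable M (\<lambda>\<omega>. g (eps n \<omega>)) \<longleftrightarrow> integrable M (\<lambda>\<omega>. g (eps 1 \<omega>))"
  using eps_distr[OF assms(1)] integral_distr[OF eps_measurable assms(2)] integrable_distr_eq[OF eps_measurable assms(2)] assms(1)
  by (metis order_refl)+

lemma eps_moments:
  assumes "n \<ge> 1"
  shows "integrable M (eps n)" "expectation (eps n) = 0"
    "integrable M (\<lambda>\<omega>. (eps n \<omega>)\<^sup>2)" "expectation (\<lambda>\<omega>. (eps n \<omega>)\<^sup>2) = \<sigma>\<^sup>2"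
  using eps_mean eps_square eps_integral[OF assms, of "\<lambda>x. x"] eps_integral[OF assms, of "\<lambda>x. x\<^sup>2"] by auto

text \<open>Conditioning on the past, carried out by Fubini: the joint law of (Y, U) and the next
  noise is a product, so the noise is integrated first with U frozen.\<close>

lemma expectation_past_iexp:
  assumes Y [measurable]: "Y \<in> borel_measurable (past n)" and bound: "\<And>\<omega>. \<omega> \<in> space M \<Longrightarrow> cmod (Y \<omega>) \<le> B"
    and U [measurable]: "U \<in> borel_measurable (past n)"
  shows "(\<integral>\<omega>. Y \<omega> * iexp (U \<omega> * eps (Suc n) \<omega>) \<partial>M) = (\<integral>\<omega>. Y \<omega> * char noise (U \<omega>) \<partial>M)"
proof -
  interpret D: real_distribution noise by (rule real_distribution_noise)
  note [measurable] = past_measurable[OF Y] past_measurable[OF U]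
  define S where "S = (borel :: complex measure) \<Otimes>\<^sub>M (borel :: real measure)"
  have YU: "(\<lambda>\<omega>. (Y \<omega>, U \<omega>)) \<in> measurable (past n) S" unfolding S_def by measurable
  note YUM [measurable] = past_measurable[OF YU]
  \<comment> \<open>Both variables of \<open>indep_var\<close> must have the same type, hence the
    dummy complex component.\<close>
  define E where "E \<omega> = (0 :: complex, eps (Suc n) \<omega>)" for \<omega>
  have EM [measurable]: "E \<in> measurable M S" unfolding E_def S_def by measurable
  define f where "f z e = fst z * iexp (snd z * snd e)" for z e :: "complex \<times> real"
  have [measurable]: "case_prod f \<in> borel_measurable (S \<Otimes>\<^sub>M S)"
    unfolding f_def S_def split_beta' by measurable
  have "indep_var S (\<lambda>\<omega>. (Y \<omega>, U \<omega>)) S (\<lambda>\<omega>. Pair 0 (eps (Suc n) \<omega>))"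
    by (rule past_indep[OF YU]) (simp add: S_def)
  then have eq: "distr M S (\<lambda>\<omega>. (Y \<omega>, U \<omega>)) \<Otimes>\<^sub>M distr M S E = distr M (S \<Otimes>\<^sub>M S) (\<lambda>\<omega>. ((Y \<omega>, U \<omega>), E \<omega>))"
    unfolding indep_var_distribution_eq E_def by simp
  interpret P: prob_space "distr M S (\<lambda>\<omega>. (Y \<omega>, U \<omega>))" by (rule prob_space_distr) measurable
  interpret PE: prob_space "distr M S E" by (rule prob_space_distr) measurable
  interpret PD: pair_prob_space "distr M S (\<lambda>\<omega>. (Y \<omega>, U \<omega>))" "distr M S E" ..
  have int: "integrable (distr M S (\<lambda>\<omega>. (Y \<omega>, U \<omega>)) \<Otimes>\<^sub>M distr M S E) (case_prod f)"
    unfolding eq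
  proof (subst integrable_distr_eq)
    show m: "(\<lambda>\<omega>. ((Y \<omega>, U \<omega>), E \<omega>)) \<in> measurable M (S \<Otimes>\<^sub>M S)" by measurable
    show "integrable M (\<lambda>\<omega>. case_prod f ((Y \<omega>, U \<omega>), E \<omega>))"
    proof (rule integrable_const_bound[of _ B])
      show "AE \<omega> in M. cmod (case_prod f ((Y \<omega>, U \<omega>), E \<omega>)) \<le> B"
        by (auto simp: f_def norm_mult bound)
      show "(\<lambda>\<omega>. case_prod f ((Y \<omega>, U \<omega>), E \<omega>)) \<in> borel_measurable M"
        by (rule measurable_compose[OF m]) measurable
    qed
  qed measurable
  have inner: "(\<integral>e. f z e \<partial>distr M S E) = fst z * char noise (snd z)" for z
  proof -
    have "(\<integral>e. f z e \<partial>distr M S E) = (\<integral>\<omega>. f z (E \<omega>) \<partial>M)"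
      by (rule integral_distr[OF EM]) (unfold f_def S_def, measurable)
    also have "\<dots> = fst z * (\<integral>\<omega>. iexp (snd z * eps (Suc n) \<omega>) \<partial>M)"
      by (simp add: f_def E_def)
    also have "(\<integral>\<omega>. iexp (snd z * eps (Suc n) \<omega>) \<partial>M) = (\<integral>\<omega>. iexp (snd z * eps 1 \<omega>) \<partial>M)"
      by (rule eps_integral) (simp, measurable)
    also have "\<dots> = char noise (snd z)"
      unfolding char_def by (rule integral_distr[symmetric]) (rule eps_measurable, simp, measurable)
    finally show ?thesis .
  qed
  have "(\<integral>\<omega>. Y \<omega> * iexp (U \<omega> * eps (Suc n) \<omega>) \<partial>M) = (\<integral>\<omega>. case_prod f ((Y \<omega>, U \<omega>), E \<omega>) \<partial>M)"
    by (simp add: f_def E_def)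
  also have "\<dots> = integral\<^sup>L (distr M S (\<lambda>\<omega>. (Y \<omega>, U \<omega>)) \<Otimes>\<^sub>M distr M S E) (case_prod f)"
    unfolding eq by (rule integral_distr[symmetric]) measurable
  also have "\<dots> = (\<integral>z. (\<integral>e. f z e \<partial>distr M S E) \<partial>distr M S (\<lambda>\<omega>. (Y \<omega>, U \<omega>)))"
    by (rule PD.integral_fst[OF int, symmetric])
  also have "\<dots> = (\<integral>z. fst z * char noise (snd z) \<partial>distr M S (\<lambda>\<omega>. (Y \<omega>, U \<omega>)))"
    by (simp only: inner)
  also have "\<dots> = (\<integral>\<omega>. fst (Y \<omega>, U \<omega>) * char noise (snd (Y \<omega>, U \<omega>)) \<partial>M)"
    by (rule integral_distr) (measurable, unfold S_def, measurable)
  also have "\<dots> = (\<integral>\<omega>. Y \<omega> * char noise (U \<omega>) \<partial>M)" by simp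
  finally show ?thesis .
qed

text \<open>Increments are orthogonal because weights from the past are independent of the next
  mean-zero noise. The energy bound holds on every path and for every N, so it also bounds each
  single weight, which settles integrability.\<close>

lemma martingale_variance:
  assumes U [measurable]: "\<And>k. U k \<in> borel_measurable (past k)"
    and bound: "\<And>\<omega> N. \<omega> \<in> space M \<Longrightarrow> (\<Sum>k<N. (U k \<omega>)\<^sup>2) \<le> B"
  shows "integrable M (\<lambda>\<omega>. (\<Sum>k<N. U k \<omega> * eps (Suc k) \<omega>)\<^sup>2)"
    and "expectation (\<lambda>\<omega>. (\<Sum>k<N. U k \<omega> * eps (Suc k) \<omega>)\<^sup>2) \<le> \<sigma>\<^sup>2 * B"
proof -
  note [measurable] = past_measurable[OF U]
  define S where "S N \<omega> = (\<Sum>k<N. U k \<omega> * eps (Suc k) \<omega>)" for N \<omega>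
  have [measurable]: "S N \<in> borel_measurable M" for N unfolding S_def by measurable
  have SF: "S N \<in> borel_measurable (past N)" for N
    unfolding S_def by (intro borel_measurable_sum borel_measurable_times)
      (auto intro: past_mono[OF _ U] eps_past)
  have U2: "(U k \<omega>)\<^sup>2 \<le> B" if "\<omega> \<in> space M" for k \<omega>
  proof -
    have "(U k \<omega>)\<^sup>2 \<le> (\<Sum>k<Suc k. (U k \<omega>)\<^sup>2)" by (simp add: sum_nonneg)
    with bound[OF that, of "Suc k"] show ?thesis by linarith
  qed
  have Ub: "\<bar>U k \<omega>\<bar> \<le> sqrt B" if "\<omega> \<in> space M" for k \<omega>
    using U2[OF that, of k] by (metis real_sqrt_abs real_sqrt_le_iff)
  have intU2: "integrable M (\<lambda>\<omega>. (U k \<omega>)\<^sup>2)" for k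
    using U2 by (intro integrable_const_bound[of _ B]) auto
  have main: "integrable M (\<lambda>\<omega>. (S N \<omega>)\<^sup>2) \<and> expectation (\<lambda>\<omega>. (S N \<omega>)\<^sup>2) = \<sigma>\<^sup>2 * (\<Sum>k<N. expectation (\<lambda>\<omega>. (U k \<omega>)\<^sup>2))" for N
  proof (induction N)
    case 0
    show ?case by (simp add: S_def)
  next
    case (Suc N)
    have intS: "integrable M (S N)" by (rule square_integrable_imp_integrable) (measurable, use Suc in blast)
    have intSU: "integrable M (\<lambda>\<omega>. S N \<omega> * U N \<omega>)"
    proof (rule Bochner_Integration.integrable_bound)
      show "integrable M (\<lambda>\<omega>. sqrt B * S N \<omega>)" using intS by simp
      show "AE \<omega> in M. norm (S N \<omega> * U N \<omega>) \<le> norm (sqrt B * S N \<omega>)"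
      proof (rule AE_I2)
        fix \<omega> assume "\<omega> \<in> space M"
        from Ub[OF this, of N] have "\<bar>U N \<omega>\<bar> \<le> \<bar>sqrt B\<bar>" by linarith
        then have "\<bar>S N \<omega>\<bar> * \<bar>U N \<omega>\<bar> \<le> \<bar>S N \<omega>\<bar> * \<bar>sqrt B\<bar>" by (intro mult_left_mono) auto
        then show "norm (S N \<omega> * U N \<omega>) \<le> norm (sqrt B * S N \<omega>)" by (simp only: real_norm_def abs_mult mult.commute)
      qed
    qed measurable
    \<comment> \<open>The product of partial sum and weight counts as one past variable, so the
      mixed term factorises and has mean 0.\<close>
    have i1: "indep_var borel (\<lambda>\<omega>. S N \<omega> * U N \<omega>) borel (eps (Suc N))"
      by (rule past_indep[where g = "\<lambda>x. x"]) (intro borel_measurable_times SF U, simp)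
    have i2: "indep_var borel (\<lambda>\<omega>. (U N \<omega>)\<^sup>2) borel (\<lambda>\<omega>. (eps (Suc N) \<omega>)\<^sup>2)"
    proof -
      have "indep_var borel (U N) borel (eps (Suc N))" by (rule past_indep[OF U, where g = "\<lambda>x. x"]) simp
      from indep_var_compose[OF this, of "\<lambda>x. x\<^sup>2" borel "\<lambda>x. x\<^sup>2" borel] show ?thesis by (simp add: comp_def)
    qed
    note e = eps_moments[of "Suc N", simplified]
    have c1: "integrable M (\<lambda>\<omega>. S N \<omega> * U N \<omega> * eps (Suc N) \<omega>)"
      "expectation (\<lambda>\<omega>. S N \<omega> * U N \<omega> * eps (Suc N) \<omega>) = 0"
      using indep_var_integrable[OF i1 intSU e(1)] indep_var_lebesgue_integral[OF i1 intSU e(1)] e(2) by auto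
    have c2: "integrable M (\<lambda>\<omega>. (U N \<omega>)\<^sup>2 * (eps (Suc N) \<omega>)\<^sup>2)"
      "expectation (\<lambda>\<omega>. (U N \<omega>)\<^sup>2 * (eps (Suc N) \<omega>)\<^sup>2) = expectation (\<lambda>\<omega>. (U N \<omega>)\<^sup>2) * \<sigma>\<^sup>2"
      using indep_var_integrable[OF i2 intU2 e(3)] indep_var_lebesgue_integral[OF i2 intU2 e(3)] e(4) by auto
    have "(S (Suc N) \<omega>)\<^sup>2 = (S N \<omega>)\<^sup>2 + (2 * (S N \<omega> * U N \<omega> * eps (Suc N) \<omega>) + (U N \<omega>)\<^sup>2 * (eps (Suc N) \<omega>)\<^sup>2)" for \<omega>
      by (simp add: S_def power2_eq_square algebra_simps)
    then show ?case using Suc c1 c2 by (simp add: algebra_simps)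
  qed
  then show "integrable M (\<lambda>\<omega>. (\<Sum>k<N. U k \<omega> * eps (Suc k) \<omega>)\<^sup>2)" by (simp add: S_def)
  have "(\<Sum>k<N. expectation (\<lambda>\<omega>. (U k \<omega>)\<^sup>2)) = expectation (\<lambda>\<omega>. \<Sum>k<N. (U k \<omega>)\<^sup>2)"
    using intU2 by (subst Bochner_Integration.integral_sum) auto
  also have "\<dots> \<le> expectation (\<lambda>\<omega>. B)"
    using intU2 bound by (intro integral_mono) auto
  finally have "(\<Sum>k<N. expectation (\<lambda>\<omega>. (U k \<omega>)\<^sup>2)) \<le> B" by (simp add: prob_space)
  then show "expectation (\<lambda>\<omega>. (\<Sum>k<N. U k \<omega> * eps (Suc k) \<omega>)\<^sup>2) \<le> \<sigma>\<^sup>2 * B"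
    using main[of N] by (simp add: S_def mult_left_mono)
qed

text \<open>For Gaussian noise exp (i S + V), with V half the accumulated conditional variance,
  would be a martingale of mean 1. The actual noise disturbs the mean at each step by at most r
  times the expected square of the weight, times the uniform bound exp (sigma^2 B / 2) on exp V; the
  expected squares sum to at most B.\<close>

lemma martingale_char:
  assumes U [measurable]: "\<And>k. U k \<in> borel_measurable (past k)"
    and bound: "\<And>\<omega> N. \<omega> \<in> space M \<Longrightarrow> (\<Sum>k<N. (U k \<omega>)\<^sup>2) \<le> B"
    and small: "\<And>\<omega> k. \<omega> \<in> space M \<Longrightarrow> \<bar>U k \<omega>\<bar> \<le> \<eta>"
    and r: "\<And>u. \<bar>u\<bar> \<le> \<eta> \<Longrightarrow> cmod (char noise u - exp (- (\<sigma>\<^sup>2 * u\<^sup>2 / 2))) \<le> r * u\<^sup>2"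
    and "r \<ge> 0"
  shows "cmod ((\<integral>\<omega>. exp (\<i> * (\<Sum>k<N. U k \<omega> * eps (Suc k) \<omega>) + \<sigma>\<^sup>2 / 2 * (\<Sum>k<N. (U k \<omega>)\<^sup>2)) \<partial>M) - 1)
    \<le> exp (\<sigma>\<^sup>2 / 2 * B) * r * B"
proof -
  interpret D: real_distribution noise by (rule real_distribution_noise)
  note [measurable] = past_measurable[OF U]
  define V where "V N \<omega> = \<sigma>\<^sup>2 / 2 * (\<Sum>k<N. (U k \<omega>)\<^sup>2)" for N \<omega>
  define S where "S N \<omega> = (\<Sum>k<N. U k \<omega> * eps (Suc k) \<omega>)" for N \<omega>
  define T where "T N \<omega> = exp (\<i> * S N \<omega> + V N \<omega>)" for N \<omega>
  \<comment> \<open>V runs one step ahead of S: the weight U N is known before the noise of index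
    Suc N, so Y N is still a past variable. Both T N and T (Suc N) are multiples of it.\<close>
  define Y where "Y N \<omega> = exp (\<i> * S N \<omega> + V (Suc N) \<omega>)" for N \<omega>
  have SF: "S N \<in> borel_measurable (past N)" for N
    unfolding S_def by (intro borel_measurable_sum borel_measurable_times)
      (auto intro: past_mono[OF _ U] eps_past)
  have VF: "V (Suc N) \<in> borel_measurable (past N)" for N
    unfolding V_def by (intro borel_measurable_sum borel_measurable_times borel_measurable_power borel_measurable_const)
      (auto intro: past_mono[OF _ U])
  have YF: "Y N \<in> borel_measurable (past N)" for N
    unfolding Y_def using SF[of N] VF[of N] by measurable
  have [measurable]: "S N \<in> borel_measurable M" "V N \<in> borel_measurable M" for N
    unfolding S_def V_def by measurable
  have [measurable]: "Y N \<in> borel_measurable M" "T N \<in> borel_measurable M" for N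
    unfolding Y_def T_def by measurable
  define C where "C = exp (\<sigma>\<^sup>2 / 2 * B)"
  have VB: "V N \<omega> \<le> \<sigma>\<^sup>2 / 2 * B" if "\<omega> \<in> space M" for N \<omega>
    unfolding V_def using bound[OF that] by (intro mult_left_mono) auto
  have YC: "cmod (Y N \<omega>) \<le> C" and TC: "cmod (T N \<omega>) \<le> C" if "\<omega> \<in> space M" for N \<omega>
    using VB[OF that] by (auto simp: Y_def T_def C_def)
  have U2: "(U k \<omega>)\<^sup>2 \<le> B" if "\<omega> \<in> space M" for k \<omega>
  proof -
    have "(U k \<omega>)\<^sup>2 \<le> (\<Sum>k<Suc k. (U k \<omega>)\<^sup>2)" by (simp add: sum_nonneg)
    with bound[OF that, of "Suc k"] show ?thesis by linarith
  qed
  have intU2: "integrable M (\<lambda>\<omega>. (U k \<omega>)\<^sup>2)" for k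
    using U2 by (intro integrable_const_bound[of _ B]) auto
  have step: "cmod (expectation (T (Suc n)) - expectation (T n)) \<le> C * r * expectation (\<lambda>\<omega>. (U n \<omega>)\<^sup>2)" for n
  proof -
    have T1: "T (Suc n) \<omega> = Y n \<omega> * iexp (U n \<omega> * eps (Suc n) \<omega>)" for \<omega>
      by (simp add: T_def Y_def S_def exp_add[symmetric] algebra_simps)
    have T0: "T n \<omega> = Y n \<omega> * exp (- (\<sigma>\<^sup>2 * (U n \<omega>)\<^sup>2 / 2))" for \<omega>
      by (simp add: T_def Y_def V_def exp_add[symmetric] exp_of_real[symmetric] algebra_simps add_divide_distrib)
    have iY: "integrable M (\<lambda>\<omega>. Y n \<omega> * char noise (U n \<omega>))"
    proof (rule integrable_const_bound[of _ C])
      show "AE \<omega> in M. cmod (Y n \<omega> * char noise (U n \<omega>)) \<le> C"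
      proof (rule AE_I2)
        fix \<omega> assume "\<omega> \<in> space M"
        then have "cmod (Y n \<omega>) * cmod (char noise (U n \<omega>)) \<le> C * 1"
          by (intro mult_mono YC D.cmod_char_le_1) (auto simp: C_def)
        then show "cmod (Y n \<omega> * char noise (U n \<omega>)) \<le> C" by (simp only: norm_mult mult_1_right)
      qed
    qed measurable
    have iT: "integrable M (\<lambda>\<omega>. Y n \<omega> * complex_of_real (exp (- (\<sigma>\<^sup>2 * (U n \<omega>)\<^sup>2 / 2))))"
      unfolding T0[symmetric] using TC by (intro integrable_const_bound[of _ C]) auto
    have "cmod (expectation (T (Suc n)) - expectation (T n))
      = cmod (\<integral>\<omega>. Y n \<omega> * char noise (U n \<omega>) - Y n \<omega> * exp (- (\<sigma>\<^sup>2 * (U n \<omega>)\<^sup>2 / 2)) \<partial>M)"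
    proof -
      have "expectation (T (Suc n)) = (\<integral>\<omega>. Y n \<omega> * char noise (U n \<omega>) \<partial>M)"
        unfolding T1[abs_def] by (rule expectation_past_iexp[OF YF YC U])
      moreover have "expectation (T n) = (\<integral>\<omega>. Y n \<omega> * complex_of_real (exp (- (\<sigma>\<^sup>2 * (U n \<omega>)\<^sup>2 / 2))) \<partial>M)"
        unfolding T0[abs_def] ..
      ultimately show ?thesis by (simp only: Bochner_Integration.integral_diff[OF iY iT])
    qed
    also have "\<dots> \<le> (\<integral>\<omega>. C * r * (U n \<omega>)\<^sup>2 \<partial>M)"
    proof (rule order_trans[OF integral_norm_bound integral_mono])
      fix \<omega> assume "\<omega> \<in> space M"
      have "cmod (Y n \<omega> * char noise (U n \<omega>) - Y n \<omega> * exp (- (\<sigma>\<^sup>2 * (U n \<omega>)\<^sup>2 / 2)))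
        = cmod (Y n \<omega>) * cmod (char noise (U n \<omega>) - exp (- (\<sigma>\<^sup>2 * (U n \<omega>)\<^sup>2 / 2)))"
        by (simp add: norm_mult[symmetric] right_diff_distrib)
      also have "\<dots> \<le> C * (r * (U n \<omega>)\<^sup>2)"
        using \<open>\<omega> \<in> space M\<close> \<open>r \<ge> 0\<close> by (intro mult_mono YC r small) (auto simp: C_def)
      finally show "cmod (Y n \<omega> * char noise (U n \<omega>) - Y n \<omega> * exp (- (\<sigma>\<^sup>2 * (U n \<omega>)\<^sup>2 / 2))) \<le> C * r * (U n \<omega>)\<^sup>2"
        by (simp add: mult.assoc)
    next
      show "integrable M (\<lambda>\<omega>. cmod (Y n \<omega> * char noise (U n \<omega>) - Y n \<omega> * exp (- (\<sigma>\<^sup>2 * (U n \<omega>)\<^sup>2 / 2))))"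
        by (intro integrable_norm, rule Bochner_Integration.integrable_diff[OF iY iT])
    qed (use intU2 in simp)
    finally show ?thesis by simp
  qed
  have "cmod (expectation (T N) - 1) \<le> C * r * (\<Sum>k<N. expectation (\<lambda>\<omega>. (U k \<omega>)\<^sup>2))"
  proof (induction N)
    case 0
    show ?case by (simp add: T_def S_def V_def prob_space)
  next
    case (Suc N)
    have "cmod (expectation (T (Suc N)) - 1) \<le> cmod (expectation (T (Suc N)) - expectation (T N)) + cmod (expectation (T N) - 1)"
      by (rule order_trans[OF _ norm_triangle_ineq]) simp
    with Suc step[of N] show ?case by (simp add: distrib_left)
  qed
  also have "(\<Sum>k<N. expectation (\<lambda>\<omega>. (U k \<omega>)\<^sup>2)) = expectation (\<lambda>\<omega>. \<Sum>k<N. (U k \<omega>)\<^sup>2)"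
    using intU2 by (subst Bochner_Integration.integral_sum) auto
  also have "C * r * expectation (\<lambda>\<omega>. \<Sum>k<N. (U k \<omega>)\<^sup>2) \<le> C * r * expectation (\<lambda>\<omega>. B)"
    using intU2 bound \<open>r \<ge> 0\<close> by (intro mult_left_mono integral_mono) (auto simp: C_def)
  finally show ?thesis by (simp add: T_def S_def V_def C_def prob_space)
qed

text \<open>With two moments, the second-order Taylor error is u^2 / 6 times the mean of min (6
  eps^2, |u| |eps|^3), and this mean tends to 0 by dominated convergence. Replacing 1 - y by exp (-
  y) costs at most y^2, which is of order u^4.\<close>

lemma char_noise_small:
  assumes "r > 0"
  shows "\<exists>\<eta>>0. \<forall>u. \<bar>u\<bar> \<le> \<eta> \<longrightarrow> cmod (char noise u - exp (- (\<sigma>\<^sup>2 * u\<^sup>2 / 2))) \<le> r * u\<^sup>2"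
proof -
  have [measurable]: "eps 1 \<in> borel_measurable M" by (rule eps_measurable) simp
  define e where "e u = expectation (\<lambda>\<omega>. min (6 * (eps 1 \<omega>)\<^sup>2) (\<bar>u\<bar> * \<bar>eps 1 \<omega>\<bar> ^ 3))" for u
  have "((\<lambda>u. expectation (\<lambda>\<omega>. min (6 * (eps 1 \<omega>)\<^sup>2) (\<bar>u\<bar> * \<bar>eps 1 \<omega>\<bar> ^ 3))) \<longlongrightarrow> expectation (\<lambda>\<omega>. 0)) (at 0)"
  proof (subst tendsto_at_iff_sequentially, intro allI impI)
    fix X :: "nat \<Rightarrow> real" assume "\<forall>i. X i \<in> UNIV - {0}" and X: "X \<longlonglongrightarrow> 0"
    show "((\<lambda>u. expectation (\<lambda>\<omega>. min (6 * (eps 1 \<omega>)\<^sup>2) (\<bar>u\<bar> * \<bar>eps 1 \<omega>\<bar> ^ 3))) \<circ> X) \<longlonglongrightarrow> expectation (\<lambda>\<omega>. 0)"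
      unfolding comp_def
    proof (rule integral_dominated_convergence[where w = "\<lambda>\<omega>. 6 * (eps 1 \<omega>)\<^sup>2"])
      show "AE \<omega> in M. (\<lambda>i. min (6 * (eps 1 \<omega>)\<^sup>2) (\<bar>X i\<bar> * \<bar>eps 1 \<omega>\<bar> ^ 3)) \<longlonglongrightarrow> 0"
      proof (intro AE_I2)
        fix \<omega>
        have "(\<lambda>i. min (6 * (eps 1 \<omega>)\<^sup>2) (\<bar>X i\<bar> * \<bar>eps 1 \<omega>\<bar> ^ 3)) \<longlonglongrightarrow> min (6 * (eps 1 \<omega>)\<^sup>2) (\<bar>0\<bar> * \<bar>eps 1 \<omega>\<bar> ^ 3)"
          by (intro tendsto_intros X)
        then show "(\<lambda>i. min (6 * (eps 1 \<omega>)\<^sup>2) (\<bar>X i\<bar> * \<bar>eps 1 \<omega>\<bar> ^ 3)) \<longlonglongrightarrow> 0" by simp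
      qed
    qed (use eps_square in auto)
  qed
  then have lim: "(e \<longlongrightarrow> 0) (at 0)" by (simp add: e_def[abs_def])
  define s where "s = \<sigma>\<^sup>2"
  have "((\<lambda>u. e u / 6 + s\<^sup>2 * u\<^sup>2 / 4) \<longlongrightarrow> 0 / 6 + s\<^sup>2 * 0\<^sup>2 / 4) (at 0)"
    by (intro tendsto_intros lim) auto
  then have "\<forall>\<^sub>F u in at 0. e u / 6 + s\<^sup>2 * u\<^sup>2 / 4 < r"
    using assms by (intro order_tendstoD(2)) auto
  then obtain d where d: "d > 0" "\<And>u. u \<noteq> 0 \<Longrightarrow> \<bar>u\<bar> < d \<Longrightarrow> e u / 6 + s\<^sup>2 * u\<^sup>2 / 4 < r"
    unfolding eventually_at by (auto simp: dist_real_def)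
  have A: "cmod (char noise u - (1 - u\<^sup>2 * s / 2)) \<le> u\<^sup>2 / 6 * e u" for u
    unfolding e_def using eps_mean eps_square by (intro char_approx3') (auto simp: s_def)
  have E: "\<bar>(1 - y) - exp (- y)\<bar> \<le> y\<^sup>2" if "y \<ge> 0" for y :: real
  proof -
    have "1 - y \<le> exp (- y)" using exp_ge_add_one_self[of "- y"] by simp
    moreover have "exp (- y) \<le> 1 - y + y\<^sup>2"
    proof -
      \<comment> \<open>The upper bound for 1 / exp y comes from exp y >= 1 + y.\<close>
      have "(1 + y) * (1 - y + y\<^sup>2) = 1 + y * y\<^sup>2" by (simp add: algebra_simps power2_eq_square)
      then have "1 \<le> (1 + y) * (1 - y + y\<^sup>2)" using that by simp
      also have "\<dots> \<le> exp y * (1 - y + y\<^sup>2)"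
      proof (rule mult_right_mono)
        show "1 + y \<le> exp y" using exp_ge_add_one_self[of y] by simp
        have "1 - y + y\<^sup>2 = (1 - y / 2)\<^sup>2 + 3 / 4 * y\<^sup>2" by (simp add: power2_eq_square field_simps)
        then show "0 \<le> 1 - y + y\<^sup>2" by simp
      qed
      finally show ?thesis by (simp add: exp_minus field_simps)
    qed
    ultimately show ?thesis by simp
  qed
  show ?thesis
  \<comment> \<open>Halved because the neighbourhood covers only |u| strictly below d.\<close>
  proof (intro exI[of _ "d / 2"] conjI allI impI)
    fix u assume u: "\<bar>u\<bar> \<le> d / 2"
    show "cmod (char noise u - exp (- (\<sigma>\<^sup>2 * u\<^sup>2 / 2))) \<le> r * u\<^sup>2"
    proof (cases "u = 0")
      case True
      interpret D: real_distribution noise by (rule real_distribution_noise)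
      show ?thesis using True by (simp only: D.char_zero) simp
    next
      case False
      have "cmod (char noise u - exp (- (\<sigma>\<^sup>2 * u\<^sup>2 / 2))) \<le> cmod (char noise u - (1 - u\<^sup>2 * s / 2))
          + cmod (complex_of_real ((1 - u\<^sup>2 * s / 2) - exp (- (u\<^sup>2 * s / 2))))"
        by (rule order_trans[OF _ norm_triangle_ineq]) (simp add: s_def mult.commute)
      also have "\<dots> \<le> u\<^sup>2 / 6 * e u + (u\<^sup>2 * s / 2)\<^sup>2"
        unfolding norm_of_real by (intro add_mono A E) (simp add: s_def)
      also have "\<dots> = (e u / 6 + s\<^sup>2 * u\<^sup>2 / 4) * u\<^sup>2" by (simp add: power2_eq_square field_simps)
      also have "\<dots> \<le> r * u\<^sup>2" using d(2)[of u] False u d(1) by (intro mult_right_mono) auto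
      finally show ?thesis .
    qed
  qed (use d in simp)
qed

text \<open>Union bound over O(h) variables. Each one exceeds the level with probability at most g h
  / (delta h), where g is a truncated second moment; the 1 / h cancels the number of terms and g
  tends to 0.\<close>

lemma max_noise_small:
  assumes "\<delta> > 0"
  shows "((\<lambda>h. prob {\<omega> \<in> space M. \<exists>k\<in>{1..m * nat \<lceil>h\<rceil> + 1}. (eps k \<omega>)\<^sup>2 > \<delta> * h}) \<longlongrightarrow> 0) at_top"
proof -
  have [measurable]: "eps 1 \<in> borel_measurable M" by (rule eps_measurable) simp
  define g where "g h = expectation (\<lambda>\<omega>. (eps 1 \<omega>)\<^sup>2 * indicator {\<omega> \<in> space M. (eps 1 \<omega>)\<^sup>2 > \<delta> * h} \<omega>)" for h
  have "((\<lambda>h. expectation (\<lambda>\<omega>. (eps 1 \<omega>)\<^sup>2 * indicator {\<omega> \<in> space M. (eps 1 \<omega>)\<^sup>2 > \<delta> * h} \<omega>)) \<longlongrightarrow> expectation (\<lambda>\<omega>. 0)) at_top"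
  proof (rule integral_dominated_convergence_at_top[where w = "\<lambda>\<omega>. (eps 1 \<omega>)\<^sup>2"])
    show "AE \<omega> in M. ((\<lambda>h. (eps 1 \<omega>)\<^sup>2 * indicator {\<omega> \<in> space M. (eps 1 \<omega>)\<^sup>2 > \<delta> * h} \<omega>) \<longlongrightarrow> 0) at_top"
    proof (intro AE_I2)
      fix \<omega>
      have "\<forall>\<^sub>F h in at_top. h \<ge> (eps 1 \<omega>)\<^sup>2 / \<delta>" by (rule eventually_ge_at_top)
      then have "\<forall>\<^sub>F h in at_top. (eps 1 \<omega>)\<^sup>2 * indicator {\<omega> \<in> space M. (eps 1 \<omega>)\<^sup>2 > \<delta> * h} \<omega> = 0"
        by eventually_elim (use assms in \<open>auto simp: indicator_def field_simps\<close>)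
      then show "((\<lambda>h. (eps 1 \<omega>)\<^sup>2 * indicator {\<omega> \<in> space M. (eps 1 \<omega>)\<^sup>2 > \<delta> * h} \<omega>) \<longlongrightarrow> 0) at_top"
        by (rule tendsto_eventually)
    qed
  qed (use eps_square in \<open>auto simp: indicator_def intro!: always_eventually\<close>)
  then have g0: "(g \<longlongrightarrow> 0) at_top" by (simp add: g_def[abs_def])
  have P1: "prob {\<omega> \<in> space M. (eps k \<omega>)\<^sup>2 > \<delta> * h} \<le> g h / (\<delta> * h)" if "k \<ge> 1" "h > 0" for k h
  proof -
    note [measurable] = eps_measurable[OF that(1)]
    define A where "A = {\<omega> \<in> space M. (eps k \<omega>)\<^sup>2 > \<delta> * h}"
    have "A \<inter> space M = A" by (auto simp: A_def)
    then have "prob A = expectation (indicator A)" by simp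
    also have "\<dots> = expectation (\<lambda>\<omega>. indicator {x. x\<^sup>2 > \<delta> * h} (eps k \<omega>))"
      by (intro Bochner_Integration.integral_cong) (auto simp: indicator_def A_def)
    also have "\<dots> = expectation (\<lambda>\<omega>. indicator {x. x\<^sup>2 > \<delta> * h} (eps 1 \<omega>))"
      by (rule eps_integral[OF that(1)]) measurable
    also have "\<dots> \<le> expectation (\<lambda>\<omega>. (eps 1 \<omega>)\<^sup>2 * indicator {\<omega> \<in> space M. (eps 1 \<omega>)\<^sup>2 > \<delta> * h} \<omega> / (\<delta> * h))"
    proof (rule integral_mono)
      show "integrable M (\<lambda>\<omega>. indicator {x. x\<^sup>2 > \<delta> * h} (eps 1 \<omega>) :: real)"
        by (intro integrable_const_bound[of _ 1]) auto
      show "integrable M (\<lambda>\<omega>. (eps 1 \<omega>)\<^sup>2 * indicator {\<omega> \<in> space M. (eps 1 \<omega>)\<^sup>2 > \<delta> * h} \<omega> / (\<delta> * h))"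
        using eps_square by (intro integrable_divide integrable_real_mult_indicator) auto
    qed (use assms that in \<open>auto simp: indicator_def field_simps\<close>)
    also have "\<dots> = g h / (\<delta> * h)" by (simp add: g_def)
    finally show ?thesis by (simp add: A_def)
  qed
  have up: "prob {\<omega> \<in> space M. \<exists>k\<in>{1..m * nat \<lceil>h\<rceil> + 1}. (eps k \<omega>)\<^sup>2 > \<delta> * h} \<le> (2 * real m + 1) / \<delta> * g h"
    if "h \<ge> 1" for h
  proof -
    let ?N = "m * nat \<lceil>h\<rceil> + 1"
    have g_nonneg: "g h \<ge> 0" unfolding g_def by simp
    have "prob {\<omega> \<in> space M. \<exists>k\<in>{1..?N}. (eps k \<omega>)\<^sup>2 > \<delta> * h} = prob (\<Union>k\<in>{1..?N}. {\<omega> \<in> space M. (eps k \<omega>)\<^sup>2 > \<delta> * h})"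
      by (intro arg_cong[where f = prob]) auto
    also have "\<dots> \<le> (\<Sum>k\<in>{1..?N}. prob {\<omega> \<in> space M. (eps k \<omega>)\<^sup>2 > \<delta> * h})"
    proof (rule finite_measure_subadditive_finite)
      have "{\<omega> \<in> space M. (eps k \<omega>)\<^sup>2 > \<delta> * h} \<in> events" if "k \<ge> 1" for k
        using eps_measurable[OF that] by measurable
      then show "(\<lambda>k. {\<omega> \<in> space M. (eps k \<omega>)\<^sup>2 > \<delta> * h}) ` {1..?N} \<subseteq> events" by auto
    qed simp
    also have "\<dots> \<le> (\<Sum>k\<in>{1..?N}. g h / (\<delta> * h))" using that by (intro sum_mono P1) auto
    also have "\<dots> = real ?N / h * (g h / \<delta>)" by simp
    also have "\<dots> \<le> (2 * real m + 1) * (g h / \<delta>)"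
    proof (rule mult_right_mono)
      have "real (nat \<lceil>h\<rceil>) \<le> 2 * h" using that by linarith
      then have "real m * real (nat \<lceil>h\<rceil>) \<le> real m * (2 * h)" by (intro mult_left_mono) auto
      then have "real ?N \<le> (2 * real m + 1) * h" using that by (simp add: algebra_simps)
      then show "real ?N / h \<le> 2 * real m + 1" using that by (simp add: divide_simps)
    qed (use g_nonneg assms in auto)
    finally show ?thesis by simp
  qed
  have lim: "((\<lambda>h. (2 * real m + 1) / \<delta> * g h) \<longlongrightarrow> 0) at_top"
    using tendsto_mult[OF tendsto_const g0, of "(2 * real m + 1) / \<delta>"] by simp
  show ?thesis
    by (rule tendsto_sandwich[OF always_eventually eventually_mono[OF eventually_ge_at_top[of 1] up]
          tendsto_const lim]) auto
qed

text \<open>Chernoff bound for the nonnegative squares: q, the mean of exp (- eps^2), is below 1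
  because the noise is not almost surely zero. It shows that a horizon proportional to h collects
  energy c h with high probability.\<close>

lemma noise_energy_lower:
  assumes "c \<ge> 0"
  shows "\<exists>m. \<forall>h\<ge>0. prob {\<omega> \<in> space M. (\<Sum>k=1..m * nat \<lceil>h\<rceil>. (eps k \<omega>)\<^sup>2) < c * h} \<le> exp (- h)"
proof -
  have [measurable]: "eps 1 \<in> borel_measurable M" by (rule eps_measurable) simp
  define q where "q = expectation (\<lambda>\<omega>. exp (- (eps 1 \<omega>)\<^sup>2))"
  have int1: "integrable M (\<lambda>\<omega>. exp (- (eps 1 \<omega>)\<^sup>2))"
    by (intro integrable_const_bound[of _ 1]) auto
  have q0: "q \<ge> 0" unfolding q_def by simp
  have q1: "q < 1"
  proof (rule ccontr)
    assume "\<not> q < 1"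
    have nn: "expectation (\<lambda>\<omega>. 1 - exp (- (eps 1 \<omega>)\<^sup>2)) = 1 - q"
      using int1 by (simp add: q_def prob_space)
    moreover have "expectation (\<lambda>\<omega>. 1 - exp (- (eps 1 \<omega>)\<^sup>2)) \<ge> 0" by simp
    ultimately have "expectation (\<lambda>\<omega>. 1 - exp (- (eps 1 \<omega>)\<^sup>2)) = 0" using \<open>\<not> q < 1\<close> by linarith
    then have "AE \<omega> in M. 1 - exp (- (eps 1 \<omega>)\<^sup>2) = 0"
      using int1 by (subst integral_nonneg_eq_0_iff_AE[symmetric]) auto
    then have "AE \<omega> in M. (eps 1 \<omega>)\<^sup>2 = 0" by eventually_elim auto
    then have "expectation (\<lambda>\<omega>. (eps 1 \<omega>)\<^sup>2) = expectation (\<lambda>\<omega>. 0)"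
      by (intro integral_cong_AE) auto
    then show False using eps_square \<sigma>_pos by simp
  qed
  have "(\<lambda>m. q ^ m) \<longlonglongrightarrow> 0" using q0 q1 by (intro LIMSEQ_realpow_zero)
  \<comment> \<open>In the exponent c pays for Markov's inequality at level c h; the extra 1 leaves
    exp (- h).\<close>
  then have "\<forall>\<^sub>F m in sequentially. q ^ m < exp (- (c + 1))" by (intro order_tendstoD(2)) auto
  then obtain m where m: "q ^ m < exp (- (c + 1))" using eventually_happens by force
  show ?thesis
  proof (intro exI[of _ m] allI impI)
    fix h :: real assume h: "h \<ge> 0"
    let ?n = "m * nat \<lceil>h\<rceil>"
    have ind: "indep_vars (\<lambda>_. borel) (\<lambda>k \<omega>. exp (- (eps k \<omega>)\<^sup>2)) {1..?n}"
      using indep_vars_compose[OF indep_vars_subset[OF eps_indep, of "{1..?n}"], of "\<lambda>_ x. exp (- x\<^sup>2)" "\<lambda>_. borel"]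
      by (auto simp: comp_def)
    have intk: "integrable M (\<lambda>\<omega>. exp (- (eps k \<omega>)\<^sup>2))" "expectation (\<lambda>\<omega>. exp (- (eps k \<omega>)\<^sup>2)) = q" if "k \<ge> 1" for k
      using eps_integral[OF that, of "\<lambda>x. exp (- x\<^sup>2)"] int1 by (auto simp: q_def)
    define G where "G \<omega> = (\<Prod>k\<in>{1..?n}. exp (- (eps k \<omega>)\<^sup>2))" for \<omega>
    have intG: "integrable M G" unfolding G_def
      by (rule indep_vars_integrable[OF _ ind]) (auto intro: intk)
    have EG: "expectation G = q ^ ?n" unfolding G_def
      by (subst indep_vars_lebesgue_integral[OF _ ind]) (auto intro: intk simp: intk)
    have G: "G \<omega> = exp (- (\<Sum>k=1..?n. (eps k \<omega>)\<^sup>2))" for \<omega>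
      by (simp add: G_def exp_sum[symmetric] sum_negf)
    have Gm: "{\<omega> \<in> space M. G \<omega> \<ge> exp (- (c * h))} \<in> events"
      using borel_measurable_integrable[OF intG] by measurable
    have "(q ^ m) ^ nat \<lceil>h\<rceil> \<le> exp (- (c + 1)) ^ nat \<lceil>h\<rceil>"
      using m q0 by (intro power_mono) auto
    also have "\<dots> = exp (real (nat \<lceil>h\<rceil>) * - (c + 1))" by (rule exp_of_nat_mult[symmetric])
    also have "\<dots> \<le> exp (h * - (c + 1))"
    proof -
      have "h \<le> real (nat \<lceil>h\<rceil>)" by linarith
      then show ?thesis using assms by (simp add: mult_right_mono_neg)
    qed
    finally have pow: "(q ^ m) ^ nat \<lceil>h\<rceil> \<le> exp (h * - (c + 1))" .
    have "prob {\<omega> \<in> space M. (\<Sum>k=1..?n. (eps k \<omega>)\<^sup>2) < c * h} \<le> prob {\<omega> \<in> space M. G \<omega> \<ge> exp (- (c * h))}"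
      by (rule finite_measure_mono[OF _ Gm]) (auto simp: G)
    also have "\<dots> \<le> expectation G / exp (- (c * h))"
      by (rule integral_Markov_inequality_measure[OF intG, of "{}"]) (auto simp: G)
    also have "\<dots> = exp (c * h) * (q ^ m) ^ nat \<lceil>h\<rceil>" by (simp add: EG exp_minus field_simps power_mult)
    also have "\<dots> \<le> exp (c * h) * exp (h * - (c + 1))"
      by (intro mult_left_mono pow) simp
    also have "\<dots> = exp (- h)" unfolding exp_add[symmetric] by (simp add: algebra_simps)
    finally show "prob {\<omega> \<in> space M. (\<Sum>k=1..?n. (eps k \<omega>)\<^sup>2) < c * h} \<le> exp (- h)" .
  qed
qed

end

section \<open>Yule-Walker equations and stability of the companion matrix\<close>

lemma pos_strict_mono: "i < j \<Longrightarrow> pos i < pos (j :: 'p::{finite,wellorder})"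
  unfolding pos_def by (auto intro!: psubset_card_mono)

lemma pos_inject [simp]: "pos i = pos (j :: 'p::{finite,wellorder}) \<longleftrightarrow> i = j"
  using pos_strict_mono by (metis linorder_neqE nat_neq_iff)

lemma pos_bounds: "1 \<le> pos i" "pos (i :: 'p::{finite,wellorder}) \<le> CARD('p)"
proof -
  show "1 \<le> pos i" by (simp add: pos_def)
  have "card {j. j < i} < CARD('p)" by (intro psubset_card_mono) auto
  then show "pos i \<le> CARD('p)" by (simp add: pos_def)
qed

lemma bij_betw_pos: "bij_betw pos (UNIV :: 'p::{finite,wellorder} set) {1..CARD('p)}"
proof -
  have "inj (pos :: 'p \<Rightarrow> nat)" by (auto simp: inj_def)
  moreover have "range (pos :: 'p \<Rightarrow> nat) \<subseteq> {1..CARD('p)}" using pos_bounds by auto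
  ultimately have "range (pos :: 'p \<Rightarrow> nat) = {1..CARD('p)}"
    by (intro card_subset_eq) (auto simp: card_image)
  with \<open>inj pos\<close> show ?thesis by (simp add: bij_betw_def)
qed

lemma sum_pos: "(\<Sum>j=1..CARD('p). f j) = (\<Sum>i\<in>(UNIV :: 'p::{finite,wellorder} set). f (pos i))"
  by (rule sum.reindex_bij_betw[OF bij_betw_pos, symmetric])

lemma ex_pos: "j \<in> {1..CARD('p)} \<Longrightarrow> \<exists>i :: 'p::{finite,wellorder}. j = pos i"
  using bij_betw_pos[where 'p = 'p] by (auto simp: bij_betw_def image_iff set_eq_iff)

lemma coef_pos [simp]: "coef v (pos i) = v $ i"
  using pos_bounds[of i] by (auto simp: coef_def)

lemma coef_outside: "j = 0 \<or> j > CARD('p) \<Longrightarrow> coef (v :: real^'p::{finite,wellorder}) j = 0"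
  by (auto simp: coef_def)

lemma coef_lambda:
  "coef (\<chi> i :: 'p::{finite,wellorder}. g (pos i)) j = (if j \<in> {1..CARD('p)} then g j else 0)"
proof (cases "j \<in> {1..CARD('p)}")
  case True
  then obtain i :: 'p where "j = pos i" using ex_pos by blast
  then show ?thesis using True by simp
qed (auto simp: coef_def)

lemma coef_linear:
  "coef (a + b) j = coef a j + coef b j" "coef (a - b) j = coef a j - coef b j"
  "coef (c *\<^sub>R a) j = c * coef a j" "coef 0 j = 0"
  by (auto simp: coef_def)

lemma coef_abs_le: "\<bar>coef v j\<bar> \<le> norm v"
  by (auto simp: coef_def component_le_norm_cart)

lemma vec_eq_coef: "(\<And>j. j \<in> {1..CARD('p)} \<Longrightarrow> coef a j = coef b j) \<Longrightarrow> a = (b :: real^'p::{finite,wellorder})"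
  by (metis atLeastAtMost_iff coef_pos pos_bounds vec_eq_iff)

lemma inner_coef: "a \<bullet> b = (\<Sum>j=1..CARD('p). coef a j * coef b j)" for a b :: "real^'p::{finite,wellorder}"
  unfolding sum_pos by (simp add: inner_vec_def)

lemma continuous_on_coef [continuous_intros]:
  fixes f :: "'a::topological_space \<Rightarrow> real^'p::{finite,wellorder}"
  shows "continuous_on S f \<Longrightarrow> continuous_on S (\<lambda>x. coef (f x) j)"
  unfolding coef_def by (cases "j \<in> {1..CARD('p)}") (auto intro!: continuous_intros)

text \<open>The range stays {1..n} because the term entering at the top is 0. This is the shape of
  every shift by one coordinate below, since \<open>coef\<close> vanishes at p + 1.\<close>

lemma sum_shift:
  assumes "f (Suc n) = (0::real)" "n \<ge> 1"
  shows "(\<Sum>a=1..n. f a) = f 1 + (\<Sum>a=1..n. f (Suc a))"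
proof -
  have "(\<Sum>a=1..n. f a) = f 1 + (\<Sum>a=Suc 1..n. f a)"
    using assms by (intro sum.atLeast_Suc_atMost) auto
  also have "(\<Sum>a=Suc 1..n. f a) = (\<Sum>a=Suc 1..Suc n. f a)" using assms by simp
  also have "\<dots> = (\<Sum>a=1..n. f (Suc a))" by (rule sum.shift_bounds_cl_Suc_ivl)
  finally show ?thesis .
qed

definition nat_dist :: "nat \<Rightarrow> nat \<Rightarrow> nat" where
  "nat_dist a b = nat \<bar>int a - int b\<bar>"

lemma nat_dist_simps [simp]:
  "nat_dist a a = 0" "nat_dist 0 a = a" "nat_dist a 0 = a" "nat_dist (Suc a) (Suc b) = nat_dist a b" "nat_dist (Suc 0) (Suc b) = b" "nat_dist (Suc b) (Suc 0) = b"
  by (auto simp: nat_dist_def)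

lemma nat_dist_le: "a \<le> b \<Longrightarrow> nat_dist a b = b - a" "b \<le> a \<Longrightarrow> nat_dist a b = a - b"
  by (auto simp: nat_dist_def)

lemma nat_dist_commute: "nat_dist a b = nat_dist b a"
  by (auto simp: nat_dist_def)

section \<open>The Yule-Walker system as a linear map\<close>

definition first_unit :: "real^'p::{finite,wellorder}" where
  "first_unit = (\<chi> i. if pos i = 1 then 1 else 0)"

lemma coef_first_unit: "coef (first_unit :: real^'p::{finite,wellorder}) j = (if j = 1 then 1 else 0)"
  using coef_lambda[of "\<lambda>j. if j = 1 then 1 else 0" j, where 'p = 'p]
  by (auto simp: first_unit_def Suc_le_eq)

lemma norm_first_unit: "norm (first_unit :: real^'p::{finite,wellorder}) = 1"
proof -
  have "(first_unit :: real^'p::{finite,wellorder}) \<bullet> first_unit = (\<Sum>j=1..CARD('p). if j = 1 then 1 else 0)"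
    unfolding inner_coef coef_first_unit by (intro sum.cong) auto
  then show ?thesis by (simp add: norm_eq_sqrt_inner Suc_le_eq)
qed

text \<open>A vector \<open>r\<close> encodes autocorrelations \<open>\<kappa>\<^sub>0, \<dots>, \<kappa>\<^sub>p\<^sub>-\<^sub>1\<close> by \<open>\<kappa>\<^sub>m = coef r (m + 1)\<close>; the
  Yule-Walker system together with \<open>\<kappa>\<^sub>0 = 1\<close> then reads \<open>yw_map \<theta> r = first_unit\<close>.\<close>

definition yw_map :: "real^'p::{finite,wellorder} \<Rightarrow> real^'p::{finite,wellorder} \<Rightarrow> real^'p::{finite,wellorder}" where
  "yw_map \<theta> r = (\<chi> i. if pos i = 1 then coef r 1
     else coef r (pos i) - (\<Sum>l=1..CARD('p). coef \<theta> l * coef r (nat_dist (pos i - 1) l + 1)))"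

definition toeplitz :: "real^'p::{finite,wellorder} \<Rightarrow> real^'p::{finite,wellorder}^'p::{finite,wellorder}" where
  "toeplitz r = (\<chi> i j. coef r (nat_dist (pos i) (pos j) + 1))"

lemma coef_yw_map:
  "coef (yw_map \<theta> r) j = (if j = 1 then coef r 1 else if j \<in> {2..CARD('p)} then
     coef r j - (\<Sum>l=1..CARD('p). coef \<theta> l * coef r (nat_dist (j - 1) l + 1)) else 0)"
  for \<theta> :: "real^'p::{finite,wellorder}"
  unfolding yw_map_def coef_lambda[of "\<lambda>j. if j = 1 then coef r 1
     else coef r j - (\<Sum>l=1..CARD('p). coef \<theta> l * coef r (nat_dist (j - 1) l + 1))"]
  by (auto simp: Suc_le_eq)

lemma yw_map_linear: "yw_map \<theta> (c *\<^sub>R a) = c *\<^sub>R yw_map \<theta> a" "yw_map \<theta> (a - b) = yw_map \<theta> a - yw_map \<theta> b"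
  by (auto simp: yw_map_def vec_eq_iff coef_linear sum_distrib_left sum_subtractf algebra_simps)

lemma toeplitz_symmetric: "transpose (toeplitz r) = toeplitz r"
  by (simp add: toeplitz_def transpose_def vec_eq_iff nat_dist_commute)

text \<open>Splitting at l = j and substituting l = j - k and l = j + k reproduces the two sums of
  Condition 3; with g 0 = 1 the middle term is its right-hand side.\<close>

lemma toeplitz_sum:
  fixes t g :: "nat \<Rightarrow> real"
  assumes "1 \<le> j" "j \<le> n"
  shows "(\<Sum>l=1..n. t l * g (nat_dist j l)) = (\<Sum>k=1..j-1. t (j - k) * g k) + t j * g 0 + (\<Sum>k=1..n-j. t (k + j) * g k)"
proof -
  have "(\<Sum>l=1..n. t l * g (nat_dist j l)) = (\<Sum>l\<in>{1..j-1} \<union> {j..n}. t l * g (nat_dist j l))"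
    using assms by (intro sum.cong) auto
  also have "\<dots> = (\<Sum>l=1..j-1. t l * g (nat_dist j l)) + (\<Sum>l=j..n. t l * g (nat_dist j l))"
    by (rule sum.union_disjoint) (use assms in auto)
  also have "(\<Sum>l=j..n. t l * g (nat_dist j l)) = t j * g 0 + (\<Sum>l=Suc j..n. t l * g (nat_dist j l))"
    using assms by (subst sum.atLeast_Suc_atMost) auto
  also have "(\<Sum>l=Suc j..n. t l * g (nat_dist j l)) = (\<Sum>k=1..n-j. t (k + j) * g k)"
    by (rule sum.reindex_bij_witness[of _ "\<lambda>k. k + j" "\<lambda>l. l - j"]) (use assms in \<open>auto simp: nat_dist_le\<close>)
  also have "(\<Sum>l=1..j-1. t l * g (nat_dist j l)) = (\<Sum>k=1..j-1. t (j - k) * g k)"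
    by (rule sum.reindex_bij_witness[of _ "\<lambda>k. j - k" "\<lambda>l. j - l"]) (use assms in \<open>auto simp: nat_dist_le\<close>)
  finally show ?thesis by simp
qed

text \<open>The system leaves Y 0 free. Overwriting it by kappa_0 = 1 turns the right-hand side into
  the diagonal term of a single Toeplitz sum.\<close>

lemma yw_solves_iff:
  "yw_solves \<theta> Y \<longleftrightarrow> (\<forall>j\<in>{1..CARD('p) - 1}. Y j = (\<Sum>l=1..CARD('p). coef \<theta> l * (Y(0 := 1)) (nat_dist j l)))"
  for \<theta> :: "real^'p::{finite,wellorder}"
proof -
  have "- (\<Sum>k=1..j-1. coef \<theta> (j - k) * Y k) + Y j - (\<Sum>k=1..CARD('p) - j. coef \<theta> (k + j) * Y k) = coef \<theta> j
      \<longleftrightarrow> Y j = (\<Sum>l=1..CARD('p). coef \<theta> l * (Y(0 := 1)) (nat_dist j l))" if "j \<in> {1..CARD('p) - 1}" for j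
  proof -
    have j: "1 \<le> j" "j \<le> CARD('p)" using that by auto
    have e: "(\<Sum>k=1..n. t k * (Y(0 := 1)) k) = (\<Sum>k=1..n. t k * Y k)" for n and t :: "nat \<Rightarrow> real"
      by (intro sum.cong) auto
    show ?thesis unfolding toeplitz_sum[OF j] e by auto
  qed
  then show ?thesis unfolding yw_solves_def by blast
qed

lemma yw_map_eq_first_unit:
  fixes \<theta> :: "real^'p::{finite,wellorder}"
  assumes "coef r 1 = 1"
  shows "yw_map \<theta> r = first_unit \<longleftrightarrow> yw_solves \<theta> (\<lambda>m. coef r (m + 1))" (is "?L \<longleftrightarrow> ?R")
proof -
  have upd: "(\<lambda>m. coef r (m + 1))(0 := 1) = (\<lambda>m. coef r (m + 1))" using assms by auto
  have "?L \<longleftrightarrow> (\<forall>j\<in>{1..CARD('p)}. coef (yw_map \<theta> r) j = coef (first_unit :: real^'p::{finite,wellorder}) j)"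
    using vec_eq_coef by metis
  also have "\<dots> \<longleftrightarrow> (\<forall>j\<in>{2..CARD('p)}. coef r j = (\<Sum>l=1..CARD('p). coef \<theta> l * coef r (nat_dist (j - 1) l + 1)))"
    using assms by (auto simp: coef_yw_map coef_first_unit)
  also have "\<dots> \<longleftrightarrow> (\<forall>j\<in>{1..CARD('p) - 1}. coef r (j + 1) = (\<Sum>l=1..CARD('p). coef \<theta> l * coef r (nat_dist j l + 1)))"
  proof safe
    fix j assume *: "\<forall>j\<in>{2..CARD('p)}. coef r j = (\<Sum>l=1..CARD('p). coef \<theta> l * coef r (nat_dist (j - 1) l + 1))"
      and "j \<in> {1..CARD('p) - 1}"
    then have "j + 1 \<in> {2..CARD('p)}" by auto
    from *[rule_format, OF this] show "coef r (j + 1) = (\<Sum>l=1..CARD('p). coef \<theta> l * coef r (nat_dist j l + 1))"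
      by simp
  next
    fix j assume *: "\<forall>j\<in>{1..CARD('p) - 1}. coef r (j + 1) = (\<Sum>l=1..CARD('p). coef \<theta> l * coef r (nat_dist j l + 1))"
      and j: "j \<in> {2..CARD('p)}"
    then have "j - 1 \<in> {1..CARD('p) - 1}" by auto
    from *[rule_format, OF this] j show "coef r j = (\<Sum>l=1..CARD('p). coef \<theta> l * coef r (nat_dist (j - 1) l + 1))"
      by simp
  qed
  finally show ?thesis unfolding yw_solves_iff upd .
qed

text \<open>Unique solvability of the inhomogeneous system is injectivity of the linear map: for v
  in the kernel, r - v solves the same system as r.\<close>

lemma cond3_yw_map:
  fixes \<theta> :: "real^'p::{finite,wellorder}"
  assumes "cond3 \<theta>"
  shows "yw_map \<theta> v = 0 \<Longrightarrow> v = 0"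
    and "\<exists>r. yw_map \<theta> r = first_unit \<and> (\<forall>v. v \<noteq> 0 \<longrightarrow> 0 < v \<bullet> (toeplitz r *v v))"
proof -
  obtain \<kappa> where \<kappa>: "yw_solves \<theta> \<kappa>"
    and uniq: "\<And>Y. yw_solves \<theta> Y \<Longrightarrow> \<forall>i\<in>{1..CARD('p) - 1}. Y i = \<kappa> i"
    and pd: "pd_matrix (toeplitz_L \<kappa> :: real^'p::{finite,wellorder}^'p::{finite,wellorder})"
    using assms unfolding cond3_def by blast
  define r where "r = (\<chi> i::'p. (\<kappa>(0 := 1)) (pos i - 1))"
  have cr: "coef r j = (if j \<in> {1..CARD('p)} then (\<kappa>(0 := 1)) (j - 1) else 0)" for j
    unfolding r_def by (rule coef_lambda)
  have r1: "coef r 1 = 1" by (simp add: cr Suc_le_eq)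
  \<comment> \<open>The vector r records only kappa_1, ..., kappa_(p-1); the system sees no other
    values.\<close>
  have cong: "yw_solves \<theta> Y" if "yw_solves \<theta> Z" "\<And>j. j \<in> {1..CARD('p) - 1} \<Longrightarrow> Y j = Z j" for Y Z
  proof -
    have "(\<Sum>l=1..CARD('p). coef \<theta> l * (Y(0 := 1)) (nat_dist j l)) = (\<Sum>l=1..CARD('p). coef \<theta> l * (Z(0 := 1)) (nat_dist j l))"
      if "j \<in> {1..CARD('p) - 1}" for j
    proof (intro sum.cong refl)
      fix l assume "l \<in> {1..CARD('p)}"
      then have "nat_dist j l = 0 \<or> nat_dist j l \<in> {1..CARD('p) - 1}" using that by (auto simp: nat_dist_def)
      then show "coef \<theta> l * (Y(0 := 1)) (nat_dist j l) = coef \<theta> l * (Z(0 := 1)) (nat_dist j l)"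
        using \<open>\<And>j. j \<in> {1..CARD('p) - 1} \<Longrightarrow> Y j = Z j\<close> by auto
    qed
    then show ?thesis using that unfolding yw_solves_iff by auto
  qed
  have rs: "yw_solves \<theta> (\<lambda>m. coef r (m + 1))"
    by (rule cong[OF \<kappa>]) (auto simp: cr)
  have "yw_map \<theta> r = first_unit" using yw_map_eq_first_unit[OF r1] rs by blast
  moreover have "toeplitz r = toeplitz_L \<kappa>"
  proof -
    have "nat_dist (pos i) (pos j) < CARD('p)" for i j :: 'p
      using pos_bounds[of i] pos_bounds[of j] by (auto simp: nat_dist_def)
    then show ?thesis by (auto simp: toeplitz_def toeplitz_L_def vec_eq_iff Let_def cr Suc_le_eq simp flip: nat_dist_def)
  qed
  ultimately show "\<exists>r. yw_map \<theta> r = first_unit \<and> (\<forall>v. v \<noteq> 0 \<longrightarrow> 0 < v \<bullet> (toeplitz r *v v))"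
    using pd unfolding pd_matrix_def by metis
  assume v: "yw_map \<theta> v = 0"
  have "coef (yw_map \<theta> v) 1 = 0" by (simp add: v coef_linear)
  then have v1: "coef v 1 = 0" by (simp add: coef_yw_map)
  have "yw_map \<theta> (r - v) = first_unit" by (simp add: yw_map_linear v \<open>yw_map \<theta> r = first_unit\<close>)
  then have rv: "yw_solves \<theta> (\<lambda>m. coef (r - v) (m + 1))"
    using yw_map_eq_first_unit[of "r - v" \<theta>] r1 v1 by (simp add: coef_linear)
  then have eq: "coef (r - v) (m + 1) = coef r (m + 1)" if "m \<in> {1..CARD('p) - 1}" for m
    using uniq[OF rv] uniq[OF rs] that by metis
  show "v = 0"
  proof (rule vec_eq_coef)
    fix j assume j: "j \<in> {1..CARD('p)}"
    show "coef v j = coef 0 j"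
    proof (cases "j = 1")
      case False
      then have "j - 1 \<in> {1..CARD('p) - 1}" using j by auto
      from eq[OF this] j show ?thesis by (simp add: coef_linear)
    qed (use v1 in \<open>simp add: coef_linear\<close>)
  qed
qed

text \<open>The transposed companion matrix A', acting on test vectors. In the last coordinate the
  shifted entry is \<open>coef v (p + 1) = 0\<close>.\<close>

definition companion_T :: "real^'p::{finite,wellorder} \<Rightarrow> real^'p::{finite,wellorder} \<Rightarrow> real^'p::{finite,wellorder}" where
  "companion_T \<theta> v = (\<chi> i. coef \<theta> (pos i) * coef v 1 + coef v (pos i + 1))"

lemma coef_companion_T:
  "coef (companion_T \<theta> v) j = (if j \<in> {1..CARD('p)} then coef \<theta> j * coef v 1 + coef v (j + 1) else 0)"
  for \<theta> :: "real^'p::{finite,wellorder}"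
  unfolding companion_T_def by (rule coef_lambda)

lemma toeplitz_form:
  "v \<bullet> (toeplitz r *v w) = (\<Sum>a=1..CARD('p). \<Sum>b=1..CARD('p). coef v a * coef w b * coef r (nat_dist a b + 1))"
  for v :: "real^'p::{finite,wellorder}"
  unfolding sum_pos
  by (simp add: inner_vec_def matrix_vector_mult_def toeplitz_def sum_distrib_left mult_ac)

text \<open>The identity A L A' = L - d e_1 e_1' tested against v. Both forms expand into the same
  shifted double sum R and the same mixed sum A, because the Yule-Walker equations turn inner sums
  over theta into autocorrelations; they differ only in the coefficient of the squared first
  coordinate.\<close>

lemma toeplitz_form_companion:
  fixes \<theta> r v :: "real^'p::{finite,wellorder}"
  assumes yw: "yw_map \<theta> r = first_unit"
  shows "companion_T \<theta> v \<bullet> (toeplitz r *v companion_T \<theta> v)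
    = v \<bullet> (toeplitz r *v v) - (1 - \<theta> \<bullet> (toeplitz r *v \<theta>)) * (coef v 1)\<^sup>2"
proof -
  define P where "P = CARD('p)"
  have P: "P \<ge> 1" by (simp add: P_def Suc_le_eq)
  define g where "g m = coef r (m + 1)" for m
  define V where "V = coef v"
  define t where "t = coef \<theta>"
  have VP: "V (Suc P) = 0" by (simp add: V_def P_def coef_outside)
  have g0: "g 0 = 1"
    using arg_cong[OF yw, of "\<lambda>x. coef x 1"] by (simp add: coef_yw_map coef_first_unit g_def)
  have ywj: "(\<Sum>b=1..P. t b * g (nat_dist a b)) = g a" if "a \<in> {1..<P}" for a
  proof -
    have "coef (yw_map \<theta> r) (a + 1) = 0" using that by (simp add: yw coef_first_unit)
    then show ?thesis using that by (simp add: coef_yw_map P_def g_def t_def)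
  qed
  \<comment> \<open>The equations cover a < P only; at a = P the weight V (Suc P) is 0.\<close>
  have mid: "(\<Sum>a=1..P. V (Suc a) * (\<Sum>b=1..P. t b * g (nat_dist a b))) = (\<Sum>a=1..P. V (Suc a) * g a)"
  proof (rule sum.cong[OF refl])
    fix a assume "a \<in> {1..P}"
    then show "V (Suc a) * (\<Sum>b=1..P. t b * g (nat_dist a b)) = V (Suc a) * g a"
      using ywj[of a] VP by (cases "a = P") auto
  qed
  define A where "A = (\<Sum>a=1..P. V (Suc a) * g a)"
  define R where "R = (\<Sum>a=1..P. \<Sum>b=1..P. V (Suc a) * V (Suc b) * g (nat_dist a b))"
  define D where "D = (\<Sum>a=1..P. \<Sum>b=1..P. t a * t b * g (nat_dist a b))"
  have cB: "coef (companion_T \<theta> v) a = t a * V 1 + V (Suc a)" if "a \<in> {1..P}" for a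
    using that by (simp add: coef_companion_T P_def t_def V_def)
  have "companion_T \<theta> v \<bullet> (toeplitz r *v companion_T \<theta> v)
    = (\<Sum>a=1..P. \<Sum>b=1..P. (t a * V 1 + V (Suc a)) * (t b * V 1 + V (Suc b)) * g (nat_dist a b))"
    unfolding toeplitz_form P_def[symmetric] g_def by (intro sum.cong refl) (simp add: cB)
  also have "\<dots> = (\<Sum>a=1..P. \<Sum>b=1..P. (V 1)\<^sup>2 * (t a * t b * g (nat_dist a b))
      + V 1 * (V (Suc a) * (t b * g (nat_dist a b))) + V 1 * (V (Suc b) * (t a * g (nat_dist b a)))
      + V (Suc a) * V (Suc b) * g (nat_dist a b))"
    by (intro sum.cong refl) (simp add: power2_eq_square algebra_simps nat_dist_commute)
  also have "\<dots> = (V 1)\<^sup>2 * D + V 1 * (\<Sum>a=1..P. V (Suc a) * (\<Sum>b=1..P. t b * g (nat_dist a b)))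
      + V 1 * (\<Sum>a=1..P. \<Sum>b=1..P. V (Suc b) * (t a * g (nat_dist b a))) + R"
    by (simp add: sum.distrib sum_distrib_left D_def R_def)
  also have "(\<Sum>a=1..P. \<Sum>b=1..P. V (Suc b) * (t a * g (nat_dist b a))) = (\<Sum>b=1..P. V (Suc b) * (\<Sum>a=1..P. t a * g (nat_dist b a)))"
    by (subst sum.swap) (simp add: sum_distrib_left)
  finally have B: "companion_T \<theta> v \<bullet> (toeplitz r *v companion_T \<theta> v) = (V 1)\<^sup>2 * D + 2 * V 1 * A + R"
    unfolding mid A_def by simp
  have "v \<bullet> (toeplitz r *v v) = (\<Sum>a=1..P. V a * (\<Sum>b=1..P. V b * g (nat_dist a b)))"
    unfolding toeplitz_form P_def V_def g_def by (simp add: sum_distrib_left mult.assoc)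
  also have "\<dots> = V 1 * (\<Sum>b=1..P. V b * g (nat_dist 1 b)) + (\<Sum>a=1..P. V (Suc a) * (\<Sum>b=1..P. V b * g (nat_dist (Suc a) b)))"
    by (rule sum_shift) (simp_all add: VP P[unfolded One_nat_def] del: sum.cl_ivl_Suc)
  also have "(\<Sum>b=1..P. V b * g (nat_dist 1 b)) = V 1 + A"
    unfolding A_def by (subst sum_shift) (simp_all add: VP P[unfolded One_nat_def] g0)
  also have "(\<Sum>a=1..P. V (Suc a) * (\<Sum>b=1..P. V b * g (nat_dist (Suc a) b)))
    = (\<Sum>a=1..P. V (Suc a) * (V 1 * g a + (\<Sum>b=1..P. V (Suc b) * g (nat_dist a b))))"
  proof (intro sum.cong refl)
    fix a
    show "V (Suc a) * (\<Sum>b=1..P. V b * g (nat_dist (Suc a) b)) = V (Suc a) * (V 1 * g a + (\<Sum>b=1..P. V (Suc b) * g (nat_dist a b)))"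
      by (subst sum_shift) (simp_all add: VP P[unfolded One_nat_def])
  qed
  also have "\<dots> = V 1 * A + R"
    by (simp add: A_def R_def distrib_left sum.distrib sum_distrib_left mult_ac)
  finally have Q: "v \<bullet> (toeplitz r *v v) = (V 1)\<^sup>2 + 2 * V 1 * A + R"
    by (simp add: power2_eq_square algebra_simps)
  have "\<theta> \<bullet> (toeplitz r *v \<theta>) = D"
    unfolding toeplitz_form P_def[symmetric] by (simp add: D_def t_def g_def)
  with B Q show ?thesis by (simp add: V_def algebra_simps)
qed

text \<open>A root \<open>z\<close> of the characteristic polynomial with \<open>|z| \<le> 1\<close> yields an eigenvector of
  \<open>companion_T\<close>; comparing the quadratic form before and after applying \<open>companion_T\<close>
  shows that the innovation variance \<open>1 - \<theta>'L\<theta>\<close> is nonnegative.\<close>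

lemma innovation_nonneg:
  fixes \<theta> r :: "real^'p::{finite,wellorder}"
  assumes yw: "yw_map \<theta> r = first_unit" and pd: "\<And>v. v \<noteq> 0 \<Longrightarrow> 0 < v \<bullet> (toeplitz r *v v)"
    and c1: "cond1 \<theta>"
  shows "\<theta> \<bullet> (toeplitz r *v \<theta>) \<le> 1"
proof -
  define P where "P = CARD('p)"
  have P: "P \<ge> 1" by (simp add: P_def Suc_le_eq)
  have cp: "poly (char_poly \<theta>) z = z ^ P - (\<Sum>l=1..P. of_real (coef \<theta> l) * z ^ (P - l))" for z
    by (simp add: char_poly_def poly_monom poly_sum P_def)
  \<comment> \<open>A leading coefficient 1 in degree P >= 1 makes the polynomial nonconstant, so it
    has a root.\<close>
  have "coeff (char_poly \<theta>) P = 1"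
    using P by (simp add: char_poly_def P_def[symmetric] coeff_sum del: One_nat_def)
      (intro sum.neutral ballI, auto)
  then have "\<not> (\<exists>a l. a \<noteq> 0 \<and> l = 0 \<and> char_poly \<theta> = pCons a l)"
    using P by (auto simp: coeff_pCons split: nat.splits)
  then obtain z where z: "poly (char_poly \<theta>) z = 0"
    using fundamental_theorem_of_algebra_alt by blast
  then have z1: "cmod z \<le> 1" using c1 by (auto simp: cond1_def)
  \<comment> \<open>Horner's scheme for the characteristic polynomial at z. The values w 0, ..., w
    (P - 1) are the coordinates of a complex eigenvector, with real part a and imaginary part b; w P
    = 0 closes the last coordinate.\<close>
  define w where "w j = z ^ j - (\<Sum>l=1..j. of_real (coef \<theta> l) * z ^ (j - l))" for j
  have w_Suc: "w (Suc j) = z * w j - of_real (coef \<theta> (Suc j))" for j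
  proof -
    have "(\<Sum>l=1..Suc j. of_real (coef \<theta> l) * z ^ (Suc j - l))
      = (\<Sum>l=1..j. of_real (coef \<theta> l) * z ^ (Suc j - l)) + of_real (coef \<theta> (Suc j))" by simp
    also have "(\<Sum>l=1..j. of_real (coef \<theta> l) * z ^ (Suc j - l)) = z * (\<Sum>l=1..j. of_real (coef \<theta> l) * z ^ (j - l))"
      unfolding sum_distrib_left by (intro sum.cong) (auto simp: Suc_diff_le)
    finally show ?thesis by (simp add: w_def algebra_simps)
  qed
  have wP: "w P = 0" using z cp by (simp add: w_def)
  define a b where "a = (\<chi> i::'p. Re (w (pos i - 1)))" and "b = (\<chi> i::'p. Im (w (pos i - 1)))"
  have ca: "coef a j = (if j \<in> {1..P} then Re (w (j - 1)) else 0)"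
    and cb: "coef b j = (if j \<in> {1..P} then Im (w (j - 1)) else 0)" for j
    unfolding a_def b_def P_def
    by (rule coef_lambda[of "\<lambda>j. Re (w (j - 1))"], rule coef_lambda[of "\<lambda>j. Im (w (j - 1))"])
  have a1: "coef a 1 = 1" and b1: "coef b 1 = 0" using P by (auto simp: ca cb w_def)
  have wj: "coef \<theta> j * 1 + Re (w j) = Re (z * w (j - 1))" "Im (w j) = Im (z * w (j - 1))" if "j \<in> {1..P}" for j
    using w_Suc[of "j - 1"] that by auto
  have nxt: "coef a (j + 1) = Re (w j)" "coef b (j + 1) = Im (w j)" if "j \<in> {1..P}" for j
    using that wP by (cases "j = P"; simp add: ca cb)+
  have Ba: "companion_T \<theta> a = Re z *\<^sub>R a - Im z *\<^sub>R b"
  proof (rule vec_eq_coef)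
    fix j assume "j \<in> {1..CARD('p)}"
    then have j: "j \<in> {1..P}" by (simp add: P_def)
    have "coef (companion_T \<theta> a) j = Re (z * w (j - 1))"
      using j wj(1)[OF j] nxt(1)[OF j] by (simp add: coef_companion_T P_def[symmetric] a1[simplified])
    then show "coef (companion_T \<theta> a) j = coef (Re z *\<^sub>R a - Im z *\<^sub>R b) j"
      using j by (simp add: coef_linear ca cb)
  qed
  have Bb: "companion_T \<theta> b = Im z *\<^sub>R a + Re z *\<^sub>R b"
  proof (rule vec_eq_coef)
    fix j assume "j \<in> {1..CARD('p)}"
    then have j: "j \<in> {1..P}" by (simp add: P_def)
    have "coef (companion_T \<theta> b) j = Im (z * w (j - 1))"
      using j wj(2)[OF j] nxt(2)[OF j] by (simp add: coef_companion_T P_def[symmetric] b1[simplified])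
    then show "coef (companion_T \<theta> b) j = coef (Im z *\<^sub>R a + Re z *\<^sub>R b) j"
      using j by (simp add: coef_linear ca cb)
  qed
  define Q where "Q v = v \<bullet> (toeplitz r *v v)" for v
  have sym: "b \<bullet> (toeplitz r *v a) = a \<bullet> (toeplitz r *v b)"
    by (metis dot_lmul_matrix inner_commute toeplitz_symmetric transpose_matrix_vector)
  \<comment> \<open>The mixed terms of a and b cancel in the sum, leaving the factor |z|^2.\<close>
  have e1: "Q (companion_T \<theta> a) + Q (companion_T \<theta> b) = ((Re z)\<^sup>2 + (Im z)\<^sup>2) * (Q a + Q b)"
    unfolding Q_def Ba Bb
    by (simp add: matrix_vector_mult_diff_distrib matrix_vector_right_distrib matrix_vector_mult_scaleR
        inner_diff_left inner_diff_right inner_add_left inner_add_right sym power2_eq_square algebra_simps)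
  have e2: "Q (companion_T \<theta> a) + Q (companion_T \<theta> b) = Q a + Q b - (1 - \<theta> \<bullet> (toeplitz r *v \<theta>))"
    unfolding Q_def toeplitz_form_companion[OF yw] a1 b1 by simp
  have e3: "((Re z)\<^sup>2 + (Im z)\<^sup>2) * (Q a + Q b) \<le> 1 * (Q a + Q b)"
  proof (rule mult_right_mono)
    show "(Re z)\<^sup>2 + (Im z)\<^sup>2 \<le> 1" using z1 by (simp add: cmod_def)
    have "Q v \<ge> 0" for v using pd[of v] by (cases "v = 0") (auto simp: Q_def)
    then show "0 \<le> Q a + Q b" by simp
  qed
  have "Q a + Q b - (1 - \<theta> \<bullet> (toeplitz r *v \<theta>)) \<le> Q a + Q b"
    using e3 unfolding e1[symmetric] e2 by simp
  then show ?thesis by simp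
qed

text \<open>The Toeplitz form is a Lyapunov function: each application subtracts d times a square,
  with d >= 0.\<close>

lemma companion_T_contraction:
  fixes \<theta> r :: "real^'p::{finite,wellorder}"
  assumes "yw_map \<theta> r = first_unit" "\<And>v. v \<noteq> 0 \<Longrightarrow> 0 < v \<bullet> (toeplitz r *v v)" "cond1 \<theta>"
  shows "(companion_T \<theta> ^^ m) v \<bullet> (toeplitz r *v (companion_T \<theta> ^^ m) v) \<le> v \<bullet> (toeplitz r *v v)"
proof (induction m)
  case (Suc m)
  have "0 \<le> (1 - \<theta> \<bullet> (toeplitz r *v \<theta>)) * (coef ((companion_T \<theta> ^^ m) v) 1)\<^sup>2"
    using innovation_nonneg[OF assms] by simp
  then show ?case using Suc toeplitz_form_companion[OF assms(1), of "(companion_T \<theta> ^^ m) v"] by simp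
qed simp

text \<open>The later estimates see K only through these constants: T bounds the parameters, 1 / b
  the inverse of the Yule-Walker map, l the Toeplitz matrix from below, and c all powers of the
  companion matrix.\<close>

definition stable_bounds :: "(real^'p::{finite,wellorder}) set \<Rightarrow> real \<Rightarrow> real \<Rightarrow> real \<Rightarrow> real \<Rightarrow> bool" where
  "stable_bounds K T b l c \<longleftrightarrow> T > 0 \<and> b > 0 \<and> l > 0 \<and> c > 0 \<and> (\<forall>\<theta>\<in>K. norm \<theta> \<le> T
    \<and> (\<forall>v. b * norm v \<le> norm (yw_map \<theta> v))
    \<and> (\<forall>m v. norm ((companion_T \<theta> ^^ m) v) \<le> c * norm v)
    \<and> (\<exists>r. yw_map \<theta> r = first_unit \<and> (\<forall>v. l * (v \<bullet> v) \<le> v \<bullet> (toeplitz r *v v))))"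

text \<open>The constants come from extrema of continuous functions on compact sets. Working on the
  compact set C of pairs of a parameter and its solution avoids showing that the solution depends
  continuously on the parameter.\<close>

lemma compact_stable_bounds:
  fixes K :: "(real^'p::{finite,wellorder}) set"
  assumes K: "compact K" "K \<subseteq> Lambda_tilde"
  shows "\<exists>T b l c. stable_bounds K T b l c"
proof (cases "K = {}")
  case True
  then show ?thesis by (auto simp: stable_bounds_def intro!: exI[of _ 1])
next
  case False
  define S where "S = sphere (0::real^'p::{finite,wellorder}) 1"
  have S: "compact S" "S \<noteq> {}" by (auto simp: S_def)
  have scale: "\<exists>w\<in>S. v = norm v *\<^sub>R w" if "v \<noteq> 0" for v :: "real^'p::{finite,wellorder}"
    using that by (intro bexI[of _ "(1 / norm v) *\<^sub>R v"]) (auto simp: S_def)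
  have cond: "cond1 \<theta>" "cond3 \<theta>" if "\<theta> \<in> K" for \<theta> using K that by (auto simp: Lambda_tilde_def)
  obtain T where T: "T > 0" "\<And>\<theta>. \<theta> \<in> K \<Longrightarrow> norm \<theta> \<le> T"
    using compact_imp_bounded[OF K(1)] unfolding bounded_pos by blast
  have cont_yw: "continuous_on A (\<lambda>x. yw_map (f x) (g x))" if "continuous_on A f" "continuous_on A g"
    for A :: "'z::topological_space set" and f g :: "'z \<Rightarrow> real^'p::{finite,wellorder}"
    unfolding yw_map_def using that
  proof (intro continuous_on_vec_lambda)
    fix i :: 'p
    show "continuous_on A (\<lambda>x. if pos i = 1 then coef (g x) 1
        else coef (g x) (pos i) - (\<Sum>l=1..CARD('p). coef (f x) l * coef (g x) (nat_dist (pos i - 1) l + 1)))"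
      using that by (cases "pos i = 1") (auto intro!: continuous_intros)
  qed
  have "continuous_on (K \<times> S) (\<lambda>x. norm (yw_map (fst x) (snd x)))"
    by (intro continuous_on_norm cont_yw continuous_intros)
  moreover have "K \<times> S \<noteq> {}" using False S(2) by simp
  ultimately obtain x where x: "x \<in> K \<times> S" "\<And>y. y \<in> K \<times> S \<Longrightarrow> norm (yw_map (fst x) (snd x)) \<le> norm (yw_map (fst y) (snd y))"
    using continuous_attains_inf[OF compact_Times[OF K(1) S(1)]] by blast
  define b where "b = norm (yw_map (fst x) (snd x))"
  have b0: "b > 0"
    using x(1) cond3_yw_map(1)[OF cond(2), of "fst x" "snd x"] by (auto simp: b_def S_def)
  have b: "b * norm v \<le> norm (yw_map \<theta> v)" if "\<theta> \<in> K" for \<theta> v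
  proof (cases "v = 0")
    case False
    then obtain w where w: "w \<in> S" "v = norm v *\<^sub>R w" using scale by blast
    have "b \<le> norm (yw_map \<theta> w)" using x(2)[of "(\<theta>, w)"] that w(1) by (simp add: b_def)
    then have "norm v * b \<le> norm v * norm (yw_map \<theta> w)" by (intro mult_left_mono) auto
    also have "\<dots> = norm (yw_map \<theta> v)" by (subst (2) w(2)) (simp add: yw_map_linear)
    finally show ?thesis by (simp add: mult.commute)
  qed simp
  \<comment> \<open>The lower bound b confines every solution to the ball of radius 1 / b, so C is
    compact and yet contains all solutions.\<close>
  define C where "C = {x \<in> K \<times> cball 0 (1 / b). yw_map (fst x) (snd x) = first_unit}"
  have "closed {x \<in> K \<times> cball 0 (1 / b). yw_map (fst x) (snd x) = first_unit}"
    by (intro continuous_closed_preimage_constant cont_yw continuous_intros closed_Times)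
      (auto intro: compact_imp_closed K)
  then have C: "compact C"
    using compact_Int_closed[OF compact_Times[OF K(1) compact_cball[of "0::real^'p::{finite,wellorder}" "1/b"]], of C]
    by (simp add: C_def Int_absorb1 subset_iff)
  have inC: "(\<theta>, r) \<in> C" if "\<theta> \<in> K" "yw_map \<theta> r = first_unit" for \<theta> r
  proof -
    have "b * norm r \<le> 1" using b[OF that(1), of r] that(2) by (simp add: norm_first_unit)
    then show ?thesis using that b0 by (simp add: C_def field_simps)
  qed
  \<comment> \<open>Injectivity identifies r with the positive definite solution supplied by
    Condition 3.\<close>
  have pdC: "0 < v \<bullet> (toeplitz r *v v)" if "(\<theta>, r) \<in> C" "v \<noteq> 0" for \<theta> r v
  proof -
    have th: "\<theta> \<in> K" "yw_map \<theta> r = first_unit" using that by (auto simp: C_def)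
    obtain r' where r': "yw_map \<theta> r' = first_unit" "\<And>v. v \<noteq> 0 \<Longrightarrow> 0 < v \<bullet> (toeplitz r' *v v)"
      using cond3_yw_map(2)[OF cond(2)[OF th(1)]] by blast
    have "yw_map \<theta> (r - r') = 0" by (simp add: yw_map_linear th r')
    then have "r = r'" using cond3_yw_map(1)[OF cond(2)[OF th(1)]] by (metis right_minus_eq)
    then show ?thesis using r'(2) that(2) by blast
  qed
  obtain \<theta>0 where \<theta>0: "\<theta>0 \<in> K" using False by blast
  have "C \<noteq> {}" using inC[OF \<theta>0] cond3_yw_map(2)[OF cond(2)[OF \<theta>0]] by blast
  then have CS: "compact (C \<times> S)" "C \<times> S \<noteq> {}" using C S by (auto intro: compact_Times)
  have cont_q: "continuous_on (C \<times> S) (\<lambda>x. snd x \<bullet> (toeplitz (snd (fst x)) *v snd x))"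
    unfolding toeplitz_form by (intro continuous_intros)
  obtain y where y: "y \<in> C \<times> S" "\<And>x. x \<in> C \<times> S \<Longrightarrow> snd y \<bullet> (toeplitz (snd (fst y)) *v snd y) \<le> snd x \<bullet> (toeplitz (snd (fst x)) *v snd x)"
    using continuous_attains_inf[OF CS cont_q] by blast
  obtain y' where y': "y' \<in> C \<times> S" "\<And>x. x \<in> C \<times> S \<Longrightarrow> snd x \<bullet> (toeplitz (snd (fst x)) *v snd x) \<le> snd y' \<bullet> (toeplitz (snd (fst y')) *v snd y')"
    using continuous_attains_sup[OF CS cont_q] by blast
  define l u where "l = snd y \<bullet> (toeplitz (snd (fst y)) *v snd y)" and "u = snd y' \<bullet> (toeplitz (snd (fst y')) *v snd y')"
  have l0: "l > 0" unfolding l_def using y(1) by (intro pdC[of "fst (fst y)"]) (auto simp: S_def)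
  have lu: "l * (v \<bullet> v) \<le> v \<bullet> (toeplitz r *v v)" "v \<bullet> (toeplitz r *v v) \<le> u * (v \<bullet> v)" if "(\<theta>, r) \<in> C" for \<theta> r v
  proof -
    have "l * (v \<bullet> v) \<le> v \<bullet> (toeplitz r *v v) \<and> v \<bullet> (toeplitz r *v v) \<le> u * (v \<bullet> v)"
    proof (cases "v = 0")
      case False
      then obtain w where w: "w \<in> S" "v = norm v *\<^sub>R w" using scale by blast
      have q: "v \<bullet> (toeplitz r *v v) = (norm v)\<^sup>2 * (w \<bullet> (toeplitz r *v w))"
        by (subst (1 2) w(2)) (simp add: matrix_vector_mult_scaleR power2_eq_square)
      have "l \<le> w \<bullet> (toeplitz r *v w)" "w \<bullet> (toeplitz r *v w) \<le> u"
        using y(2)[of "((\<theta>, r), w)"] y'(2)[of "((\<theta>, r), w)"] that w(1) by (auto simp: l_def u_def)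
      then show ?thesis unfolding q power2_norm_eq_inner[symmetric]
        by (auto simp: mult.commute[of _ "(norm v)\<^sup>2"] intro: mult_left_mono)
    qed simp
    then show "l * (v \<bullet> v) \<le> v \<bullet> (toeplitz r *v v)" "v \<bullet> (toeplitz r *v v) \<le> u * (v \<bullet> v)" by auto
  qed
  have "0 < u"
  proof -
    have "snd y' \<noteq> 0" using y'(1) by (auto simp: S_def)
    then show ?thesis unfolding u_def using y'(1) by (intro pdC[of "fst (fst y')"]) auto
  qed
  \<comment> \<open>The Toeplitz form does not grow along powers; l and u compare it with the
    Euclidean norm.\<close>
  define c where "c = sqrt (u / l)"
  have c0: "c > 0" using \<open>0 < u\<close> l0 by (simp add: c_def)
  have c: "norm ((companion_T \<theta> ^^ m) v) \<le> c * norm v" if \<theta>: "\<theta> \<in> K" for \<theta> m v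
  proof -
    obtain r where r: "yw_map \<theta> r = first_unit" "\<And>v. v \<noteq> 0 \<Longrightarrow> 0 < v \<bullet> (toeplitz r *v v)"
      using cond3_yw_map(2)[OF cond(2)[OF \<theta>]] by blast
    let ?w = "(companion_T \<theta> ^^ m) v"
    have "l * (?w \<bullet> ?w) \<le> ?w \<bullet> (toeplitz r *v ?w)" by (rule lu(1)[OF inC[OF \<theta> r(1)]])
    also have "\<dots> \<le> v \<bullet> (toeplitz r *v v)" by (rule companion_T_contraction[OF r cond(1)[OF \<theta>]])
    also have "\<dots> \<le> u * (v \<bullet> v)" by (rule lu(2)[OF inC[OF \<theta> r(1)]])
    finally have "(norm ?w)\<^sup>2 \<le> (u / l) * (norm v)\<^sup>2"
      using l0 by (simp add: power2_norm_eq_inner field_simps)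
    also have "\<dots> = (c * norm v)\<^sup>2" using \<open>0 < u\<close> l0 by (simp add: c_def power_mult_distrib)
    finally show ?thesis by (rule power2_le_imp_le) (use c0 in simp)
  qed
  have "stable_bounds K T b l c"
    unfolding stable_bounds_def
  proof (intro conjI ballI allI T b b0 l0 c0 c)
    fix \<theta> assume \<theta>: "\<theta> \<in> K"
    obtain r where "yw_map \<theta> r = first_unit" using cond3_yw_map(2)[OF cond(2)[OF \<theta>]] by blast
    with lu(1)[OF inC[OF \<theta> this]]
    show "\<exists>r. yw_map \<theta> r = first_unit \<and> (\<forall>v. l * (v \<bullet> v) \<le> v \<bullet> (toeplitz r *v v))" by blast
  qed
  then show ?thesis by blast
qed

section \<open>Pathwise estimates\<close>

text \<open>Truncated subtraction is what is wanted: for k beyond n it returns \<open>ar_x\<close>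
  at 0, which vanishes like the prescribed initial values.\<close>

lemma nth_ar_hist: "nth_default 0 (ar_hist \<theta> e n) k = ar_x \<theta> e (n - k)"
proof (induction n arbitrary: k)
  case 0
  show ?case by (simp add: ar_x_def)
next
  case (Suc n)
  show ?case
  proof (cases k)
    case (Suc k')
    then show ?thesis using Suc.IH[of k'] by simp
  qed (simp add: ar_x_def)
qed

lemma ar_x_0 [simp]: "ar_x \<theta> e 0 = 0"
  by (simp add: ar_x_def)

lemma coef_ar_X: "coef (ar_X \<theta> e n) j = (if j \<in> {1..CARD('p)} then ar_x \<theta> e (n - (j - 1)) else 0)"
  for \<theta> :: "real^'p::{finite,wellorder}"
  unfolding ar_X_def nth_ar_hist by (rule coef_lambda)

lemma ar_X_nth: "ar_X \<theta> e n $ i = ar_x \<theta> e (n - (pos i - 1))"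
  by (simp add: ar_X_def nth_ar_hist)

lemma ar_X_0 [simp]: "ar_X \<theta> e 0 = 0"
  by (simp add: vec_eq_iff ar_X_nth)

lemma ar_x_Suc: "ar_x \<theta> e (Suc n) = e (Suc n) + \<theta> \<bullet> ar_X \<theta> e n"
  for \<theta> :: "real^'p::{finite,wellorder}"
proof -
  have "(\<Sum>j=1..CARD('p). coef \<theta> j * nth_default 0 (ar_hist \<theta> e n) (j - 1)) = \<theta> \<bullet> ar_X \<theta> e n"
    unfolding inner_coef by (intro sum.cong) (auto simp: coef_ar_X nth_ar_hist)
  then show ?thesis by (simp add: ar_x_def)
qed

lemma abs_ar_x_le: "\<bar>ar_x \<theta> e n\<bar> \<le> norm (ar_X \<theta> e n)"
  for \<theta> :: "real^'p::{finite,wellorder}"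
  using coef_abs_le[of "ar_X \<theta> e n" 1] by (simp add: coef_ar_X Suc_le_eq)

lemma ar_M_nth: "ar_M \<theta> e n $ i $ j = (\<Sum>k<n. ar_X \<theta> e k $ i * ar_X \<theta> e k $ j)"
  unfolding ar_M_def
  by simp (rule sum.reindex_bij_witness[of _ Suc "\<lambda>k. k - 1"], auto)

lemma trace_ar_M: "trace (ar_M \<theta> e n) = (\<Sum>k<n. (norm (ar_X \<theta> e k))\<^sup>2)"
  unfolding trace_def ar_M_nth
  by (subst sum.swap) (simp add: power2_norm_eq_inner inner_vec_def)

lemma ar_M_mult: "ar_M \<theta> e n *v v = (\<Sum>k<n. (v \<bullet> ar_X \<theta> e k) *\<^sub>R ar_X \<theta> e k)"
proof -
  have "(ar_M \<theta> e n *v v) $ i = (\<Sum>k<n. (v \<bullet> ar_X \<theta> e k) *\<^sub>R ar_X \<theta> e k) $ i" for i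
  proof -
    have "(ar_M \<theta> e n *v v) $ i = (\<Sum>j\<in>UNIV. \<Sum>k<n. ar_X \<theta> e k $ i * ar_X \<theta> e k $ j * v $ j)"
      by (simp add: matrix_vector_mult_def ar_M_nth sum_distrib_right)
    also have "\<dots> = (\<Sum>k<n. \<Sum>j\<in>UNIV. ar_X \<theta> e k $ i * ar_X \<theta> e k $ j * v $ j)"
      by (rule sum.swap)
    also have "\<dots> = (\<Sum>k<n. (v \<bullet> ar_X \<theta> e k) *\<^sub>R ar_X \<theta> e k) $ i"
      by (simp add: inner_vec_def sum_distrib_right sum_distrib_left mult_ac)
    finally show ?thesis .
  qed
  then show ?thesis by (simp add: vec_eq_iff)
qed

lemma ar_M_form: "v \<bullet> (ar_M \<theta> e n *v v) = (\<Sum>k<n. (v \<bullet> ar_X \<theta> e k)\<^sup>2)"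
  by (simp add: ar_M_mult inner_sum_right power2_eq_square)

lemma ar_M_psd: "ar_M \<theta> e n \<in> psd_cone"
  unfolding psd_cone_def psd_matrix_def
  by (auto simp: ar_M_form sum_nonneg transpose_def vec_eq_iff ar_M_nth mult.commute)

text \<open>The normal equations with x_(k+1) = theta . X_k + eps_(k+1) inserted; the part with
  theta cancels and the score remains.\<close>

lemma ar_lse_equation:
  assumes "det (ar_M \<theta> e n) > 0"
  shows "ar_M \<theta> e n *v (ar_lse \<theta> e n - \<theta>) = (\<Sum>k<n. e (Suc k) *\<^sub>R ar_X \<theta> e k)"
proof -
  let ?M = "ar_M \<theta> e n"
  define s where "s = (\<Sum>k=1..n. ar_x \<theta> e k *\<^sub>R ar_X \<theta> e (k - 1))"
  have "invertible ?M" using assms by (simp add: invertible_det_nz)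
  then have inv: "?M ** matrix_inv ?M = mat 1"
    unfolding invertible_def matrix_inv_def by (rule someI2_ex) simp
  have "?M *v ar_lse \<theta> e n = s"
    using assms by (simp add: ar_lse_def pinv_def s_def matrix_vector_mul_assoc inv)
  moreover have "s = (\<Sum>k<n. ar_x \<theta> e (Suc k) *\<^sub>R ar_X \<theta> e k)"
    unfolding s_def by (rule sum.reindex_bij_witness[of _ Suc "\<lambda>k. k - 1"]) auto
  ultimately show ?thesis
    by (simp add: matrix_vector_mult_diff_distrib ar_M_mult ar_x_Suc scaleR_add_left sum.distrib)
qed

text \<open>The recursion X_(n+1) = A X_n + eps_(n+1) e_1 in dual form, so that it can be iterated
  with \<open>companion_T\<close> alone.\<close>

lemma inner_ar_X_Suc: "v \<bullet> ar_X \<theta> e (Suc n) = companion_T \<theta> v \<bullet> ar_X \<theta> e n + coef v 1 * e (Suc n)"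
  for \<theta> v :: "real^'p::{finite,wellorder}"
proof -
  define P where "P = CARD('p)"
  have P: "Suc 0 \<le> P" by (simp add: P_def Suc_le_eq)
  define f where "f j = coef v j * ar_x \<theta> e (Suc n - (j - 1))" for j
  have "v \<bullet> ar_X \<theta> e (Suc n) = (\<Sum>j=1..P. f j)"
    unfolding inner_coef P_def f_def by (intro sum.cong) (auto simp: coef_ar_X)
  also have "\<dots> = f 1 + (\<Sum>j=1..P. f (Suc j))"
    by (rule sum_shift) (use P in \<open>auto simp: f_def P_def coef_outside\<close>)
  also have "f 1 = coef v 1 * e (Suc n) + (\<Sum>j=1..P. coef v 1 * coef \<theta> j * coef (ar_X \<theta> e n) j)"
    by (simp add: f_def ar_x_Suc inner_coef P_def distrib_left sum_distrib_left mult.assoc)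
  also have "(\<Sum>j=1..P. f (Suc j)) = (\<Sum>j=1..P. coef v (j + 1) * coef (ar_X \<theta> e n) j)"
  proof (intro sum.cong refl)
    fix j assume "j \<in> {1..P}"
    then have "Suc n - (Suc j - 1) = n - (j - 1)" by auto
    then show "f (Suc j) = coef v (j + 1) * coef (ar_X \<theta> e n) j"
      using \<open>j \<in> {1..P}\<close> by (simp add: f_def coef_ar_X P_def)
  qed
  finally have "v \<bullet> ar_X \<theta> e (Suc n) = coef v 1 * e (Suc n)
      + (\<Sum>j=1..P. (coef \<theta> j * coef v 1 + coef v (j + 1)) * coef (ar_X \<theta> e n) j)"
    by (simp add: sum.distrib[symmetric] algebra_simps)
  also have "(\<Sum>j=1..P. (coef \<theta> j * coef v 1 + coef v (j + 1)) * coef (ar_X \<theta> e n) j) = companion_T \<theta> v \<bullet> ar_X \<theta> e n"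
    unfolding inner_coef P_def by (intro sum.cong) (auto simp: coef_companion_T)
  finally show ?thesis by simp
qed

lemma inner_ar_X_iterate:
  "m \<le> n \<Longrightarrow> v \<bullet> ar_X \<theta> e n = (companion_T \<theta> ^^ m) v \<bullet> ar_X \<theta> e (n - m)
    + (\<Sum>j<m. coef ((companion_T \<theta> ^^ j) v) 1 * e (n - j))"
proof (induction m)
  case (Suc m)
  then have "n - m = Suc (n - Suc m)" by simp
  then show ?case using Suc inner_ar_X_Suc[of "(companion_T \<theta> ^^ m) v" \<theta> e "n - Suc m"] by simp
qed simp

text \<open>Testing with v = X_n makes the left side |X_n|^2, and one factor |X_n| cancels. Bounds
  on powers of the transposed matrix therefore suffice.\<close>

lemma ar_X_growth:
  assumes c: "\<And>m v. norm ((companion_T \<theta> ^^ m) v) \<le> c * norm v" and "m \<le> n"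
  shows "norm (ar_X \<theta> e n) \<le> c * (norm (ar_X \<theta> e (n - m)) + (\<Sum>j<m. \<bar>e (n - j)\<bar>))"
proof (cases "ar_X \<theta> e n = 0")
  case True
  have "c \<ge> 0" using c[of 0 "axis undefined 1"] by (simp add: norm_axis_1)
  then show ?thesis using True by (simp add: sum_nonneg)
next
  case False
  define v where "v = ar_X \<theta> e n"
  have "norm v * norm v = v \<bullet> ar_X \<theta> e n" by (simp add: v_def flip: power2_norm_eq_inner power2_eq_square)
  also have "\<dots> = (companion_T \<theta> ^^ m) v \<bullet> ar_X \<theta> e (n - m) + (\<Sum>j<m. coef ((companion_T \<theta> ^^ j) v) 1 * e (n - j))"
    by (rule inner_ar_X_iterate[OF assms(2)])
  also have "\<dots> \<le> c * norm v * norm (ar_X \<theta> e (n - m)) + (\<Sum>j<m. c * norm v * \<bar>e (n - j)\<bar>)"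
  proof (rule add_mono)
    have "(companion_T \<theta> ^^ m) v \<bullet> ar_X \<theta> e (n - m) \<le> norm ((companion_T \<theta> ^^ m) v) * norm (ar_X \<theta> e (n - m))"
      by (rule norm_cauchy_schwarz)
    also have "\<dots> \<le> c * norm v * norm (ar_X \<theta> e (n - m))" by (intro mult_right_mono c) simp
    finally show "(companion_T \<theta> ^^ m) v \<bullet> ar_X \<theta> e (n - m) \<le> c * norm v * norm (ar_X \<theta> e (n - m))" .
    show "(\<Sum>j<m. coef ((companion_T \<theta> ^^ j) v) 1 * e (n - j)) \<le> (\<Sum>j<m. c * norm v * \<bar>e (n - j)\<bar>)"
    proof (rule sum_mono)
      fix j
      have "coef ((companion_T \<theta> ^^ j) v) 1 * e (n - j) \<le> \<bar>coef ((companion_T \<theta> ^^ j) v) 1\<bar> * \<bar>e (n - j)\<bar>"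
        by (simp flip: abs_mult)
      also have "\<dots> \<le> c * norm v * \<bar>e (n - j)\<bar>"
        using order_trans[OF coef_abs_le c] by (intro mult_right_mono) auto
      finally show "coef ((companion_T \<theta> ^^ j) v) 1 * e (n - j) \<le> c * norm v * \<bar>e (n - j)\<bar>" .
    qed
  qed
  also have "\<dots> = norm v * (c * (norm (ar_X \<theta> e (n - m)) + (\<Sum>j<m. \<bar>e (n - j)\<bar>)))"
    by (simp add: sum_distrib_left distrib_left mult_ac)
  finally show ?thesis using False by (simp add: v_def)
qed

text \<open>Averaging the growth bound over a window of length \<open>w\<close> controls a single \<open>|X\<^sub>n|\<^sup>2\<close> by a small
  fraction of the accumulated energy plus the largest noise.\<close>

lemma ar_X_window:
  assumes c: "\<And>m v. norm ((companion_T \<theta> ^^ m) v) \<le> c * norm v"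
    and w: "w \<ge> 1" and e: "\<And>k. k \<in> {1..n} \<Longrightarrow> (e k)\<^sup>2 \<le> \<eta>" and \<eta>: "\<eta> \<ge> 0"
    and H: "(\<Sum>k<n. (norm (ar_X \<theta> e k))\<^sup>2) \<le> H"
  shows "(norm (ar_X \<theta> e n))\<^sup>2 \<le> 2 * c\<^sup>2 * H / w + 2 * c\<^sup>2 * (real w)\<^sup>2 * \<eta>"
proof -
  have c0: "c \<ge> 0" using c[of 0 "axis undefined 1"] by (simp add: norm_axis_1)
  have step: "(norm (ar_X \<theta> e n))\<^sup>2 \<le> 2 * c\<^sup>2 * ((norm (ar_X \<theta> e (n - m)))\<^sup>2 + (real w)\<^sup>2 * \<eta>)" if "m \<le> n" "m \<le> w" for m
  proof -
    have "(\<Sum>j<m. \<bar>e (n - j)\<bar>) \<le> (\<Sum>j<m. sqrt \<eta>)"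
    proof (rule sum_mono)
      fix j assume "j \<in> {..<m}"
      then have "n - j \<in> {1..n}" using that by auto
      from e[OF this] show "\<bar>e (n - j)\<bar> \<le> sqrt \<eta>" by (simp add: real_le_rsqrt)
    qed
    also have "\<dots> \<le> w * sqrt \<eta>" using that \<eta> by (simp add: mult_right_mono)
    finally have s: "(\<Sum>j<m. \<bar>e (n - j)\<bar>) \<le> w * sqrt \<eta>" .
    have "norm (ar_X \<theta> e n) \<le> c * (norm (ar_X \<theta> e (n - m)) + w * sqrt \<eta>)"
      by (rule order_trans[OF ar_X_growth[OF c that(1)]]) (use s c0 in \<open>auto intro: mult_left_mono\<close>)
    then have "(norm (ar_X \<theta> e n))\<^sup>2 \<le> (c * (norm (ar_X \<theta> e (n - m)) + w * sqrt \<eta>))\<^sup>2"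
      by (intro power_mono) auto
    also have "\<dots> = c\<^sup>2 * (norm (ar_X \<theta> e (n - m)) + w * sqrt \<eta>)\<^sup>2" by (simp add: power_mult_distrib)
    also have "\<dots> \<le> c\<^sup>2 * (2 * ((norm (ar_X \<theta> e (n - m)))\<^sup>2 + (w * sqrt \<eta>)\<^sup>2))"
      using sum_squares_bound[of "norm (ar_X \<theta> e (n - m))" "w * sqrt \<eta>"]
      by (intro mult_left_mono) (auto simp: power2_sum)
    finally show ?thesis using \<eta> by (simp add: power_mult_distrib algebra_simps)
  qed
  have H0: "H \<ge> 0" using H by (rule order_trans[rotated]) (simp add: sum_nonneg)
  show ?thesis
  \<comment> \<open>Early times reach back to X_0 = 0. Later ones average over w distinct earlier
    times, whose energies sum to at most H.\<close>
  proof (cases "n < w")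
    case True
    then have "(norm (ar_X \<theta> e n))\<^sup>2 \<le> 2 * c\<^sup>2 * (real w)\<^sup>2 * \<eta>" using step[of n] by simp
    moreover have "0 \<le> 2 * c\<^sup>2 * H / w" using H0 by simp
    ultimately show ?thesis by linarith
  next
    case False
    have "w * (norm (ar_X \<theta> e n))\<^sup>2 = (\<Sum>m=1..w. (norm (ar_X \<theta> e n))\<^sup>2)" by simp
    also have "\<dots> \<le> (\<Sum>m=1..w. 2 * c\<^sup>2 * ((norm (ar_X \<theta> e (n - m)))\<^sup>2 + (real w)\<^sup>2 * \<eta>))"
      using False by (intro sum_mono step) auto
    also have "\<dots> = 2 * c\<^sup>2 * ((\<Sum>m=1..w. (norm (ar_X \<theta> e (n - m)))\<^sup>2) + w * ((real w)\<^sup>2 * \<eta>))"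
      by (simp add: sum_distrib_left[symmetric] sum.distrib)
    also have "\<dots> \<le> 2 * c\<^sup>2 * (H + w * ((real w)\<^sup>2 * \<eta>))"
    proof (intro mult_left_mono add_mono order_refl)
      have "(\<Sum>m=1..w. (norm (ar_X \<theta> e (n - m)))\<^sup>2) = (\<Sum>k\<in>(\<lambda>m. n - m) ` {1..w}. (norm (ar_X \<theta> e k))\<^sup>2)"
        using False by (subst sum.reindex) (auto simp: inj_on_def)
      also have "\<dots> \<le> (\<Sum>k<n. (norm (ar_X \<theta> e k))\<^sup>2)"
        using False by (intro sum_mono2) auto
      finally show "(\<Sum>m=1..w. (norm (ar_X \<theta> e (n - m)))\<^sup>2) \<le> H" using H by simp
    qed simp_all
    finally show ?thesis using w by (simp add: field_simps)
  qed
qed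

text \<open>Before the stopping time the energy is below H; at tau the last term may overshoot by D
  <= H, so the window bound is applied there with 2 H. This is the origin of the 4 in the balance
  condition.\<close>

lemma ar_X_max:
  assumes c: "\<And>m v. norm ((companion_T \<theta> ^^ m) v) \<le> c * norm v"
    and w: "w \<ge> 1" and e: "\<And>k. k \<in> {1..\<tau>} \<Longrightarrow> (e k)\<^sup>2 \<le> \<eta>" and \<eta>: "\<eta> \<ge> 0"
    and active: "\<And>k. k < \<tau> \<Longrightarrow> trace (ar_M \<theta> e k) < H"
    and D: "4 * c\<^sup>2 * H / w + 2 * c\<^sup>2 * (real w)\<^sup>2 * \<eta> \<le> D" "D \<le> H" and "\<tau> \<ge> 1"
  shows "n \<le> \<tau> \<Longrightarrow> (norm (ar_X \<theta> e n))\<^sup>2 \<le> D" and "trace (ar_M \<theta> e \<tau>) \<le> H + D"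
proof -
  have H0: "0 \<le> H" using active[of 0] \<open>\<tau> \<ge> 1\<close> by (auto simp: trace_ar_M)
  have le: "2 * c\<^sup>2 * H / w \<le> 4 * c\<^sup>2 * H / w" using H0 by (intro divide_right_mono) auto
  have *: "(norm (ar_X \<theta> e n))\<^sup>2 \<le> D" if "n < \<tau>" for n
    using ar_X_window[OF c w _ \<eta>, where n = n and e = e and H = H] active[OF that] e that D(1) le by (auto simp: trace_ar_M)
  have "trace (ar_M \<theta> e \<tau>) = trace (ar_M \<theta> e (\<tau> - 1)) + (norm (ar_X \<theta> e (\<tau> - 1)))\<^sup>2"
    using \<open>\<tau> \<ge> 1\<close> by (cases \<tau>) (auto simp: trace_ar_M)
  then show t: "trace (ar_M \<theta> e \<tau>) \<le> H + D"
    using active[of "\<tau> - 1"] *[of "\<tau> - 1"] \<open>\<tau> \<ge> 1\<close> by simp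
  assume "n \<le> \<tau>"
  then consider "n < \<tau>" | "n = \<tau>" by linarith
  then show "(norm (ar_X \<theta> e n))\<^sup>2 \<le> D"
  proof cases
    case 2
    have "(norm (ar_X \<theta> e \<tau>))\<^sup>2 \<le> 2 * c\<^sup>2 * (2 * H) / w + 2 * c\<^sup>2 * (real w)\<^sup>2 * \<eta>"
      by (rule ar_X_window[OF c w e \<eta>]) (use t D(2) in \<open>auto simp: trace_ar_M\<close>)
    then show ?thesis using 2 D(1) by simp
  qed (use * in simp)
qed

text \<open>Each further unit of lag drops one term at the end, of size at most D; at the start
  truncated subtraction only inserts F 0 = 0.\<close>

lemma sum_lag:
  fixes F :: "nat \<Rightarrow> real" and D :: real
  assumes "F 0 = 0" "\<And>k. k < n \<Longrightarrow> \<bar>F k\<bar> \<le> D" "D \<ge> 0"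
  shows "\<bar>(\<Sum>k<n. F (k - a)) - (\<Sum>k<n. F k)\<bar> \<le> a * D"
proof (induction a)
  case (Suc a)
  have "(\<Sum>k<n. F (k - Suc a)) = (\<Sum>k<n. F (k - a)) - (if n = 0 then 0 else F (n - 1 - a))"
  proof (cases n)
    case (Suc m)
    have "(\<Sum>k<Suc m. F (k - Suc a)) = F 0 + (\<Sum>k<m. F (k - a))"
      by (subst sum.lessThan_Suc_shift) simp
    then show ?thesis using Suc assms(1) by simp
  qed simp
  moreover have "\<bar>if n = 0 then 0 else F (n - 1 - a)\<bar> \<le> D"
    using assms(2)[of "n - 1 - a"] assms(3) by auto
  ultimately show ?case using Suc by (simp add: algebra_simps abs_le_iff)
qed simp

definition ar_autocov :: "real^'p::{finite,wellorder} \<Rightarrow> (nat \<Rightarrow> real) \<Rightarrow> nat \<Rightarrow> nat \<Rightarrow> real" where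
  "ar_autocov \<theta> e n m = (\<Sum>k<n. ar_x \<theta> e k * ar_x \<theta> e (k - m))"

text \<open>Each matrix entry is an autocovariance sum delayed by fewer than p steps, so
  \<open>sum_lag\<close> controls the difference.\<close>

lemma ar_M_autocov:
  fixes \<theta> :: "real^'p::{finite,wellorder}" and D :: real
  assumes D: "\<And>k. k \<le> n \<Longrightarrow> (norm (ar_X \<theta> e k))\<^sup>2 \<le> D"
  shows "\<bar>ar_M \<theta> e n $ i $ j - ar_autocov \<theta> e n (nat_dist (pos i) (pos j))\<bar> \<le> CARD('p) * D"
proof -
  have D0: "D \<ge> 0" using D[of 0] by simp
  have x: "\<bar>ar_x \<theta> e k * ar_x \<theta> e l\<bar> \<le> D" if "k \<le> n" "l \<le> n" for k l
  proof -
    have "\<bar>ar_x \<theta> e k\<bar> \<le> sqrt D" if "k \<le> n" for k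
      using order_trans[OF abs_ar_x_le real_le_rsqrt[OF D[OF that]]] .
    then have "\<bar>ar_x \<theta> e k\<bar> * \<bar>ar_x \<theta> e l\<bar> \<le> sqrt D * sqrt D" using that D0 by (intro mult_mono) auto
    then show ?thesis using D0 by (simp add: abs_mult)
  qed
  have *: "\<bar>ar_M \<theta> e n $ i $ j - ar_autocov \<theta> e n (nat_dist (pos i) (pos j))\<bar> \<le> CARD('p) * D" if "pos i \<le> pos j" for i j :: 'p
  proof -
    define a d where "a = pos i - 1" and "d = pos j - pos i"
    have "pos j - 1 = a + d" using that pos_bounds[of i] by (simp add: a_def d_def)
    then have M: "ar_M \<theta> e n $ i $ j = (\<Sum>k<n. ar_x \<theta> e (k - a) * ar_x \<theta> e (k - a - d))"
      by (simp add: ar_M_nth ar_X_nth a_def)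
    have "\<bar>(\<Sum>k<n. ar_x \<theta> e (k - a) * ar_x \<theta> e (k - a - d)) - (\<Sum>k<n. ar_x \<theta> e k * ar_x \<theta> e (k - d))\<bar> \<le> a * D"
      using sum_lag[of "\<lambda>k. ar_x \<theta> e k * ar_x \<theta> e (k - d)" n D a] x D0 by auto
    also have "\<dots> \<le> CARD('p) * D"
      using pos_bounds[of i] D0 by (intro mult_right_mono) (auto simp: a_def)
    finally show ?thesis unfolding M ar_autocov_def using that by (simp add: nat_dist_le d_def)
  qed
  show ?thesis
  proof (cases "pos i \<le> pos j")
    case False
    have "ar_M \<theta> e n $ i $ j = ar_M \<theta> e n $ j $ i" by (simp add: ar_M_nth mult.commute)
    then show ?thesis using *[of j i] False by (simp add: nat_dist_commute)
  qed (rule *)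
qed

text \<open>The sample autocovariances solve the Yule-Walker system up to boundary terms and the score
  \<open>\<Sum>\<epsilon>\<^sub>k X\<^sub>k\<^sub>-\<^sub>1\<close>, so the information matrix is close to a multiple of the Toeplitz solution.\<close>

lemma ar_M_close:
  fixes K :: "(real^'p::{finite,wellorder}) set"
  assumes K: "stable_bounds K T b l c"
  shows "\<exists>A>0. \<forall>\<theta>\<in>K. \<forall>r e n H (D::real). yw_map \<theta> r = first_unit
      \<and> (\<forall>k\<le>n. (norm (ar_X \<theta> e k))\<^sup>2 \<le> D) \<and> norm (\<Sum>k<n. e (Suc k) *\<^sub>R ar_X \<theta> e k) \<le> D
      \<and> H \<le> trace (ar_M \<theta> e n) \<and> trace (ar_M \<theta> e n) \<le> H + D
      \<longrightarrow> norm (ar_M \<theta> e n - (H / CARD('p)) *\<^sub>R toeplitz r) \<le> A * D"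
proof -
  define P where "P = CARD('p)"
  have P1: "real P \<ge> 1" by (simp add: P_def Suc_le_eq)
  have T: "T > 0" and b: "b > 0" using K by (auto simp: stable_bounds_def)
  \<comment> \<open>Residual in one Yule-Walker equation: 2 for a score coordinate and a boundary
    product, the rest for replacing matrix entries weighted by theta by autocovariances.\<close>
  define E where "E = 2 + real P * (T * real P)"
  \<comment> \<open>Three sources: passing from entries to autocovariances, inverting the
    Yule-Walker map, and reading the lag zero autocovariance off the trace.\<close>
  define A where "A = real P + real P * E / b + (1 + (real P)\<^sup>2) / b"
  have E0: "E > 0" using P1 T by (simp add: E_def add_pos_nonneg)
  have A0: "A > 0" using P1 E0 b by (simp add: A_def add_pos_nonneg)
  show ?thesis
  proof (intro exI[of _ "(real P)\<^sup>2 * A"] conjI ballI allI impI)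
    show "0 < (real P)\<^sup>2 * A" using P1 A0 by simp
    fix \<theta> r e n H D
    assume \<theta>: "\<theta> \<in> K" and *: "yw_map \<theta> r = first_unit
      \<and> (\<forall>k\<le>n. (norm (ar_X \<theta> e k))\<^sup>2 \<le> D) \<and> norm (\<Sum>k<n. e (Suc k) *\<^sub>R ar_X \<theta> e k) \<le> D
      \<and> H \<le> trace (ar_M \<theta> e n) \<and> trace (ar_M \<theta> e n) \<le> H + D"
    then have yw: "yw_map \<theta> r = first_unit" and D: "\<And>k. k \<le> n \<Longrightarrow> (norm (ar_X \<theta> e k))\<^sup>2 \<le> D"
      and S: "norm (\<Sum>k<n. e (Suc k) *\<^sub>R ar_X \<theta> e k) \<le> D"
      and H: "H \<le> trace (ar_M \<theta> e n)" "trace (ar_M \<theta> e n) \<le> H + D" by auto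
    have \<theta>T: "norm \<theta> \<le> T" and \<theta>b: "\<And>v. b * norm v \<le> norm (yw_map \<theta> v)"
      using K \<theta> by (auto simp: stable_bounds_def)
    have D0: "D \<ge> 0" using D[of 0] by simp
    define C where "C = ar_autocov \<theta> e n"
    have MC: "\<bar>ar_M \<theta> e n $ i $ j - C (nat_dist (pos i) (pos j))\<bar> \<le> P * D" for i j
      unfolding C_def P_def by (rule ar_M_autocov[OF D])
    have r1: "coef r 1 = 1"
      using arg_cong[OF yw, of "\<lambda>x. coef x 1"] by (simp add: coef_yw_map coef_first_unit)
    have nr: "norm r \<le> 1 / b"
      using \<theta>b[of r] b by (simp add: yw norm_first_unit field_simps)
    have YW: "\<bar>C j - (\<Sum>l=1..P. coef \<theta> l * C (nat_dist j l))\<bar> \<le> E * D" if j: "j \<in> {1..P - 1}" for j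
    proof -
      have "j \<in> {1..CARD('p)}" using j by (auto simp: P_def)
      then obtain i :: 'p where i: "j = pos i" using ex_pos by blast
      define s where "s = (\<Sum>k<n. e (Suc k) *\<^sub>R ar_X \<theta> e k) $ i"
      have s: "\<bar>s\<bar> \<le> D" unfolding s_def using component_le_norm_cart S order_trans by blast
      have xx: "\<bar>ar_x \<theta> e n * ar_x \<theta> e (n - j)\<bar> \<le> D"
      proof -
        have "\<bar>ar_x \<theta> e k\<bar> \<le> sqrt D" if "k \<le> n" for k
          using order_trans[OF abs_ar_x_le real_le_rsqrt[OF D[OF that]]] .
        then have "\<bar>ar_x \<theta> e n\<bar> * \<bar>ar_x \<theta> e (n - j)\<bar> \<le> sqrt D * sqrt D" using D0 by (intro mult_mono) auto
        then show ?thesis using D0 by (simp add: abs_mult)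
      qed
      \<comment> \<open>Shifting time by one costs only the product at the right end, because x_0 =
        0.\<close>
      have "(\<Sum>k<n. ar_x \<theta> e (Suc k) * ar_x \<theta> e (Suc k - j)) = C j + ar_x \<theta> e n * ar_x \<theta> e (n - j)"
        using sum.lessThan_Suc_shift[of "\<lambda>k. ar_x \<theta> e k * ar_x \<theta> e (k - j)" n] by (simp add: C_def ar_autocov_def)
      moreover have "(\<Sum>k<n. ar_x \<theta> e (Suc k) * ar_x \<theta> e (Suc k - j)) = (\<Sum>k<n. ar_x \<theta> e (Suc k) * ar_X \<theta> e k $ i)"
        using j by (intro sum.cong) (auto simp: ar_X_nth i[symmetric])
      moreover have "(\<Sum>k<n. ar_x \<theta> e (Suc k) * ar_X \<theta> e k $ i) = s + (ar_M \<theta> e n *v \<theta>) $ i"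
        by (simp add: ar_x_Suc ar_M_mult s_def distrib_right sum.distrib)
      moreover have "(ar_M \<theta> e n *v \<theta>) $ i = (\<Sum>k\<in>UNIV. \<theta> $ k * ar_M \<theta> e n $ i $ k)"
        by (simp add: matrix_vector_mult_def mult.commute)
      moreover have "(\<Sum>l=1..P. coef \<theta> l * C (nat_dist j l)) = (\<Sum>k\<in>UNIV. \<theta> $ k * C (nat_dist (pos i) (pos k)))"
        unfolding P_def sum_pos by (simp add: i)
      ultimately have "C j - (\<Sum>l=1..P. coef \<theta> l * C (nat_dist j l))
        = s - ar_x \<theta> e n * ar_x \<theta> e (n - j) + (\<Sum>k\<in>UNIV. \<theta> $ k * (ar_M \<theta> e n $ i $ k - C (nat_dist (pos i) (pos k))))"
        by (simp add: right_diff_distrib sum_subtractf)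
      also have "\<bar>\<dots>\<bar> \<le> D + D + (\<Sum>k\<in>(UNIV::'p set). T * (P * D))"
      proof -
        have "\<bar>\<Sum>k\<in>UNIV. \<theta> $ k * (ar_M \<theta> e n $ i $ k - C (nat_dist (pos i) (pos k)))\<bar> \<le> (\<Sum>k\<in>(UNIV::'p set). T * (P * D))"
        proof (rule order_trans[OF sum_abs sum_mono])
          fix k :: 'p
          have "\<bar>\<theta> $ k\<bar> \<le> T" using component_le_norm_cart[of \<theta> k] \<theta>T by linarith
          then show "\<bar>\<theta> $ k * (ar_M \<theta> e n $ i $ k - C (nat_dist (pos i) (pos k)))\<bar> \<le> T * (P * D)"
            unfolding abs_mult using MC[of i k] T by (intro mult_mono) auto
        qed
        then show ?thesis using s xx by linarith
      qed
      also have "\<dots> = E * D" by (simp add: E_def P_def[symmetric] algebra_simps)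
      finally show ?thesis .
    qed
    define V where "V = (\<chi> i::'p. C (pos i - 1))"
    have cV: "coef V j = (if j \<in> {1..P} then C (j - 1) else 0)" for j
      unfolding V_def P_def by (rule coef_lambda[of "\<lambda>j. C (j - 1)"])
    have "norm (yw_map \<theta> V - C 0 *\<^sub>R first_unit) \<le> (\<Sum>i\<in>UNIV. \<bar>(yw_map \<theta> V - C 0 *\<^sub>R first_unit) $ i\<bar>)"
      by (rule norm_le_l1_cart)
    also have "\<dots> \<le> (\<Sum>i\<in>(UNIV::'p set). E * D)"
    proof (rule sum_mono)
      fix i :: 'p
      show "\<bar>(yw_map \<theta> V - C 0 *\<^sub>R first_unit) $ i\<bar> \<le> E * D"
      proof (cases "pos i = 1")
        case True
        then show ?thesis using E0 D0 P1 by (simp add: yw_map_def first_unit_def cV)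
      next
        case False
        then have j: "pos i - 1 \<in> {1..P - 1}" "pos i \<in> {2..P}" using pos_bounds[of i] by (auto simp: P_def)
        have "(yw_map \<theta> V - C 0 *\<^sub>R first_unit) $ i = C (pos i - 1) - (\<Sum>l=1..P. coef \<theta> l * C (nat_dist (pos i - 1) l))"
        proof -
          have "coef V (nat_dist (pos i - 1) l + 1) = C (nat_dist (pos i - 1) l)" if "l \<in> {1..P}" for l
            using j that by (auto simp: cV nat_dist_def)
          then have "(\<Sum>l=1..P. coef \<theta> l * coef V (nat_dist (pos i - 1) l + 1)) = (\<Sum>l=1..P. coef \<theta> l * C (nat_dist (pos i - 1) l))"
            by (intro sum.cong) auto
          moreover have "V $ i = C (pos i - 1)" by (simp add: V_def)
          ultimately show ?thesis using False by (simp add: yw_map_def first_unit_def P_def)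
        qed
        then show ?thesis using YW[OF j(1)] by simp
      qed
    qed
    also have "\<dots> = P * E * D" by (simp add: P_def)
    finally have n1: "norm (yw_map \<theta> V - C 0 *\<^sub>R first_unit) \<le> P * E * D" .
    \<comment> \<open>The vector C 0 times r solves the system exactly with first coordinate C 0, so
      the residual of V controls their distance.\<close>
    have "b * norm (V - C 0 *\<^sub>R r) \<le> norm (yw_map \<theta> (V - C 0 *\<^sub>R r))" by (rule \<theta>b)
    also have "\<dots> \<le> P * E * D" using n1 by (simp add: yw_map_linear yw)
    finally have Vr: "norm (V - C 0 *\<^sub>R r) \<le> P * E / b * D" using b by (simp add: field_simps)
    \<comment> \<open>Every diagonal entry is close to C 0, so the trace determines C 0 up to
      O(D).\<close>
    have "trace (ar_M \<theta> e n) - P * C 0 = (\<Sum>i\<in>(UNIV::'p set). ar_M \<theta> e n $ i $ i - C 0)"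
      by (simp add: trace_def sum_subtractf P_def)
    also have "\<bar>\<dots>\<bar> \<le> (\<Sum>i\<in>(UNIV::'p set). P * D)"
      using MC[of i i for i] by (intro order_trans[OF sum_abs sum_mono]) auto
    finally have "\<bar>trace (ar_M \<theta> e n) - P * C 0\<bar> \<le> P * P * D" by (simp add: P_def)
    then have "\<bar>P * C 0 - H\<bar> \<le> (1 + (real P)\<^sup>2) * D" using H by (simp add: power2_eq_square algebra_simps)
    also have "\<dots> \<le> P * ((1 + (real P)\<^sup>2) * D)"
      using P1 D0 mult_right_mono[of 1 "real P" "(1 + (real P)\<^sup>2) * D"] by simp
    finally have "\<bar>P * (C 0 - H / P)\<bar> \<le> P * ((1 + (real P)\<^sup>2) * D)" using P1 by (simp add: right_diff_distrib)
    then have C0: "\<bar>C 0 - H / P\<bar> \<le> (1 + (real P)\<^sup>2) * D" using P1 by (simp add: abs_mult)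
    have entry: "\<bar>(ar_M \<theta> e n - (H / P) *\<^sub>R toeplitz r) $ i $ j\<bar> \<le> A * D" for i j
    proof -
      define m where "m = nat_dist (pos i) (pos j)"
      have m: "m < P" using pos_bounds[of i] pos_bounds[of j] by (auto simp: m_def nat_dist_def P_def)
      have "C m - C 0 * coef r (m + 1) = coef (V - C 0 *\<^sub>R r) (m + 1)" using m by (simp add: coef_linear cV)
      then have "\<bar>C m - C 0 * coef r (m + 1)\<bar> \<le> P * E / b * D"
        using order_trans[OF coef_abs_le Vr] by simp
      moreover have "\<bar>C 0 * coef r (m + 1) - H / P * coef r (m + 1)\<bar> \<le> (1 + (real P)\<^sup>2) / b * D"
      proof -
        have "\<bar>C 0 * coef r (m + 1) - H / P * coef r (m + 1)\<bar> = \<bar>C 0 - H / P\<bar> * \<bar>coef r (m + 1)\<bar>"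
          by (simp add: abs_mult[symmetric] left_diff_distrib)
        also have "\<dots> \<le> ((1 + (real P)\<^sup>2) * D) * (1 / b)"
          using order_trans[OF coef_abs_le nr] by (intro mult_mono C0) (auto simp: D0)
        finally show ?thesis by simp
      qed
      moreover have "\<bar>ar_M \<theta> e n $ i $ j - C m\<bar> \<le> P * D" unfolding m_def by (rule MC)
      moreover have "(ar_M \<theta> e n - (H / P) *\<^sub>R toeplitz r) $ i $ j = ar_M \<theta> e n $ i $ j - H / P * coef r (m + 1)"
        by (simp add: toeplitz_def m_def)
      ultimately show ?thesis unfolding A_def distrib_right by linarith
    qed
    have "norm (ar_M \<theta> e n - (H / P) *\<^sub>R toeplitz r) \<le> (\<Sum>i\<in>UNIV. norm ((ar_M \<theta> e n - (H / P) *\<^sub>R toeplitz r) $ i))"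
      unfolding norm_vec_def[of "ar_M \<theta> e n - (H / P) *\<^sub>R toeplitz r"] by (rule L2_set_le_sum) simp
    also have "\<dots> \<le> (\<Sum>i\<in>(UNIV::'p set). \<Sum>j\<in>(UNIV::'p set). A * D)"
      by (intro sum_mono order_trans[OF norm_le_l1_cart] entry)
    also have "\<dots> = (real P)\<^sup>2 * A * D" by (simp add: P_def power2_eq_square)
    finally show "norm (ar_M \<theta> e n - (H / CARD('p)) *\<^sub>R toeplitz r) \<le> (real P)\<^sup>2 * A * D" by (simp add: P_def)
  qed
qed

section \<open>Matrix bounds and inverse square roots\<close>

lemma norm_matrix_vector_le: "norm (E *v v) \<le> norm E * norm v" for E :: "real^'n^'m"
proof -
  have "(norm (E *v v))\<^sup>2 = (\<Sum>i\<in>UNIV. (E $ i \<bullet> v)\<^sup>2)"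
    unfolding power2_norm_eq_inner inner_vec_def[of "E *v v"]
    by (simp add: matrix_vector_mul_component power2_eq_square)
  also have "\<dots> \<le> (\<Sum>i\<in>UNIV. (norm (E $ i))\<^sup>2 * (norm v)\<^sup>2)"
  proof (rule sum_mono)
    fix i
    have "\<bar>E $ i \<bullet> v\<bar> \<le> norm (E $ i) * norm v" by (rule Cauchy_Schwarz_ineq2)
    then show "(E $ i \<bullet> v)\<^sup>2 \<le> (norm (E $ i))\<^sup>2 * (norm v)\<^sup>2"
      by (metis abs_ge_zero power2_abs power_mono power_mult_distrib)
  qed
  also have "\<dots> = (norm E * norm v)\<^sup>2" by (simp add: norm_matrix_squared power_mult_distrib sum_distrib_right)
  finally show ?thesis by (rule power2_le_imp_le) simp
qed

lemma form_le_norm: "\<bar>v \<bullet> (E *v v)\<bar> \<le> norm E * (norm v)\<^sup>2" for E :: "real^'n^'n"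
proof -
  have "\<bar>v \<bullet> (E *v v)\<bar> \<le> norm v * norm (E *v v)" by (rule Cauchy_Schwarz_ineq2)
  also have "\<dots> \<le> norm v * (norm E * norm v)" by (intro mult_left_mono norm_matrix_vector_le) simp
  finally show ?thesis by (simp add: power2_eq_square mult_ac)
qed

lemma norm_lower_of_form:
  fixes S :: "real^'n^'n"
  assumes "s * (v \<bullet> v) \<le> v \<bullet> (S *v v)"
  shows "s * norm v \<le> norm (S *v v)"
proof (cases "v = 0")
  case False
  have "norm v * (s * norm v) \<le> norm v * norm (S *v v)"
    using assms norm_cauchy_schwarz[of v "S *v v"] by (simp add: mult_ac flip: power2_norm_eq_inner power2_eq_square)
  then show ?thesis using False by simp
qed simp

lemma invertible_of_form:
  fixes S :: "real^'n^'n"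
  assumes "\<And>v. s * (v \<bullet> v) \<le> v \<bullet> (S *v v)" "s > 0"
  shows "invertible S"
proof -
  have "v = 0" if "S *v v = 0" for v
  proof -
    have "v \<bullet> v \<le> 0" using assms(1)[of v] assms(2) that by (simp add: mult_le_0_iff)
    then show ?thesis using inner_gt_zero_iff[of v] by linarith
  qed
  then show ?thesis by (simp add: invertible_left_inverse matrix_left_invertible_ker)
qed

lemma matrix_inv_mult:
  assumes "invertible (S :: real^'n^'n)"
  shows "S ** matrix_inv S = mat 1" "matrix_inv S ** S = mat 1"
  using someI_ex[OF assms[unfolded invertible_def]] by (auto simp: matrix_inv_def)

text \<open>The determinant is the square of that of the root. Positivity puts \<open>pinv\<close>
  into its invertible branch.\<close>

lemma psd_det_pos:
  assumes A: "A \<in> psd_cone" and inv: "invertible A"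
  shows "det A > 0"
proof -
  have "det A = (det (msqrt A))\<^sup>2"
    by (metis det_mul msqrt_psd(2)[OF A] power2_eq_square)
  moreover have "det A \<noteq> 0" using inv by (simp add: invertible_det_nz)
  ultimately show ?thesis by (metis zero_less_power2 zero_power2)
qed

text \<open>J is the inverse square root of G: symmetric, bounded by 1 / sqrt g, and J G J is the
  identity, so J turns the covariance G of the score into a standard one.\<close>

lemma inverse_sqrt:
  assumes G: "G \<in> psd_cone" and g: "\<And>v. g * (v \<bullet> v) \<le> v \<bullet> (G *v v)" "g > 0"
  defines "J \<equiv> matrix_inv (msqrt G)"
  shows "msqrt G *v (J *v z) = z" "norm (J *v z) \<le> norm z / sqrt g"
    "u \<bullet> (J *v z) = (J *v u) \<bullet> z" "(J *v z) \<bullet> (G *v (J *v z)) = z \<bullet> z"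
proof -
  note S = msqrt_psd[OF G]
  have low: "sqrt g * (v \<bullet> v) \<le> v \<bullet> (msqrt G *v v)" for v
    using msqrt_lower[OF G g(1)] g(2) by simp
  have sg: "sqrt g > 0" using g by simp
  note inv = matrix_inv_mult[OF invertible_of_form[OF low sg], folded J_def]
  have SJ: "msqrt G *v (J *v z) = z" for z by (simp add: matrix_vector_mul_assoc inv)
  have tr: "transpose (msqrt G) = msqrt G" using S(1) by (simp add: psd_cone_def)
  show "msqrt G *v (J *v z) = z" by (rule SJ)
  show "norm (J *v z) \<le> norm z / sqrt g"
    using norm_lower_of_form[OF low, of "J *v z"] sg by (simp add: SJ field_simps)
  have "u \<bullet> (J *v z) = (msqrt G *v (J *v u)) \<bullet> (J *v z)" by (simp add: SJ)
  also have "\<dots> = (J *v u) \<bullet> (msqrt G *v (J *v z))" by (rule inner_symmetric_matrix[OF tr, symmetric])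
  finally show "u \<bullet> (J *v z) = (J *v u) \<bullet> z" by (simp add: SJ)
  have "(J *v z) \<bullet> (G *v (J *v z)) = (J *v z) \<bullet> (msqrt G *v (msqrt G *v (J *v z)))"
    using S(2) by (metis matrix_vector_mul_assoc)
  also have "\<dots> = (msqrt G *v (J *v z)) \<bullet> (msqrt G *v (J *v z))" by (rule inner_symmetric_matrix[OF tr])
  finally show "(J *v z) \<bullet> (G *v (J *v z)) = z \<bullet> z" by (simp add: SJ)
qed

text \<open>Both conditions concern X_0, ..., X_k only, so these weights are predictable. On a good
  path they are X_k for k < tau and 0 afterwards; on every path their total energy is
  bounded.\<close>

definition truncated_X :: "real^'p::{finite,wellorder} \<Rightarrow> (nat \<Rightarrow> real) \<Rightarrow> real \<Rightarrow> real \<Rightarrow> nat \<Rightarrow> real^'p::{finite,wellorder}" where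
  "truncated_X \<theta> e H D k = (if trace (ar_M \<theta> e k) < H \<and> (norm (ar_X \<theta> e k))\<^sup>2 \<le> D then ar_X \<theta> e k else 0)"

lemma truncated_X_bound: "D \<ge> 0 \<Longrightarrow> (norm (truncated_X \<theta> e H D k))\<^sup>2 \<le> D"
  by (simp add: truncated_X_def)

text \<open>The induction carries both bounds at once: while the trace is below H a term of size at
  most D may be added, and from then on nothing is.\<close>

lemma truncated_X_sum:
  assumes "H \<ge> 0" "D \<ge> 0"
  shows "(\<Sum>k<N. (norm (truncated_X \<theta> e H D k))\<^sup>2) \<le> H + D"
proof -
  have "(\<Sum>k<N. (norm (truncated_X \<theta> e H D k))\<^sup>2) \<le> min (trace (ar_M \<theta> e N)) (H + D)"
  proof (induction N)
    case 0
    show ?case using assms by (simp add: trace_ar_M)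
  next
    case (Suc N)
    have "trace (ar_M \<theta> e (Suc N)) = trace (ar_M \<theta> e N) + (norm (ar_X \<theta> e N))\<^sup>2" by (simp add: trace_ar_M)
    then show ?case
      using Suc by (cases "trace (ar_M \<theta> e N) < H \<and> (norm (ar_X \<theta> e N))\<^sup>2 \<le> D")
        (auto simp: truncated_X_def[of \<theta> e H D N] intro: add_increasing2)
  qed
  then show ?thesis by simp
qed

definition ar_pivot :: "real^'p::{finite,wellorder} \<Rightarrow> (nat \<Rightarrow> real) \<Rightarrow> real \<Rightarrow> real \<Rightarrow> real^'p::{finite,wellorder}" where
  "ar_pivot \<theta> e \<sigma> h = msqrt (ar_M \<theta> e (ar_tau \<theta> e \<sigma> h)) *v (ar_lse \<theta> e (ar_tau \<theta> e \<sigma> h) - \<theta>)"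

lemma scaled_toeplitz:
  assumes r: "\<And>v. l * (v \<bullet> v) \<le> v \<bullet> (toeplitz r *v v)" and "l \<ge> 0" "a \<ge> 0"
  shows "a * l * (v \<bullet> v) \<le> v \<bullet> (a *\<^sub>R toeplitz r *v v)" "a *\<^sub>R toeplitz r \<in> psd_cone"
proof -
  have low: "a * l * (v \<bullet> v) \<le> v \<bullet> (a *\<^sub>R toeplitz r *v v)" for v
    using mult_left_mono[OF r \<open>a \<ge> 0\<close>, of v] by (simp add: mult.assoc flip: scaleR_matrix_vector_assoc)
  show "a * l * (v \<bullet> v) \<le> v \<bullet> (a *\<^sub>R toeplitz r *v v)" by (rule low)
  have "0 \<le> v \<bullet> (a *\<^sub>R toeplitz r *v v)" for v
    by (rule order_trans[OF _ low]) (use assms in simp)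
  moreover have "transpose (a *\<^sub>R toeplitz r) = a *\<^sub>R toeplitz r"
    using toeplitz_symmetric[of r] by (simp add: transpose_def vec_eq_iff)
  ultimately show "a *\<^sub>R toeplitz r \<in> psd_cone" by (simp add: psd_cone_def psd_matrix_def)
qed

text \<open>The deterministic core; probability enters later, through the assumptions on e, N and
  the score. Let R be the root of M / h, W the pivot and Y the inverse root of G applied to Z. Then
  R W and the root of G applied to Y both equal Z, so R (W - Y) is minus the difference of the two
  roots applied to Y, small by \<open>msqrt_lipschitz\<close>.\<close>

lemma good_path:
  fixes \<theta> :: "real^'p::{finite,wellorder}" and \<sigma> h \<delta> \<eta> A :: real
  assumes c: "\<And>m v. norm ((companion_T \<theta> ^^ m) v) \<le> c * norm v"
    and r: "\<And>v. l * (v \<bullet> v) \<le> v \<bullet> (toeplitz r *v v)"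
    and A: "\<And>e n H D. (\<forall>k\<le>n. (norm (ar_X \<theta> e k))\<^sup>2 \<le> D) \<Longrightarrow> norm (\<Sum>k<n. e (Suc k) *\<^sub>R ar_X \<theta> e k) \<le> D
      \<Longrightarrow> H \<le> trace (ar_M \<theta> e n) \<Longrightarrow> trace (ar_M \<theta> e n) \<le> H + D
      \<Longrightarrow> norm (ar_M \<theta> e n - (H / CARD('p)) *\<^sub>R toeplitz r) \<le> A * D"
    and pos: "l > 0" "\<sigma> > 0" "h > 0" "A > 0"
    and \<delta>: "4 * c\<^sup>2 * \<sigma>\<^sup>2 / real w + 2 * c\<^sup>2 * (real w)\<^sup>2 * \<eta> \<le> \<delta>" "\<delta> \<le> \<sigma>\<^sup>2" "w \<ge> 1" "\<eta> \<ge> 0"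
    and g: "g = \<sigma>\<^sup>2 * l / CARD('p)" "A * \<delta> \<le> g / 2"
    and e: "\<And>k. k \<in> {1..N} \<Longrightarrow> (e k)\<^sup>2 \<le> \<eta> * h" and N: "trace (ar_M \<theta> e N) \<ge> h * \<sigma>\<^sup>2"
    and Zb: "norm (\<Sum>k<N. e (Suc k) *\<^sub>R truncated_X \<theta> e (h * \<sigma>\<^sup>2) (\<delta> * h) k) \<le> \<delta> * h"
  defines "G \<equiv> (\<sigma>\<^sup>2 / CARD('p)) *\<^sub>R toeplitz r"
    and "Z \<equiv> (1 / sqrt h) *\<^sub>R (\<Sum>k<N. e (Suc k) *\<^sub>R truncated_X \<theta> e (h * \<sigma>\<^sup>2) (\<delta> * h) k)"
  shows "norm (ar_pivot \<theta> e \<sigma> h - matrix_inv (msqrt G) *v Z) \<le> (sqrt 2 * A / (g * sqrt g)) * \<delta> * norm Z"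
    and "\<bar>(\<Sum>k<N. (\<mu> \<bullet> truncated_X \<theta> e (h * \<sigma>\<^sup>2) (\<delta> * h) k)\<^sup>2) / h - \<mu> \<bullet> (G *v \<mu>)\<bar> \<le> A * \<delta> * (norm \<mu>)\<^sup>2"
proof -
  define H where "H = h * \<sigma>\<^sup>2"
  define D where "D = \<delta> * h"
  define \<tau> where "\<tau> = ar_tau \<theta> e \<sigma> h"
  have H0: "H > 0" using pos by (simp add: H_def)
  have N1: "N \<ge> 1"
  proof (rule ccontr)
    assume "\<not> N \<ge> 1"
    then have "N = 0" by simp
    then show False using N H0 by (simp add: trace_ar_M H_def)
  qed
  have \<tau>: "1 \<le> \<tau>" "trace (ar_M \<theta> e \<tau>) \<ge> H" "\<tau> \<le> N"
    unfolding \<tau>_def ar_tau_def H_def using LeastI[of "\<lambda>n. 1 \<le> n \<and> trace (ar_M \<theta> e n) \<ge> h * \<sigma>\<^sup>2" N] N N1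
    by (auto intro: Least_le)
  have active: "trace (ar_M \<theta> e k) < H" if "k < \<tau>" for k
  proof (cases "k = 0")
    case True
    then show ?thesis using H0 by (simp add: trace_ar_M)
  next
    case False
    then show ?thesis
      using not_less_Least[of k "\<lambda>n. 1 \<le> n \<and> trace (ar_M \<theta> e n) \<ge> h * \<sigma>\<^sup>2"] that
      by (auto simp: \<tau>_def ar_tau_def H_def not_le)
  qed
  have mono: "trace (ar_M \<theta> e \<tau>) \<le> trace (ar_M \<theta> e k)" if "\<tau> \<le> k" for k
    unfolding trace_ar_M using that by (intro sum_mono2) auto
  have D1: "4 * c\<^sup>2 * H / real w + 2 * c\<^sup>2 * (real w)\<^sup>2 * (\<eta> * h) \<le> D"
    using mult_right_mono[OF \<delta>(1), of h] pos by (simp add: H_def D_def algebra_simps)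
  have D2: "D \<le> H" using \<delta>(2) pos by (simp add: H_def D_def mult.commute mult_left_mono)
  have X: "(norm (ar_X \<theta> e n))\<^sup>2 \<le> D" if "n \<le> \<tau>" for n
    using ar_X_max(1)[OF c \<delta>(3) _ _ active D1 D2 \<tau>(1) that] e \<tau>(3) \<delta>(4) pos by auto
  have tr: "trace (ar_M \<theta> e \<tau>) \<le> H + D"
    using ar_X_max(2)[OF c \<delta>(3) _ _ active D1 D2 \<tau>(1)] e \<tau>(3) \<delta>(4) pos by auto
  \<comment> \<open>Up to tau the size condition always holds, and from tau on the trace condition
    fails for good.\<close>
  have trunc: "truncated_X \<theta> e H D k = (if k < \<tau> then ar_X \<theta> e k else 0)" for k
  proof (cases "k < \<tau>")
    case False
    then show ?thesis using mono[of k] \<tau>(2) by (simp add: truncated_X_def)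
  qed (use active X in \<open>simp add: truncated_X_def\<close>)
  have sum_trunc: "(\<Sum>k<N. f k (truncated_X \<theta> e H D k)) = (\<Sum>k<\<tau>. f k (ar_X \<theta> e k))"
    if "\<And>k. f k 0 = 0" for f :: "nat \<Rightarrow> real^'p::{finite,wellorder} \<Rightarrow> 'b::real_vector"
  proof -
    have "(\<Sum>k<\<tau>. f k (ar_X \<theta> e k)) = (\<Sum>k<N. f k (truncated_X \<theta> e H D k))"
      using \<tau>(3) that by (intro sum.mono_neutral_cong_left) (auto simp: trunc)
    then show ?thesis by simp
  qed
  define S where "S = (\<Sum>k<\<tau>. e (Suc k) *\<^sub>R ar_X \<theta> e k)"
  have ZS: "(\<Sum>k<N. e (Suc k) *\<^sub>R truncated_X \<theta> e H D k) = S"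
    unfolding S_def by (rule sum_trunc) simp
  have Z: "Z = (1 / sqrt h) *\<^sub>R S" unfolding Z_def H_def[symmetric] D_def[symmetric] ZS ..
  have SD: "norm S \<le> D" using Zb unfolding H_def[symmetric] D_def[symmetric] ZS .
  define Mh where "Mh = (1 / h) *\<^sub>R ar_M \<theta> e \<tau>"
  have close: "norm (Mh - G) \<le> A * \<delta>"
  proof -
    have "Mh - G = (1 / h) *\<^sub>R (ar_M \<theta> e \<tau> - (H / CARD('p)) *\<^sub>R toeplitz r)"
      using pos by (simp add: Mh_def G_def H_def scaleR_diff_right)
    then have "norm (Mh - G) = norm (ar_M \<theta> e \<tau> - (H / CARD('p)) *\<^sub>R toeplitz r) / h" using pos by simp
    also have "\<dots> \<le> A * D / h"
      using A[of \<tau> e D H] X SD \<tau>(2) tr pos by (intro divide_right_mono) (auto simp: S_def)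
    finally show ?thesis using pos by (simp add: D_def)
  qed
  have g0: "g > 0" using pos by (simp add: g)
  have Gg: "g * (v \<bullet> v) \<le> v \<bullet> (G *v v)" for v
    using scaled_toeplitz(1)[OF r, of "\<sigma>\<^sup>2 / CARD('p)" v] pos by (simp add: G_def g)
  have Gpsd: "G \<in> psd_cone"
    unfolding G_def by (rule scaled_toeplitz(2)[OF r]) (use pos in auto)
  have Mpsd: "Mh \<in> psd_cone"
    using ar_M_psd[of \<theta> e \<tau>] pos
    by (auto simp: Mh_def psd_cone_def psd_matrix_def transpose_def vec_eq_iff simp flip: scaleR_matrix_vector_assoc)
  have diff: "\<bar>v \<bullet> (Mh *v v) - v \<bullet> (G *v v)\<bar> \<le> A * \<delta> * (norm v)\<^sup>2" for v
  proof -
    have "\<bar>v \<bullet> (Mh *v v) - v \<bullet> (G *v v)\<bar> = \<bar>v \<bullet> ((Mh - G) *v v)\<bar>"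
      by (simp add: matrix_vector_mult_diff_rdistrib inner_diff_right)
    also have "\<dots> \<le> norm (Mh - G) * (norm v)\<^sup>2" by (rule form_le_norm)
    also have "\<dots> \<le> A * \<delta> * (norm v)\<^sup>2" by (intro mult_right_mono close) simp
    finally show ?thesis .
  qed
  \<comment> \<open>Half of g is given up to the perturbation. What is left keeps the information
    matrix invertible, so the estimator uses the true inverse.\<close>
  have Mg: "(g / 2) * (v \<bullet> v) \<le> v \<bullet> (Mh *v v)" for v
  proof -
    have "A * \<delta> * (norm v)\<^sup>2 \<le> g / 2 * (norm v)\<^sup>2" by (intro mult_right_mono g) simp
    then show ?thesis using diff[of v] Gg[of v] by (simp add: power2_norm_eq_inner)
  qed
  have "(\<Sum>k<N. (\<mu> \<bullet> truncated_X \<theta> e H D k)\<^sup>2) = \<mu> \<bullet> (ar_M \<theta> e \<tau> *v \<mu>)"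
    unfolding ar_M_form by (rule sum_trunc) simp
  then have "(\<Sum>k<N. (\<mu> \<bullet> truncated_X \<theta> e H D k)\<^sup>2) / h = \<mu> \<bullet> (Mh *v \<mu>)"
    by (simp add: Mh_def flip: scaleR_matrix_vector_assoc)
  with diff[of \<mu>] show "\<bar>(\<Sum>k<N. (\<mu> \<bullet> truncated_X \<theta> e (h * \<sigma>\<^sup>2) (\<delta> * h) k)\<^sup>2) / h - \<mu> \<bullet> (G *v \<mu>)\<bar> \<le> A * \<delta> * (norm \<mu>)\<^sup>2"
    by (simp add: H_def D_def)
  have M: "ar_M \<theta> e \<tau> = h *\<^sub>R Mh" using pos by (simp add: Mh_def)
  have "invertible (ar_M \<theta> e \<tau>)"
  proof (rule invertible_of_form)
    show "(h * (g / 2)) * (v \<bullet> v) \<le> v \<bullet> (ar_M \<theta> e \<tau> *v v)" for v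
      using mult_left_mono[OF Mg[of v], of h] pos by (simp add: M mult.assoc flip: scaleR_matrix_vector_assoc)
    show "h * (g / 2) > 0" using pos g0 by simp
  qed
  then have det: "det (ar_M \<theta> e \<tau>) > 0" by (intro psd_det_pos ar_M_psd)
  define W where "W = ar_pivot \<theta> e \<sigma> h"
  have W: "W = sqrt h *\<^sub>R (msqrt Mh *v (ar_lse \<theta> e \<tau> - \<theta>))"
    unfolding W_def ar_pivot_def \<tau>_def[symmetric] M using Mpsd pos
    by (simp add: msqrt_scaleR scaleR_matrix_vector_assoc)
  have "msqrt Mh *v W = (sqrt h / h) *\<^sub>R (h *\<^sub>R (Mh *v (ar_lse \<theta> e \<tau> - \<theta>)))"
    unfolding W using pos by (simp add: matrix_vector_mult_scaleR matrix_vector_mul_assoc msqrt_psd(2)[OF Mpsd])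
  also have "h *\<^sub>R (Mh *v (ar_lse \<theta> e \<tau> - \<theta>)) = S"
    unfolding S_def ar_lse_equation[OF det, symmetric] by (simp add: M scaleR_matrix_vector_assoc)
  also have "sqrt h / h = 1 / sqrt h" using pos by (simp add: field_simps)
  finally have RW: "msqrt Mh *v W = Z" by (simp add: Z)
  define Y where "Y = matrix_inv (msqrt G) *v Z"
  have RY: "msqrt G *v Y = Z" and nY: "norm Y \<le> norm Z / sqrt g"
    unfolding Y_def by (rule inverse_sqrt[OF Gpsd Gg g0])+
  have lowG: "sqrt g * (v \<bullet> v) \<le> v \<bullet> (msqrt G *v v)" for v
    using msqrt_lower[OF Gpsd Gg] g0 by simp
  have lowM: "sqrt (g / 2) * (v \<bullet> v) \<le> v \<bullet> (msqrt Mh *v v)" for v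
    using msqrt_lower[OF Mpsd Mg] g0 by simp
  have lip: "norm (msqrt Mh - msqrt G) \<le> A * \<delta> / sqrt g"
    using msqrt_lipschitz[OF Mpsd Gpsd _ lowG] g0 close divide_right_mono[OF close, of "sqrt g"] by simp
  \<comment> \<open>The final constant collects 1 / sqrt g from the Lipschitz bound, 1 / sqrt g from
    the norm of Y and sqrt (2 / g) from the lower bound for R.\<close>
  have "sqrt (g / 2) * norm (W - Y) \<le> norm (msqrt Mh *v (W - Y))" by (rule norm_lower_of_form[OF lowM])
  also have "msqrt Mh *v (W - Y) = - ((msqrt Mh - msqrt G) *v Y)"
    by (simp add: matrix_vector_mult_diff_distrib matrix_vector_mult_diff_rdistrib RW RY)
  also have "norm (- ((msqrt Mh - msqrt G) *v Y)) \<le> norm (msqrt Mh - msqrt G) * norm Y"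
    by (simp add: norm_matrix_vector_le)
  also have "\<dots> \<le> (A * \<delta> / sqrt g) * (norm Z / sqrt g)"
    using lip by (intro mult_mono nY) (auto intro: order_trans[OF norm_ge_zero])
  also have "\<dots> = A * \<delta> * norm Z / g" using g0 by (simp add: real_sqrt_mult_self flip: times_divide_times_eq)
  finally have "norm (W - Y) \<le> A * \<delta> * norm Z / g / sqrt (g / 2)"
    using g0 by (simp add: pos_le_divide_eq mult_ac)
  also have "\<dots> = (sqrt 2 * A / (g * sqrt g)) * \<delta> * norm Z"
    by (simp add: real_sqrt_divide mult_ac)
  finally show "norm (ar_pivot \<theta> e \<sigma> h - matrix_inv (msqrt G) *v Z) \<le> (sqrt 2 * A / (g * sqrt g)) * \<delta> * norm Z"
    by (simp add: W_def Y_def)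
qed

section \<open>Asymptotic normality\<close>

lemma borel_measurable_matrixI:
  fixes f :: "'a \<Rightarrow> real^'n^'m"
  assumes "\<And>i j. (\<lambda>x. f x $ i $ j) \<in> borel_measurable M"
  shows "f \<in> borel_measurable M"
  using assms by (subst borel_measurable_euclidean_space) (auto simp: Basis_vec_def inner_axis)

lemma borel_measurable_matrix_entry [measurable (raw)]:
  fixes f :: "'a \<Rightarrow> real^'n^'m"
  assumes [measurable]: "f \<in> borel_measurable M"
  shows "(\<lambda>x. f x $ i $ j) \<in> borel_measurable M"
proof -
  have "(\<lambda>A :: real^'n^'m. A $ i $ j) \<in> borel_measurable borel"
    by (intro borel_measurable_continuous_onI continuous_intros)
  from measurable_compose[OF assms this] show ?thesis .
qed

lemma borel_measurable_det:
  fixes f :: "'a \<Rightarrow> real^'n^'n"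
  assumes [measurable]: "f \<in> borel_measurable M"
  shows "(\<lambda>x. det (f x)) \<in> borel_measurable M"
  unfolding det_def by measurable

lemma borel_measurable_matrix_vector:
  fixes f :: "'a \<Rightarrow> real^'n^'m"
  assumes [measurable]: "f \<in> borel_measurable M" "g \<in> borel_measurable M"
  shows "(\<lambda>x. f x *v g x) \<in> borel_measurable M"
  unfolding matrix_vector_mult_def by (rule borel_measurable_vecI) simp

text \<open>Cramer's rule writes the inverse through determinants, which are polynomials in the
  entries; measurability of the estimator follows.\<close>

lemma pinv_mult:
  "pinv A *v b = (if det A > 0 then (\<chi> k. det (\<chi> i j. if j = k then b $ i else A $ i $ j) / det A) else 0)"
proof (cases "det A > 0")
  case True
  then have "invertible A" by (simp add: invertible_det_nz)
  then have "A *v (pinv A *v b) = b" using True by (simp add: pinv_def matrix_vector_mul_assoc matrix_inv_mult)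
  then show ?thesis using True cramer[of A "pinv A *v b" b] by simp
qed (simp add: pinv_def)

context iid_noise
begin

abbreviation noise_path :: "'a \<Rightarrow> nat \<Rightarrow> real" where
  "noise_path \<omega> \<equiv> \<lambda>n. eps n \<omega>"

lemma ar_x_past: "(\<lambda>\<omega>. ar_x \<theta> (noise_path \<omega>) n) \<in> borel_measurable (past n)"
proof (induction n rule: less_induct)
  case (less n)
  show ?case
  proof (cases n)
    case (Suc k)
    have "(\<lambda>\<omega>. ar_x \<theta> (noise_path \<omega>) (k - (pos i - 1))) \<in> borel_measurable (past n)" for i
      by (rule past_mono[OF _ less]) (use Suc in auto)
    then show ?thesis unfolding Suc ar_x_Suc inner_vec_def ar_X_nth inner_real_def
      by (intro borel_measurable_add borel_measurable_sum borel_measurable_times borel_measurable_const)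
        (auto simp: Suc intro: eps_past)
  qed simp
qed

lemma ar_X_past: "k \<le> n \<Longrightarrow> (\<lambda>\<omega>. ar_X \<theta> (noise_path \<omega>) k) \<in> borel_measurable (past n)"
  by (rule borel_measurable_vecI) (auto simp: ar_X_nth intro: past_mono[OF _ ar_x_past])

lemma trace_ar_M_past: "(\<lambda>\<omega>. trace (ar_M \<theta> (noise_path \<omega>) n)) \<in> borel_measurable (past n)"
  unfolding trace_ar_M
  by (intro borel_measurable_sum borel_measurable_power measurable_compose[OF _ borel_measurable_norm]) (auto intro: ar_X_past)

lemma truncated_X_past: "(\<lambda>\<omega>. truncated_X \<theta> (noise_path \<omega>) H D k) \<in> borel_measurable (past k)"
proof -
  note [measurable] = ar_X_past[OF order_refl, of \<theta> k] trace_ar_M_past[of \<theta> k]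
  show ?thesis unfolding truncated_X_def by measurable
qed

lemma ar_M_measurable [measurable]: "(\<lambda>\<omega>. ar_M \<theta> (noise_path \<omega>) n) \<in> borel_measurable M"
proof (rule borel_measurable_matrixI)
  fix i j
  have [measurable]: "(\<lambda>\<omega>. ar_X \<theta> (noise_path \<omega>) k) \<in> borel_measurable M" for k
    by (rule past_measurable[OF ar_X_past[OF order_refl]])
  show "(\<lambda>\<omega>. ar_M \<theta> (noise_path \<omega>) n $ i $ j) \<in> borel_measurable M"
    unfolding ar_M_nth by measurable
qed

text \<open>The stopping time has countably many values, so the statistic is glued from its versions
  at fixed times.\<close>

lemma ar_pivot_measurable [measurable]: "(\<lambda>\<omega>. ar_pivot \<theta> (noise_path \<omega>) s h) \<in> borel_measurable M"
proof -
  have [measurable]: "(\<lambda>\<omega>. ar_X \<theta> (noise_path \<omega>) k) \<in> borel_measurable M" for k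
    by (rule past_measurable[OF ar_X_past[OF order_refl]])
  have [measurable]: "(\<lambda>\<omega>. ar_x \<theta> (noise_path \<omega>) k) \<in> borel_measurable M" for k
    by (rule past_measurable[OF ar_x_past])
  have [measurable]: "(\<lambda>\<omega>. trace (ar_M \<theta> (noise_path \<omega>) n)) \<in> borel_measurable M" for n
    by (rule past_measurable[OF trace_ar_M_past])
  have lse: "(\<lambda>\<omega>. ar_lse \<theta> (noise_path \<omega>) n) \<in> borel_measurable M" for n
  proof -
    define b where "b \<omega> = (\<Sum>k=1..n. ar_x \<theta> (noise_path \<omega>) k *\<^sub>R ar_X \<theta> (noise_path \<omega>) (k - 1))" for \<omega>
    have [measurable]: "b \<in> borel_measurable M" unfolding b_def by measurable
    note [measurable] = borel_measurable_det[OF ar_M_measurable]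
    have "(\<lambda>\<omega>. \<chi> k. det (\<chi> i j. if j = k then b \<omega> $ i else ar_M \<theta> (noise_path \<omega>) n $ i $ j)
        / det (ar_M \<theta> (noise_path \<omega>) n)) \<in> borel_measurable M"
    proof (rule borel_measurable_vecI)
      fix k
      have [measurable]: "(\<lambda>\<omega>. det (\<chi> i j. if j = k then b \<omega> $ i else ar_M \<theta> (noise_path \<omega>) n $ i $ j)) \<in> borel_measurable M"
        by (intro borel_measurable_det borel_measurable_matrixI) simp
      show "(\<lambda>\<omega>. (\<chi> k. det (\<chi> i j. if j = k then b \<omega> $ i else ar_M \<theta> (noise_path \<omega>) n $ i $ j)
        / det (ar_M \<theta> (noise_path \<omega>) n)) $ k) \<in> borel_measurable M" by simp
    qed
    then have "(\<lambda>\<omega>. pinv (ar_M \<theta> (noise_path \<omega>) n) *v b \<omega>) \<in> borel_measurable M"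
      unfolding pinv_mult by measurable
    then show ?thesis by (simp add: ar_lse_def b_def)
  qed
  have "(\<lambda>\<omega>. ar_tau \<theta> (noise_path \<omega>) s h) \<in> measurable M (count_space UNIV)"
    unfolding ar_tau_def by measurable
  then show ?thesis
    unfolding ar_pivot_def
    by (rule measurable_compose_countable[rotated])
      (intro borel_measurable_matrix_vector borel_measurable_msqrt ar_M_measurable ar_M_psd
        borel_measurable_diff lse borel_measurable_const)
qed

text \<open>The sum has deterministic length and the truncated weights do the stopping, so estimates
  for fixed length apply. On \<open>good_event\<close>, with constants balanced as in
  \<open>good_path\<close>, it equals the score stopped at tau.\<close>

definition score :: "real^'p::{finite,wellorder} \<Rightarrow> nat \<Rightarrow> real \<Rightarrow> real \<Rightarrow> 'a \<Rightarrow> real^'p::{finite,wellorder}" where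
  "score \<theta> m \<delta> h \<omega> = (\<Sum>k<m * nat \<lceil>h\<rceil> + 1. eps (Suc k) \<omega> *\<^sub>R truncated_X \<theta> (noise_path \<omega>) (h * \<sigma>\<^sup>2) (\<delta> * h) k)"

text \<open>The three pathwise requirements of \<open>good_path\<close>: small noise, threshold
  reached within the horizon, score of smaller order than h.\<close>

definition good_event :: "real^'p::{finite,wellorder} \<Rightarrow> nat \<Rightarrow> real \<Rightarrow> real \<Rightarrow> real \<Rightarrow> 'a set" where
  "good_event \<theta> m \<delta> \<eta> h = {\<omega> \<in> space M. (\<forall>k\<in>{1..m * nat \<lceil>h\<rceil> + 1}. (eps k \<omega>)\<^sup>2 \<le> \<eta> * h)
     \<and> h * \<sigma>\<^sup>2 \<le> trace (ar_M \<theta> (noise_path \<omega>) (m * nat \<lceil>h\<rceil> + 1)) \<and> norm (score \<theta> m \<delta> h \<omega>) \<le> \<delta> * h}"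

lemma score_measurable [measurable]: "score \<theta> m \<delta> h \<in> borel_measurable M"
proof -
  have [measurable]: "(\<lambda>\<omega>. truncated_X \<theta> (noise_path \<omega>) H D k) \<in> borel_measurable M" for H D k
    by (rule past_measurable[OF truncated_X_past])
  show ?thesis unfolding score_def by measurable
qed

text \<open>\<open>martingale_variance\<close> in each coordinate, with the energy bound H + D <= 2
  sigma^2 h.\<close>

lemma score_energy:
  fixes \<theta> :: "real^'p::{finite,wellorder}"
  assumes "h > 0" "0 \<le> \<delta>" "\<delta> \<le> \<sigma>\<^sup>2"
  shows "integrable M (\<lambda>\<omega>. (norm (score \<theta> m \<delta> h \<omega>))\<^sup>2)"
    "expectation (\<lambda>\<omega>. (norm (score \<theta> m \<delta> h \<omega>))\<^sup>2) \<le> CARD('p) * (2 * \<sigma>\<^sup>2 * \<sigma>\<^sup>2) * h"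
proof -
  define U where "U i k \<omega> = truncated_X \<theta> (noise_path \<omega>) (h * \<sigma>\<^sup>2) (\<delta> * h) k $ i" for i k \<omega>
  define N where "N = m * nat \<lceil>h\<rceil> + 1"
  have Up: "U i k \<in> borel_measurable (past k)" for i k
    unfolding U_def by (rule borel_measurable_vec_component[OF truncated_X_past])
  have D: "h * \<sigma>\<^sup>2 \<ge> 0" "\<delta> * h \<ge> 0" using assms by auto
  have b: "(\<Sum>k<N. (U i k \<omega>)\<^sup>2) \<le> 2 * \<sigma>\<^sup>2 * h" for i \<omega> N
  proof -
    have "(\<Sum>k<N. (U i k \<omega>)\<^sup>2) \<le> (\<Sum>k<N. (norm (truncated_X \<theta> (noise_path \<omega>) (h * \<sigma>\<^sup>2) (\<delta> * h) k))\<^sup>2)"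
    proof (rule sum_mono)
      fix k
      show "(U i k \<omega>)\<^sup>2 \<le> (norm (truncated_X \<theta> (noise_path \<omega>) (h * \<sigma>\<^sup>2) (\<delta> * h) k))\<^sup>2"
        unfolding U_def using component_le_norm_cart by (metis abs_norm_cancel abs_le_square_iff)
    qed
    also have "\<dots> \<le> h * \<sigma>\<^sup>2 + \<delta> * h" by (rule truncated_X_sum[OF D])
    also have "\<dots> \<le> 2 * \<sigma>\<^sup>2 * h" using assms mult_right_mono[of \<delta> "\<sigma>\<^sup>2" h] by simp
    finally show ?thesis .
  qed
  have comp: "score \<theta> m \<delta> h \<omega> $ i = (\<Sum>k<N. U i k \<omega> * eps (Suc k) \<omega>)" for i \<omega>
    by (simp add: score_def U_def N_def mult.commute)
  have eq: "(norm (score \<theta> m \<delta> h \<omega>))\<^sup>2 = (\<Sum>i\<in>UNIV. (\<Sum>k<N. U i k \<omega> * eps (Suc k) \<omega>)\<^sup>2)" for \<omega>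
    unfolding power2_norm_eq_inner inner_vec_def comp by (simp add: power2_eq_square)
  note mv = martingale_variance[OF Up b, of _ N]
  show "integrable M (\<lambda>\<omega>. (norm (score \<theta> m \<delta> h \<omega>))\<^sup>2)"
    unfolding eq by (intro Bochner_Integration.integrable_sum mv)
  have "expectation (\<lambda>\<omega>. (norm (score \<theta> m \<delta> h \<omega>))\<^sup>2) = (\<Sum>i\<in>UNIV. expectation (\<lambda>\<omega>. (\<Sum>k<N. U i k \<omega> * eps (Suc k) \<omega>)\<^sup>2))"
    unfolding eq by (intro Bochner_Integration.integral_sum mv)
  also have "\<dots> \<le> (\<Sum>i\<in>(UNIV::'p set). \<sigma>\<^sup>2 * (2 * \<sigma>\<^sup>2 * h))" by (intro sum_mono mv)
  finally show "expectation (\<lambda>\<omega>. (norm (score \<theta> m \<delta> h \<omega>))\<^sup>2) \<le> CARD('p) * (2 * \<sigma>\<^sup>2 * \<sigma>\<^sup>2) * h"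
    by (simp add: mult_ac)
qed

lemma score_tail:
  fixes \<theta> :: "real^'p::{finite,wellorder}"
  assumes "h > 0" "0 \<le> \<delta>" "\<delta> \<le> \<sigma>\<^sup>2" "R > 0"
  shows "prob {\<omega> \<in> space M. norm (score \<theta> m \<delta> h \<omega>) > R} \<le> CARD('p) * (2 * \<sigma>\<^sup>2 * \<sigma>\<^sup>2) * h / R\<^sup>2"
proof -
  have "prob {\<omega> \<in> space M. norm (score \<theta> m \<delta> h \<omega>) > R} \<le> prob {\<omega> \<in> space M. (norm (score \<theta> m \<delta> h \<omega>))\<^sup>2 \<ge> R\<^sup>2}"
    using assms by (intro finite_measure_mono) (auto intro!: power_mono)
  also have "\<dots> \<le> expectation (\<lambda>\<omega>. (norm (score \<theta> m \<delta> h \<omega>))\<^sup>2) / R\<^sup>2"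
    using assms by (intro integral_Markov_inequality_measure[where A = "{}"] score_energy) auto
  also have "\<dots> \<le> CARD('p) * (2 * \<sigma>\<^sup>2 * \<sigma>\<^sup>2) * h / R\<^sup>2"
    by (intro divide_right_mono score_energy assms) simp
  finally show ?thesis .
qed

lemma good_event_measurable [measurable]: "good_event \<theta> m \<delta> \<eta> h \<in> events"
proof -
  have [measurable]: "{\<omega> \<in> space M. \<forall>k\<in>{1..m * nat \<lceil>h\<rceil> + 1}. (eps k \<omega>)\<^sup>2 \<le> \<eta> * h} \<in> events"
  proof (rule sets.sets_Collect_finite_All)
    fix k assume "k \<in> {1..m * nat \<lceil>h\<rceil> + 1}"
    then have [measurable]: "eps k \<in> borel_measurable M" by (intro eps_measurable) auto
    show "{\<omega> \<in> space M. (eps k \<omega>)\<^sup>2 \<le> \<eta> * h} \<in> events" by measurable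
  qed simp
  have [measurable]: "(\<lambda>\<omega>. trace (ar_M \<theta> (noise_path \<omega>) n)) \<in> borel_measurable M" for n
    by (rule past_measurable[OF trace_ar_M_past])
  have "good_event \<theta> m \<delta> \<eta> h = {\<omega> \<in> space M. \<forall>k\<in>{1..m * nat \<lceil>h\<rceil> + 1}. (eps k \<omega>)\<^sup>2 \<le> \<eta> * h}
    \<inter> {\<omega> \<in> space M. h * \<sigma>\<^sup>2 \<le> trace (ar_M \<theta> (noise_path \<omega>) (m * nat \<lceil>h\<rceil> + 1)) \<and> norm (score \<theta> m \<delta> h \<omega>) \<le> \<delta> * h}"
    by (auto simp: good_event_def)
  also have "\<dots> \<in> events" by measurable
  finally show ?thesis .
qed

text \<open>The noise is recovered from the path as x_(k+1) - theta . X_k, so its energy bounds the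
  trace from below, uniformly over bounded sets of parameters. The time n + 1 makes the trace
  include X_n.\<close>

lemma noise_energy_le_trace:
  assumes "norm \<theta> \<le> T"
  shows "(\<Sum>k=1..n. (e k)\<^sup>2) \<le> (2 + 2 * T\<^sup>2) * trace (ar_M \<theta> e (n + 1))"
proof -
  have step: "(e (Suc k))\<^sup>2 \<le> 2 * (norm (ar_X \<theta> e (Suc k)))\<^sup>2 + 2 * T\<^sup>2 * (norm (ar_X \<theta> e k))\<^sup>2" for k
  proof -
    have "\<bar>\<theta> \<bullet> ar_X \<theta> e k\<bar> \<le> norm \<theta> * norm (ar_X \<theta> e k)" by (rule Cauchy_Schwarz_ineq2)
    also have "\<dots> \<le> T * norm (ar_X \<theta> e k)" using assms by (intro mult_right_mono) auto
    finally have "(\<theta> \<bullet> ar_X \<theta> e k)\<^sup>2 \<le> (T * norm (ar_X \<theta> e k))\<^sup>2"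
      by (metis abs_ge_zero power2_abs power_mono)
    moreover have "(ar_x \<theta> e (Suc k))\<^sup>2 \<le> (norm (ar_X \<theta> e (Suc k)))\<^sup>2"
      using abs_ar_x_le[of \<theta> e "Suc k"] by (metis abs_norm_cancel abs_le_square_iff)
    moreover have "(e (Suc k))\<^sup>2 \<le> 2 * (ar_x \<theta> e (Suc k))\<^sup>2 + 2 * (\<theta> \<bullet> ar_X \<theta> e k)\<^sup>2"
    proof -
      have "e (Suc k) = ar_x \<theta> e (Suc k) - \<theta> \<bullet> ar_X \<theta> e k" by (simp add: ar_x_Suc)
      moreover have "(a - b)\<^sup>2 \<le> 2 * a\<^sup>2 + 2 * b\<^sup>2" for a b :: real
        using zero_le_power2[of "a + b"] by (simp add: power2_sum power2_diff)
      ultimately show ?thesis by metis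
    qed
    ultimately show ?thesis by (simp add: power_mult_distrib)
  qed
  have "(\<Sum>k=1..n. (e k)\<^sup>2) = (\<Sum>k<n. (e (Suc k))\<^sup>2)"
    by (rule sum.reindex_bij_witness[of _ Suc "\<lambda>k. k - 1"]) auto
  also have "\<dots> \<le> (\<Sum>k<n. 2 * (norm (ar_X \<theta> e (Suc k)))\<^sup>2 + 2 * T\<^sup>2 * (norm (ar_X \<theta> e k))\<^sup>2)"
    by (intro sum_mono step)
  also have "\<dots> = 2 * (\<Sum>k<n. (norm (ar_X \<theta> e (Suc k)))\<^sup>2) + 2 * T\<^sup>2 * (\<Sum>k<n. (norm (ar_X \<theta> e k))\<^sup>2)"
    by (simp add: sum.distrib sum_distrib_left)
  also have "\<dots> \<le> 2 * trace (ar_M \<theta> e (n + 1)) + 2 * T\<^sup>2 * trace (ar_M \<theta> e (n + 1))"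
  proof (intro add_mono mult_left_mono)
    show "(\<Sum>k<n. (norm (ar_X \<theta> e (Suc k)))\<^sup>2) \<le> trace (ar_M \<theta> e (n + 1))"
      using sum.lessThan_Suc_shift[of "\<lambda>k. (norm (ar_X \<theta> e k))\<^sup>2" n] by (simp add: trace_ar_M)
    show "(\<Sum>k<n. (norm (ar_X \<theta> e k))\<^sup>2) \<le> trace (ar_M \<theta> e (n + 1))" by (simp add: trace_ar_M)
  qed auto
  finally show ?thesis by (simp add: distrib_right)
qed

text \<open>The complement is covered by three rare events, one per requirement. The horizon factor
  m is fixed before delta, eta and rho, since it only has to make the noise energy exceed a constant
  multiple of h.\<close>

lemma good_event_prob:
  fixes K :: "(real^'p::{finite,wellorder}) set"
  assumes K: "\<forall>\<theta>\<in>K. norm \<theta> \<le> T"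
  shows "\<exists>m. \<forall>\<delta> \<eta> \<rho>. 0 < \<delta> \<and> \<delta> \<le> \<sigma>\<^sup>2 \<and> 0 < \<eta> \<and> 0 < \<rho> \<longrightarrow>
    (\<exists>h0>0. \<forall>h\<ge>h0. \<forall>\<theta>\<in>K. prob (space M - good_event \<theta> m \<delta> \<eta> h) \<le> \<rho>)"
proof -
  define c where "c = (2 + 2 * T\<^sup>2) * \<sigma>\<^sup>2"
  have "c \<ge> 0" by (simp add: c_def)
  then obtain m where m: "\<And>h. h \<ge> 0 \<Longrightarrow> prob {\<omega> \<in> space M. (\<Sum>k=1..m * nat \<lceil>h\<rceil>. (eps k \<omega>)\<^sup>2) < c * h} \<le> exp (- h)"
    using noise_energy_lower by blast
  show ?thesis
  proof (intro exI[of _ m] allI impI)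
    fix \<delta> \<eta> \<rho> :: real assume *: "0 < \<delta> \<and> \<delta> \<le> \<sigma>\<^sup>2 \<and> 0 < \<eta> \<and> 0 < \<rho>"
    define p1 where "p1 h = prob {\<omega> \<in> space M. \<exists>k\<in>{1..m * nat \<lceil>h\<rceil> + 1}. (eps k \<omega>)\<^sup>2 > \<eta> * h}" for h
    \<comment> \<open>Chebyshev for the score at level delta h: a second moment of order h against a
      squared level of order h^2.\<close>
    define C where "C = CARD('p) * (2 * \<sigma>\<^sup>2 * \<sigma>\<^sup>2) / \<delta>\<^sup>2"
    have "((\<lambda>h. p1 h + exp (- h) + C / h) \<longlongrightarrow> 0 + 0 + 0) at_top"
    proof (intro tendsto_add)
      show "(p1 \<longlongrightarrow> 0) at_top" unfolding p1_def[abs_def] using * by (intro max_noise_small) auto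
      show "((\<lambda>h::real. exp (- h)) \<longlongrightarrow> 0) at_top"
        by (rule filterlim_compose[OF exp_at_bot filterlim_uminus_at_bot_at_top])
      show "((\<lambda>h. C / h) \<longlongrightarrow> 0) at_top" by (rule real_tendsto_divide_at_top[OF tendsto_const filterlim_ident])
    qed
    then have "\<forall>\<^sub>F h in at_top. p1 h + exp (- h) + C / h < \<rho>" using * by (intro order_tendstoD(2)) auto
    then obtain h1 where h1: "\<And>h. h \<ge> h1 \<Longrightarrow> p1 h + exp (- h) + C / h < \<rho>"
      unfolding eventually_at_top_linorder by blast
    show "\<exists>h0>0. \<forall>h\<ge>h0. \<forall>\<theta>\<in>K. prob (space M - good_event \<theta> m \<delta> \<eta> h) \<le> \<rho>"
    proof (intro exI[of _ "max 1 h1"] conjI allI impI ballI)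
      fix h \<theta> assume h: "max 1 h1 \<le> h" and \<theta>: "\<theta> \<in> K"
      let ?E1 = "{\<omega> \<in> space M. \<exists>k\<in>{1..m * nat \<lceil>h\<rceil> + 1}. (eps k \<omega>)\<^sup>2 > \<eta> * h}"
      let ?E2 = "{\<omega> \<in> space M. (\<Sum>k=1..m * nat \<lceil>h\<rceil>. (eps k \<omega>)\<^sup>2) < c * h}"
      let ?E3 = "{\<omega> \<in> space M. norm (score \<theta> m \<delta> h \<omega>) > \<delta> * h}"
      have E1: "?E1 \<in> events"
      proof (rule sets.sets_Collect_finite_Ex)
        fix k assume "k \<in> {1..m * nat \<lceil>h\<rceil> + 1}"
        then have [measurable]: "eps k \<in> borel_measurable M" by (intro eps_measurable) auto
        show "{\<omega> \<in> space M. (eps k \<omega>)\<^sup>2 > \<eta> * h} \<in> events" by measurable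
      qed simp
      have E2: "?E2 \<in> events"
      proof -
        have "(\<lambda>\<omega>. \<Sum>k=1..m * nat \<lceil>h\<rceil>. (eps k \<omega>)\<^sup>2) \<in> borel_measurable M"
          by (intro borel_measurable_sum borel_measurable_power eps_measurable) auto
        then show ?thesis by (rule borel_measurable_less[OF _ borel_measurable_const])
      qed
      have E3: "?E3 \<in> events" by measurable
      have "space M - good_event \<theta> m \<delta> \<eta> h \<subseteq> ?E1 \<union> ?E2 \<union> ?E3"
      proof
        fix \<omega> assume \<omega>: "\<omega> \<in> space M - good_event \<theta> m \<delta> \<eta> h"
        have "(\<Sum>k=1..m * nat \<lceil>h\<rceil>. (eps k \<omega>)\<^sup>2) < c * h" if "trace (ar_M \<theta> (noise_path \<omega>) (m * nat \<lceil>h\<rceil> + 1)) < h * \<sigma>\<^sup>2"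
        proof -
          have "(\<Sum>k=1..m * nat \<lceil>h\<rceil>. (eps k \<omega>)\<^sup>2) \<le> (2 + 2 * T\<^sup>2) * trace (ar_M \<theta> (noise_path \<omega>) (m * nat \<lceil>h\<rceil> + 1))"
            by (rule noise_energy_le_trace[OF K[rule_format, OF \<theta>]])
          also have "\<dots> < (2 + 2 * T\<^sup>2) * (h * \<sigma>\<^sup>2)"
            using that by (intro mult_strict_left_mono) (auto intro: add_pos_nonneg)
          finally show ?thesis by (simp add: c_def mult_ac)
        qed
        then show "\<omega> \<in> ?E1 \<union> ?E2 \<union> ?E3" using \<omega> by (auto simp: good_event_def not_le)
      qed
      then have "prob (space M - good_event \<theta> m \<delta> \<eta> h) \<le> prob (?E1 \<union> ?E2 \<union> ?E3)"
        using E1 E2 E3 by (intro finite_measure_mono) auto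
      also have "\<dots> \<le> prob (?E1 \<union> ?E2) + prob ?E3" using E1 E2 E3 by (intro measure_Un_le) auto
      also have "\<dots> \<le> prob ?E1 + prob ?E2 + prob ?E3" using E1 E2 by (intro add_right_mono measure_Un_le) auto
      also have "\<dots> \<le> p1 h + exp (- h) + C / h"
      proof (intro add_mono)
        show "prob ?E1 \<le> p1 h" by (simp add: p1_def)
        show "prob ?E2 \<le> exp (- h)" using h by (intro m) simp
        have "prob ?E3 \<le> CARD('p) * (2 * \<sigma>\<^sup>2 * \<sigma>\<^sup>2) * h / (\<delta> * h)\<^sup>2"
          using h * by (intro score_tail) auto
        then show "prob ?E3 \<le> C / h" using h * by (simp add: C_def power2_eq_square field_simps)
      qed
      also have "\<dots> \<le> \<rho>" using h1[of h] h by simp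
      finally show "prob (space M - good_event \<theta> m \<delta> \<eta> h) \<le> \<rho>" .
    qed simp
  qed
qed

text \<open>In the intended instance G approximates M_tau / h and J is its inverse square root. Only
  the properties used later are exported, so the Toeplitz matrices stay hidden.\<close>

definition pivot_approximation :: "real^'p::{finite,wellorder} \<Rightarrow> nat \<Rightarrow> real \<Rightarrow> real \<Rightarrow> real \<Rightarrow> real \<Rightarrow> real \<Rightarrow> real \<Rightarrow> bool" where
  "pivot_approximation \<theta> m \<delta> \<eta> g A C h \<longleftrightarrow> (\<exists>J G. (\<forall>z. norm (J *v z) \<le> norm z / sqrt g) \<and> (\<forall>u z. u \<bullet> (J *v z) = (J *v u) \<bullet> z)
        \<and> (\<forall>z. (J *v z) \<bullet> (G *v (J *v z)) = z \<bullet> z)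
        \<and> (\<forall>\<omega>\<in>good_event \<theta> m \<delta> \<eta> h.
            norm (ar_pivot \<theta> (noise_path \<omega>) \<sigma> h - J *v ((1 / sqrt h) *\<^sub>R score \<theta> m \<delta> h \<omega>))
              \<le> C * \<delta> * norm ((1 / sqrt h) *\<^sub>R score \<theta> m \<delta> h \<omega>)
          \<and> (\<forall>\<mu>. \<bar>(\<Sum>k<m * nat \<lceil>h\<rceil> + 1. (\<mu> \<bullet> truncated_X \<theta> (noise_path \<omega>) (h * \<sigma>\<^sup>2) (\<delta> * h) k)\<^sup>2) / h
              - \<mu> \<bullet> (G *v \<mu>)\<bar> \<le> A * \<delta> * (norm \<mu>)\<^sup>2)))"

text \<open>The order of choice matters: m, g, A and C come from K and the noise alone; then delta
  is given, the window w is taken from delta, eta from w, and h0 last.\<close>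

lemma pivot_approx:
  fixes K :: "(real^'p::{finite,wellorder}) set"
  assumes K: "compact K" "K \<subseteq> Lambda_tilde"
  shows "\<exists>m g A C. g > 0 \<and> A > 0 \<and> C > 0 \<and> (\<forall>\<delta> \<rho>. 0 < \<delta> \<and> \<delta> \<le> \<sigma>\<^sup>2 \<and> A * \<delta> \<le> g / 2 \<and> 0 < \<rho> \<longrightarrow>
    (\<exists>\<eta>. \<exists>h0>0. \<forall>h\<ge>h0. \<forall>\<theta>\<in>K. prob (space M - good_event \<theta> m \<delta> \<eta> h) \<le> \<rho> \<and>
      pivot_approximation \<theta> m \<delta> \<eta> g A C h))"
proof -
  obtain T b l c where sb: "stable_bounds K T b l c" using compact_stable_bounds[OF K] by blast
  then have pos: "l > 0" "c > 0" and T: "\<forall>\<theta>\<in>K. norm \<theta> \<le> T"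
    and c: "\<And>\<theta> m v. \<theta> \<in> K \<Longrightarrow> norm ((companion_T \<theta> ^^ m) v) \<le> c * norm v"
    and ex_r: "\<And>\<theta>. \<theta> \<in> K \<Longrightarrow> \<exists>r. yw_map \<theta> r = first_unit \<and> (\<forall>v. l * (v \<bullet> v) \<le> v \<bullet> (toeplitz r *v v))"
    by (auto simp: stable_bounds_def)
  from ar_M_close[OF sb] obtain A where A: "A > 0" and close0: "\<forall>\<theta>\<in>K. \<forall>r e n H (D::real). yw_map \<theta> r = first_unit
      \<and> (\<forall>k\<le>n. (norm (ar_X \<theta> e k))\<^sup>2 \<le> D) \<and> norm (\<Sum>k<n. e (Suc k) *\<^sub>R ar_X \<theta> e k) \<le> D
      \<and> H \<le> trace (ar_M \<theta> e n) \<and> trace (ar_M \<theta> e n) \<le> H + D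
      \<longrightarrow> norm (ar_M \<theta> e n - (H / CARD('p)) *\<^sub>R toeplitz r) \<le> A * D"
    by (elim exE conjE)
  have close: "norm (ar_M \<theta> e n - (H / CARD('p)) *\<^sub>R toeplitz r) \<le> A * D"
    if "\<theta> \<in> K" "yw_map \<theta> r = first_unit" "\<forall>k\<le>n. (norm (ar_X \<theta> e k))\<^sup>2 \<le> D"
      "norm (\<Sum>k<n. e (Suc k) *\<^sub>R ar_X \<theta> e k) \<le> D"
      "H \<le> trace (ar_M \<theta> e n)" "trace (ar_M \<theta> e n) \<le> H + D" for \<theta> r e n H D
    by (rule close0[rule_format, OF that(1)]) (intro conjI that)
  from good_event_prob[OF T] obtain m where m: "\<forall>\<delta> \<eta> \<rho>. 0 < \<delta> \<and> \<delta> \<le> \<sigma>\<^sup>2 \<and> 0 < \<eta> \<and> 0 < \<rho> \<longrightarrow>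
    (\<exists>h0>0. \<forall>h\<ge>h0. \<forall>\<theta>\<in>K. prob (space M - good_event \<theta> m \<delta> \<eta> h) \<le> \<rho>)"
    by (elim exE) (rule that)
  define g where "g = \<sigma>\<^sup>2 * l / CARD('p)"
  have g0: "g > 0" using pos \<sigma>_pos by (simp add: g_def)
  define C where "C = sqrt 2 * A / (g * sqrt g)"
  have C0: "C > 0" using A g0 by (simp add: C_def)
  show ?thesis
  proof (rule exI[of _ m], rule exI[of _ g], rule exI[of _ A], rule exI[of _ C], intro conjI allI impI g0 A C0)
    fix \<delta> \<rho> :: real assume \<delta>: "0 < \<delta> \<and> \<delta> \<le> \<sigma>\<^sup>2 \<and> A * \<delta> \<le> g / 2 \<and> 0 < \<rho>"
    \<comment> \<open>This w makes the first term of the balance condition at most delta / 2, and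
      eta, chosen after it, makes the second equal to delta / 2. The added 1 ensures w >= 1.\<close>
    obtain w :: nat where w0: "8 * c\<^sup>2 * \<sigma>\<^sup>2 / \<delta> + 1 \<le> real w" using real_arch_simple by blast
    have "8 * c\<^sup>2 * \<sigma>\<^sup>2 / \<delta> \<ge> 0" using \<delta> by simp
    then have w: "w \<ge> 1" "8 * c\<^sup>2 * \<sigma>\<^sup>2 / \<delta> \<le> real w" using w0 by linarith+
    define \<eta> where "\<eta> = \<delta> / (4 * c\<^sup>2 * (real w)\<^sup>2)"
    have \<eta>: "\<eta> > 0" using \<delta> pos w by (simp add: \<eta>_def)
    have bal: "4 * c\<^sup>2 * \<sigma>\<^sup>2 / real w + 2 * c\<^sup>2 * (real w)\<^sup>2 * \<eta> \<le> \<delta>"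
    proof -
      have "4 * c\<^sup>2 * \<sigma>\<^sup>2 / real w \<le> \<delta> / 2" using w \<delta> by (simp add: field_simps)
      moreover have "2 * c\<^sup>2 * (real w)\<^sup>2 * \<eta> = \<delta> / 2" using pos w by (simp add: \<eta>_def field_simps)
      ultimately show ?thesis by linarith
    qed
    have "\<exists>h0>0. \<forall>h\<ge>h0. \<forall>\<theta>\<in>K. prob (space M - good_event \<theta> m \<delta> \<eta> h) \<le> \<rho>"
      by (rule m[rule_format]) (use \<delta> \<eta> in simp)
    then obtain h0 where h0: "h0 > 0" "\<forall>h\<ge>h0. \<forall>\<theta>\<in>K. prob (space M - good_event \<theta> m \<delta> \<eta> h) \<le> \<rho>"
      by (elim exE conjE)
    show "\<exists>\<eta>. \<exists>h0>0. \<forall>h\<ge>h0. \<forall>\<theta>\<in>K. prob (space M - good_event \<theta> m \<delta> \<eta> h) \<le> \<rho> \<and>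
      pivot_approximation \<theta> m \<delta> \<eta> g A C h"
    proof (rule exI[of _ \<eta>], rule exI[of _ h0], intro conjI h0(1) allI impI ballI)
      fix h \<theta> assume h: "h0 \<le> h" and \<theta>: "\<theta> \<in> K"
      show "prob (space M - good_event \<theta> m \<delta> \<eta> h) \<le> \<rho>" by (rule h0(2)[rule_format, OF h \<theta>])
      obtain r where r: "yw_map \<theta> r = first_unit" "\<And>v. l * (v \<bullet> v) \<le> v \<bullet> (toeplitz r *v v)"
        using ex_r[OF \<theta>] by blast
      define G where "G = (\<sigma>\<^sup>2 / CARD('p)) *\<^sub>R toeplitz r"
      have Gg: "g * (v \<bullet> v) \<le> v \<bullet> (G *v v)" for v
        using scaled_toeplitz(1)[OF r(2), of "\<sigma>\<^sup>2 / CARD('p)" v] pos by (simp add: G_def g_def)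
      have Gpsd: "G \<in> psd_cone"
        unfolding G_def by (rule scaled_toeplitz(2)[OF r(2)]) (use pos in auto)
      note J = inverse_sqrt[OF Gpsd Gg g0]
      have path: "norm (ar_pivot \<theta> (noise_path \<omega>) \<sigma> h - matrix_inv (msqrt G) *v ((1 / sqrt h) *\<^sub>R score \<theta> m \<delta> h \<omega>))
              \<le> C * \<delta> * norm ((1 / sqrt h) *\<^sub>R score \<theta> m \<delta> h \<omega>)"
        "\<bar>(\<Sum>k<m * nat \<lceil>h\<rceil> + 1. (\<mu> \<bullet> truncated_X \<theta> (noise_path \<omega>) (h * \<sigma>\<^sup>2) (\<delta> * h) k)\<^sup>2) / h
              - \<mu> \<bullet> (G *v \<mu>)\<bar> \<le> A * \<delta> * (norm \<mu>)\<^sup>2"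
        if "\<omega> \<in> good_event \<theta> m \<delta> \<eta> h" for \<omega> \<mu>
      proof -
        have e: "(noise_path \<omega> k)\<^sup>2 \<le> \<eta> * h" if "k \<in> {1..m * nat \<lceil>h\<rceil> + 1}" for k
          using \<open>\<omega> \<in> good_event \<theta> m \<delta> \<eta> h\<close> that by (simp add: good_event_def)
        have N: "h * \<sigma>\<^sup>2 \<le> trace (ar_M \<theta> (noise_path \<omega>) (m * nat \<lceil>h\<rceil> + 1))"
          and S: "norm (\<Sum>k<m * nat \<lceil>h\<rceil> + 1. noise_path \<omega> (Suc k) *\<^sub>R truncated_X \<theta> (noise_path \<omega>) (h * \<sigma>\<^sup>2) (\<delta> * h) k) \<le> \<delta> * h"
          using that by (simp_all add: good_event_def score_def)
        have hp: "h > 0" using h h0(1) by simp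
        have \<delta>': "\<delta> \<le> \<sigma>\<^sup>2" "A * \<delta> \<le> g / 2" using \<delta> by auto
        note gp = good_path[where \<theta> = \<theta> and e = "noise_path \<omega>", OF c[OF \<theta>] r(2) close[OF \<theta> r(1)]
            pos(1) \<sigma>_pos hp A bal \<delta>'(1) w(1) less_imp_le[OF \<eta>] g_def \<delta>'(2) e N S]
        show "norm (ar_pivot \<theta> (noise_path \<omega>) \<sigma> h - matrix_inv (msqrt G) *v ((1 / sqrt h) *\<^sub>R score \<theta> m \<delta> h \<omega>))
              \<le> C * \<delta> * norm ((1 / sqrt h) *\<^sub>R score \<theta> m \<delta> h \<omega>)"
          using gp(1) unfolding G_def C_def score_def .
        show "\<bar>(\<Sum>k<m * nat \<lceil>h\<rceil> + 1. (\<mu> \<bullet> truncated_X \<theta> (noise_path \<omega>) (h * \<sigma>\<^sup>2) (\<delta> * h) k)\<^sup>2) / h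
              - \<mu> \<bullet> (G *v \<mu>)\<bar> \<le> A * \<delta> * (norm \<mu>)\<^sup>2"
          using gp(2) unfolding G_def .
      qed
      show "pivot_approximation \<theta> m \<delta> \<eta> g A C h"
        unfolding pivot_approximation_def
        by (rule exI[of _ "matrix_inv (msqrt G)"], rule exI[of _ G], intro conjI allI ballI J path)
    qed
  qed
qed

end

section \<open>Characteristic functions, tightness and the uniform limit\<close>

lemma iexp_lipschitz: "cmod (iexp x - iexp y) \<le> \<bar>x - y\<bar>"
proof -
  have "iexp x - iexp y = iexp y * (iexp (x - y) - 1)"
    by (simp add: right_diff_distrib exp_add[symmetric])
  also have "cmod \<dots> = cmod (iexp (x - y) - 1)" by (simp only: norm_mult norm_exp_i_times mult_1)
  also have "\<dots> \<le> \<bar>x - y\<bar>" using iexp_approx1[of "x - y" 0] by simp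
  finally show ?thesis .
qed

lemma exp_lipschitz:
  assumes "a \<le> c" "b \<le> (c::real)"
  shows "\<bar>exp a - exp b\<bar> \<le> exp c * \<bar>a - b\<bar>"
proof -
  have *: "exp u - exp v \<le> exp c * (u - v)" if "v \<le> u" "u \<le> c" for u v :: real
  proof -
    have "exp u - exp v = exp u * (1 - exp (v - u))" by (simp add: right_diff_distrib exp_add[symmetric])
    also have "\<dots> \<le> exp u * (u - v)"
    proof (rule mult_left_mono)
      show "1 - exp (v - u) \<le> u - v" using exp_ge_add_one_self[of "v - u"] by linarith
    qed simp
    also have "\<dots> \<le> exp c * (u - v)" using that by (intro mult_right_mono) auto
    finally show ?thesis .
  qed
  show ?thesis
  proof (cases "b \<le> a")
    case True
    then show ?thesis using *[of b a] assms by simp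
  next
    case False
    then show ?thesis using *[of a b] assms by (simp add: abs_minus_commute abs_if)
  qed
qed

text \<open>Merges finitely many smallness requirements on delta, each linear, into one
  choice.\<close>

lemma ex_small_delta:
  fixes B :: "(real \<times> real) set"
  assumes "finite B" "\<And>a y. (a, y) \<in> B \<Longrightarrow> y > 0"
  shows "\<exists>\<delta>>0. \<forall>(a, y)\<in>B. a * \<delta> \<le> y"
proof -
  have "\<forall>\<^sub>F \<delta> in at_right 0. \<forall>x\<in>B. fst x * \<delta> < snd x"
  proof (intro eventually_ball_finite[OF assms(1)] ballI)
    fix x assume "x \<in> B"
    have "((\<lambda>\<delta>. fst x * \<delta>) \<longlongrightarrow> fst x * 0) (at_right 0)" by (intro tendsto_intros)
    then show "\<forall>\<^sub>F \<delta> in at_right 0. fst x * \<delta> < snd x"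
      using assms(2)[of "fst x" "snd x"] \<open>x \<in> B\<close> by (intro order_tendstoD(2)) auto
  qed
  moreover have "\<forall>\<^sub>F \<delta> in at_right (0::real). \<delta> > 0" by (rule eventually_at_right_less)
  ultimately have "\<forall>\<^sub>F \<delta> in at_right 0. \<delta> > 0 \<and> (\<forall>x\<in>B. fst x * \<delta> < snd x)" by (rule eventually_conj[rotated])
  then obtain \<delta> where "\<delta> > 0" "\<forall>x\<in>B. fst x * \<delta> < snd x"
    using eventually_happens'[OF trivial_limit_at_right_real] by blast
  then show ?thesis by (force simp: case_prod_beta)
qed

context iid_noise
begin

text \<open>Three comparisons: (a) the mean of exp (i S + V) is near 1, (b) V may be exchanged for
  its limit q, (c) the pivot may be exchanged for J Z. On the bad event the integrands are merely
  bounded, which its small probability pays for.\<close>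

lemma pivot_char:
  fixes K :: "(real^'p::{finite,wellorder}) set" and v :: "real^'p::{finite,wellorder}"
  assumes K: "compact K" "K \<subseteq> Lambda_tilde" and "\<epsilon> > 0"
  shows "\<exists>h0. \<forall>h\<ge>h0. \<forall>\<theta>\<in>K. cmod ((\<integral>\<omega>. iexp (v \<bullet> ((1 / \<sigma>) *\<^sub>R ar_pivot \<theta> (noise_path \<omega>) \<sigma> h)) \<partial>M)
    - complex_of_real (exp (- (v \<bullet> v) / 2))) < \<epsilon>"
proof -
  from pivot_approx[OF K] obtain m g A C where g: "g > 0" and A: "A > 0" and C: "C > 0"
    and approx: "\<forall>\<delta> \<rho>. 0 < \<delta> \<and> \<delta> \<le> \<sigma>\<^sup>2 \<and> A * \<delta> \<le> g / 2 \<and> 0 < \<rho> \<longrightarrow>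
    (\<exists>\<eta>. \<exists>h0>0. \<forall>h\<ge>h0. \<forall>\<theta>\<in>K. prob (space M - good_event \<theta> m \<delta> \<eta> h) \<le> \<rho> \<and>
      pivot_approximation \<theta> m \<delta> \<eta> g A C h)"
    by (elim exE conjE)
  define q where "q = v \<bullet> v / 2"
  \<comment> \<open>Bounds the norm of the direction J v / sigma on which the score is projected,
    for all parameters at once.\<close>
  define m0 where "m0 = norm v / (\<sigma> * sqrt g)"
  have m0: "m0 \<ge> 0" using g \<sigma>_pos by (simp add: m0_def)
  \<comment> \<open>Energy of the projected weights: H + D <= 2 sigma^2 h, divided by h.\<close>
  define B where "B = m0\<^sup>2 * (2 * \<sigma>\<^sup>2)"
  have B: "B \<ge> 0" by (simp add: B_def)
  \<comment> \<open>Bounds both exp V and exp q on every path, the bad ones included.\<close>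
  define E where "E = exp (\<sigma>\<^sup>2 / 2 * B + q)"
  have q0: "q \<ge> 0" by (simp add: q_def)
  have E1: "E \<ge> 1" "exp (\<sigma>\<^sup>2 / 2 * B) \<le> E" using B q0 by (auto simp: E_def)
  define r where "r = \<epsilon> / (5 * (E * B + 1))"
  have EB: "E * B + 1 > 0" using E1 B by (simp add: add_nonneg_pos)
  have r: "r > 0" using \<open>\<epsilon> > 0\<close> EB by (simp add: r_def)
  obtain \<eta>r where \<eta>r: "\<eta>r > 0" "\<And>u. \<bar>u\<bar> \<le> \<eta>r \<Longrightarrow> cmod (char noise u - exp (- (\<sigma>\<^sup>2 * u\<^sup>2 / 2))) \<le> r * u\<^sup>2"
    using char_noise_small[OF r] by blast
  define s where "s = norm v / \<sigma>"
  have s: "s \<ge> 0" using \<sigma>_pos by (simp add: s_def)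
  define P where "P = real CARD('p)"
  define Q where "Q = 1 + P * (2 * \<sigma>\<^sup>2 * \<sigma>\<^sup>2)"
  \<comment> \<open>In order: the two conditions of \<open>pivot_approx\<close>, weights within the
    range of \<open>char_noise_small\<close>, error of replacing the pivot by J Z, error of
    replacing V by q.\<close>
  have "\<exists>\<delta>>0. \<forall>(a, y)\<in>{(1, \<sigma>\<^sup>2), (A, g / 2), (m0\<^sup>2, \<eta>r\<^sup>2), (s * C * Q, \<epsilon> / 5), (E * (\<sigma>\<^sup>2 / 2 * (A * m0\<^sup>2)), \<epsilon> / 5)}. a * \<delta> \<le> y"
    by (rule ex_small_delta) (use \<sigma>_pos g \<eta>r \<open>\<epsilon> > 0\<close> in auto)
  then obtain \<delta> where \<delta>: "\<delta> > 0" "\<delta> \<le> \<sigma>\<^sup>2" "A * \<delta> \<le> g / 2" "m0\<^sup>2 * \<delta> \<le> \<eta>r\<^sup>2"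
    "s * C * Q * \<delta> \<le> \<epsilon> / 5" "E * (\<sigma>\<^sup>2 / 2 * (A * m0\<^sup>2)) * \<delta> \<le> \<epsilon> / 5" by auto
  \<comment> \<open>The bad event costs 2 rho in comparison (c) and E rho in comparison (b),
    together eps / 5.\<close>
  define \<rho> where "\<rho> = \<epsilon> / (5 * (2 + E))"
  have \<rho>: "\<rho> > 0" using \<open>\<epsilon> > 0\<close> E1 by (simp add: \<rho>_def)
  have "\<exists>\<eta>. \<exists>h0>0. \<forall>h\<ge>h0. \<forall>\<theta>\<in>K. prob (space M - good_event \<theta> m \<delta> \<eta> h) \<le> \<rho> \<and> pivot_approximation \<theta> m \<delta> \<eta> g A C h"
    by (rule approx[rule_format]) (use \<delta> \<rho> in simp)
  then obtain \<eta> h0 where h0: "h0 > 0"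
    and good: "\<forall>h\<ge>h0. \<forall>\<theta>\<in>K. prob (space M - good_event \<theta> m \<delta> \<eta> h) \<le> \<rho> \<and> pivot_approximation \<theta> m \<delta> \<eta> g A C h"
    by (elim exE conjE)
  show ?thesis
  proof (rule exI[of _ h0], intro allI impI ballI)
    fix h \<theta> assume h: "h0 \<le> h" and \<theta>: "\<theta> \<in> K"
    have hp: "h > 0" using h h0 by simp
    define bad where "bad = space M - good_event \<theta> m \<delta> \<eta> h"
    define N where "N = m * nat \<lceil>h\<rceil> + 1"
    define U where "U k \<omega> = truncated_X \<theta> (noise_path \<omega>) (h * \<sigma>\<^sup>2) (\<delta> * h) k" for k \<omega>
    define Z where "Z \<omega> = (1 / sqrt h) *\<^sub>R score \<theta> m \<delta> h \<omega>" for \<omega>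
    define W where "W \<omega> = ar_pivot \<theta> (noise_path \<omega>) \<sigma> h" for \<omega>
    note gd = good[rule_format, OF h \<theta>, folded bad_def]
    have bad: "prob bad \<le> \<rho>" using gd by blast
    from gd have "pivot_approximation \<theta> m \<delta> \<eta> g A C h" ..
    then obtain J G where J: "\<forall>z. norm (J *v z) \<le> norm z / sqrt g" "\<forall>u z. u \<bullet> (J *v z) = (J *v u) \<bullet> z"
        "\<forall>z. (J *v z) \<bullet> (G *v (J *v z)) = z \<bullet> z"
      and path0: "\<forall>\<omega>\<in>good_event \<theta> m \<delta> \<eta> h. norm (W \<omega> - J *v Z \<omega>) \<le> C * \<delta> * norm (Z \<omega>)
        \<and> (\<forall>\<mu>. \<bar>(\<Sum>k<N. (\<mu> \<bullet> U k \<omega>)\<^sup>2) / h - \<mu> \<bullet> (G *v \<mu>)\<bar> \<le> A * \<delta> * (norm \<mu>)\<^sup>2)"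
      unfolding pivot_approximation_def Z_def[symmetric] W_def[symmetric] N_def[symmetric] U_def[symmetric]
      by (elim exE conjE)
    note J = J[rule_format]
    have path: "norm (W \<omega> - J *v Z \<omega>) \<le> C * \<delta> * norm (Z \<omega>)"
        "\<bar>(\<Sum>k<N. (\<mu> \<bullet> U k \<omega>)\<^sup>2) / h - \<mu> \<bullet> (G *v \<mu>)\<bar> \<le> A * \<delta> * (norm \<mu>)\<^sup>2"
      if "\<omega> \<in> space M" "\<omega> \<notin> bad" for \<omega> \<mu>
      using path0 that by (auto simp: bad_def)
    have [measurable]: "bad \<in> events" unfolding bad_def by measurable
    have [measurable]: "Z \<in> borel_measurable M" unfolding Z_def by measurable
    have [measurable]: "W \<in> borel_measurable M" unfolding W_def by measurable
    define \<mu> where "\<mu> = (1 / \<sigma>) *\<^sub>R (J *v v)"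
    have n\<mu>: "norm \<mu> \<le> m0"
      using J(1)[of v] \<sigma>_pos g by (simp add: \<mu>_def m0_def field_simps)
    have n\<mu>2: "(norm \<mu>)\<^sup>2 \<le> m0\<^sup>2" using n\<mu> by (intro power_mono) auto
    \<comment> \<open>Since J G J is the identity, V tends to q whatever G is.\<close>
    have \<mu>G: "\<mu> \<bullet> (G *v \<mu>) = 2 * q / \<sigma>\<^sup>2"
      using J(3)[of v] by (simp add: \<mu>_def q_def matrix_vector_mult_scaleR power2_eq_square)
    define u where "u k \<omega> = \<mu> \<bullet> U k \<omega> / sqrt h" for k \<omega>
    have up: "u k \<in> borel_measurable (past k)" for k
    proof -
      note [measurable] = truncated_X_past[of \<theta> "h * \<sigma>\<^sup>2" "\<delta> * h" k]
      show ?thesis unfolding u_def U_def by measurable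
    qed
    note [measurable] = past_measurable[OF up]
    have u2: "(u k \<omega>)\<^sup>2 \<le> m0\<^sup>2 * (norm (U k \<omega>))\<^sup>2 / h" for k \<omega>
    proof -
      have "\<bar>\<mu> \<bullet> U k \<omega>\<bar> \<le> norm \<mu> * norm (U k \<omega>)" by (rule Cauchy_Schwarz_ineq2)
      also have "\<dots> \<le> m0 * norm (U k \<omega>)" by (intro mult_right_mono n\<mu>) simp
      finally have "(\<mu> \<bullet> U k \<omega>)\<^sup>2 \<le> (m0 * norm (U k \<omega>))\<^sup>2"
        by (metis abs_ge_zero power2_abs power_mono)
      then show ?thesis using hp by (simp add: u_def power_divide power_mult_distrib divide_right_mono)
    qed
    have D: "0 \<le> h * \<sigma>\<^sup>2" "0 \<le> \<delta> * h" using hp \<delta>(1) by auto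
    have uB: "(\<Sum>k<n. (u k \<omega>)\<^sup>2) \<le> B" for n \<omega>
    proof -
      have "(\<Sum>k<n. (u k \<omega>)\<^sup>2) \<le> (\<Sum>k<n. m0\<^sup>2 / h * (norm (U k \<omega>))\<^sup>2)" using u2 by (intro sum_mono) simp
      also have "\<dots> = m0\<^sup>2 / h * (\<Sum>k<n. (norm (U k \<omega>))\<^sup>2)" by (simp add: sum_distrib_left)
      also have "\<dots> \<le> m0\<^sup>2 / h * (h * \<sigma>\<^sup>2 + \<delta> * h)"
        unfolding U_def using hp by (intro mult_left_mono truncated_X_sum D) simp
      also have "\<dots> = m0\<^sup>2 * (\<sigma>\<^sup>2 + \<delta>)" using hp by (simp add: field_simps)
      also have "\<dots> \<le> B" unfolding B_def using \<delta>(2) by (intro mult_left_mono) auto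
      finally show ?thesis .
    qed
    have us: "\<bar>u k \<omega>\<bar> \<le> \<eta>r" for k \<omega>
    proof -
      have "(u k \<omega>)\<^sup>2 \<le> m0\<^sup>2 * (\<delta> * h) / h"
        unfolding U_def
        by (rule order_trans[OF u2[unfolded U_def]]) (use hp D in \<open>intro divide_right_mono mult_left_mono truncated_X_bound, auto\<close>)
      also have "\<dots> \<le> \<eta>r\<^sup>2" using \<delta>(4) hp by simp
      finally show ?thesis using \<eta>r(1) by (simp add: abs_le_square_iff[symmetric])
    qed
    define S where "S \<omega> = (\<Sum>k<N. u k \<omega> * eps (Suc k) \<omega>)" for \<omega>
    define V where "V \<omega> = \<sigma>\<^sup>2 / 2 * (\<Sum>k<N. (u k \<omega>)\<^sup>2)" for \<omega>
    have [measurable]: "S \<in> borel_measurable M" "V \<in> borel_measurable M" unfolding S_def V_def by measurable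
    have "score \<theta> m \<delta> h \<omega> = (\<Sum>k<N. eps (Suc k) \<omega> *\<^sub>R U k \<omega>)" for \<omega>
      by (simp only: score_def U_def N_def)
    then have SZ: "S \<omega> = \<mu> \<bullet> Z \<omega>" for \<omega>
      by (simp add: S_def Z_def u_def inner_sum_right sum_divide_distrib mult.commute)
    have VB: "V \<omega> \<le> \<sigma>\<^sup>2 / 2 * B" for \<omega> unfolding V_def by (intro mult_left_mono uB) simp
    have Vq: "\<bar>V \<omega> - q\<bar> \<le> \<sigma>\<^sup>2 / 2 * (A * \<delta> * m0\<^sup>2)" if "\<omega> \<in> space M" "\<omega> \<notin> bad" for \<omega>
    proof -
      define d where "d = (\<Sum>k<N. (\<mu> \<bullet> U k \<omega>)\<^sup>2) / h - \<mu> \<bullet> (G *v \<mu>)"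
      have "(\<Sum>k<N. (u k \<omega>)\<^sup>2) = (\<Sum>k<N. (\<mu> \<bullet> U k \<omega>)\<^sup>2) / h"
        using hp by (simp add: u_def power_divide sum_divide_distrib)
      then have "V \<omega> - q = \<sigma>\<^sup>2 / 2 * d"
        unfolding d_def \<mu>G V_def using \<sigma>_pos by (simp add: right_diff_distrib)
      then have Vd: "\<bar>V \<omega> - q\<bar> = \<sigma>\<^sup>2 / 2 * \<bar>d\<bar>" by (simp only: abs_mult) simp
      have "\<bar>d\<bar> \<le> A * \<delta> * (norm \<mu>)\<^sup>2" unfolding d_def by (rule path(2)[OF that])
      also have "\<dots> \<le> A * \<delta> * m0\<^sup>2" using A \<delta> by (intro mult_left_mono n\<mu>2) auto
      finally show ?thesis unfolding Vd by (intro mult_left_mono) auto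
    qed
    have int_exp: "integrable M (\<lambda>\<omega>. exp (\<i> * S \<omega> + V \<omega>))"
      using VB by (intro integrable_const_bound[of _ "exp (\<sigma>\<^sup>2 / 2 * B)"]) auto
    have bad_space: "bad \<inter> space M = bad" by (auto simp: bad_def)
    have int_bad: "integrable M (indicator bad :: 'a \<Rightarrow> real)"
      by (intro integrable_const_bound[of _ 1]) auto
    note integrable_intros = integrable_norm Bochner_Integration.integrable_diff
      Bochner_Integration.integrable_add integrable_mult_right integrable_const
    have int_S: "integrable M (\<lambda>\<omega>. iexp (S \<omega>))" by (intro integrable_const_bound[of _ 1]) auto
    have a: "cmod ((\<integral>\<omega>. exp (\<i> * S \<omega> + V \<omega>) \<partial>M) - 1) \<le> \<epsilon> / 5"
    proof -
      have "cmod ((\<integral>\<omega>. exp (\<i> * S \<omega> + V \<omega>) \<partial>M) - 1) \<le> exp (\<sigma>\<^sup>2 / 2 * B) * r * B"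
        unfolding S_def V_def by (rule martingale_char[OF up uB us \<eta>r(2)]) (use r in auto)
      also have "\<dots> \<le> E * r * B" using E1 r B by (intro mult_right_mono) auto
      also have "\<dots> = r * (E * B)" by simp
      also have "\<dots> \<le> r * (E * B + 1)" using r by simp
      also have "\<dots> = \<epsilon> / 5" using EB by (simp add: r_def field_simps)
      finally show ?thesis .
    qed
    have b: "cmod (exp q * (\<integral>\<omega>. iexp (S \<omega>) \<partial>M) - (\<integral>\<omega>. exp (\<i> * S \<omega> + V \<omega>) \<partial>M)) \<le> E * \<rho> + \<epsilon> / 5"
    proof -
      have "exp q * (\<integral>\<omega>. iexp (S \<omega>) \<partial>M) - (\<integral>\<omega>. exp (\<i> * S \<omega> + V \<omega>) \<partial>M)
        = (\<integral>\<omega>. exp q * iexp (S \<omega>) - exp (\<i> * S \<omega> + V \<omega>) \<partial>M)"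
        using int_S int_exp by simp
      also have "cmod \<dots> \<le> (\<integral>\<omega>. E * indicator bad \<omega> + \<epsilon> / 5 \<partial>M)"
      proof (rule order_trans[OF integral_norm_bound integral_mono])
        fix \<omega> assume \<omega>: "\<omega> \<in> space M"
        have "exp q * iexp (S \<omega>) - exp (\<i> * S \<omega> + V \<omega>) = iexp (S \<omega>) * complex_of_real (exp q - exp (V \<omega>))"
          by (simp add: exp_add right_diff_distrib mult.commute exp_of_real)
        then have n: "cmod (exp q * iexp (S \<omega>) - exp (\<i> * S \<omega> + V \<omega>)) = \<bar>exp q - exp (V \<omega>)\<bar>"
          by (simp only: norm_mult norm_exp_i_times norm_of_real mult_1)
        show "cmod (exp q * iexp (S \<omega>) - exp (\<i> * S \<omega> + V \<omega>)) \<le> E * indicator bad \<omega> + \<epsilon> / 5"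
        proof (cases "\<omega> \<in> bad")
          case True
          have "exp q \<le> E" "exp (V \<omega>) \<le> E" "0 < exp q" "0 < exp (V \<omega>)"
            using VB[of \<omega>] B q0 by (auto simp: E_def intro: order_trans)
          then have "\<bar>exp q - exp (V \<omega>)\<bar> \<le> E" by linarith
          then show ?thesis using True n \<open>\<epsilon> > 0\<close> by simp
        next
          case False
          have "\<bar>exp q - exp (V \<omega>)\<bar> \<le> E * \<bar>q - V \<omega>\<bar>" unfolding E_def
            by (rule exp_lipschitz) (use VB[of \<omega>] B q0 in auto)
          also have "\<dots> \<le> E * (\<sigma>\<^sup>2 / 2 * (A * \<delta> * m0\<^sup>2))"
            using Vq[OF \<omega> False] E1 by (intro mult_left_mono) (auto simp: abs_minus_commute)
          also have "\<dots> \<le> \<epsilon> / 5" using \<delta>(6) by (simp add: mult_ac)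
          finally show ?thesis using n False by simp
        qed
      qed (intro integrable_intros int_S int_exp int_bad)+
      also have "\<dots> = E * prob bad + \<epsilon> / 5" using int_bad by (simp add: prob_space bad_space)
      also have "\<dots> \<le> E * \<rho> + \<epsilon> / 5" using bad E1 by simp
      finally show ?thesis .
    qed
    have c: "cmod ((\<integral>\<omega>. iexp (v \<bullet> ((1 / \<sigma>) *\<^sub>R W \<omega>)) \<partial>M) - (\<integral>\<omega>. iexp (S \<omega>) \<partial>M)) \<le> 2 * \<rho> + \<epsilon> / 5"
    proof -
      have eZ: "integrable M (\<lambda>\<omega>. (norm (Z \<omega>))\<^sup>2)" "expectation (\<lambda>\<omega>. (norm (Z \<omega>))\<^sup>2) \<le> P * (2 * \<sigma>\<^sup>2 * \<sigma>\<^sup>2)"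
      proof -
        have Z2: "(norm (Z \<omega>))\<^sup>2 = (norm (score \<theta> m \<delta> h \<omega>))\<^sup>2 / h" for \<omega>
          using hp by (simp add: Z_def power_mult_distrib power_divide)
        note se = score_energy[OF hp less_imp_le[OF \<delta>(1)] \<delta>(2), of \<theta> m]
        show "integrable M (\<lambda>\<omega>. (norm (Z \<omega>))\<^sup>2)" unfolding Z2 using se(1) by simp
        show "expectation (\<lambda>\<omega>. (norm (Z \<omega>))\<^sup>2) \<le> P * (2 * \<sigma>\<^sup>2 * \<sigma>\<^sup>2)"
          unfolding Z2 using se(2) hp by (simp add: P_def pos_divide_le_eq)
      qed
      have int_W: "integrable M (\<lambda>\<omega>. iexp (v \<bullet> ((1 / \<sigma>) *\<^sub>R W \<omega>)))"
        by (intro integrable_const_bound[of _ 1]) auto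
      have "(\<integral>\<omega>. iexp (v \<bullet> ((1 / \<sigma>) *\<^sub>R W \<omega>)) \<partial>M) - (\<integral>\<omega>. iexp (S \<omega>) \<partial>M)
        = (\<integral>\<omega>. iexp (v \<bullet> ((1 / \<sigma>) *\<^sub>R W \<omega>)) - iexp (S \<omega>) \<partial>M)"
        using int_S int_W by simp
      also have "cmod \<dots> \<le> (\<integral>\<omega>. 2 * indicator bad \<omega> + s * C * \<delta> * (1 + (norm (Z \<omega>))\<^sup>2) \<partial>M)"
      proof (rule order_trans[OF integral_norm_bound integral_mono])
        fix \<omega> assume \<omega>: "\<omega> \<in> space M"
        have nn: "0 \<le> s * C * \<delta> * (1 + (norm (Z \<omega>))\<^sup>2)" using s C \<delta>(1) by simp
        show "cmod (iexp (v \<bullet> ((1 / \<sigma>) *\<^sub>R W \<omega>)) - iexp (S \<omega>)) \<le> 2 * indicator bad \<omega> + s * C * \<delta> * (1 + (norm (Z \<omega>))\<^sup>2)"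
        proof (cases "\<omega> \<in> bad")
          case True
          have "cmod (iexp (v \<bullet> ((1 / \<sigma>) *\<^sub>R W \<omega>)) - iexp (S \<omega>)) \<le> 1 + 1"
            by (rule order_trans[OF norm_triangle_ineq4]) (simp only: norm_exp_i_times order_refl)
          then show ?thesis using nn True by simp
        next
          case False
          have "S \<omega> = v \<bullet> ((1 / \<sigma>) *\<^sub>R (J *v Z \<omega>))" by (simp add: SZ \<mu>_def J(2))
          then have "v \<bullet> ((1 / \<sigma>) *\<^sub>R W \<omega>) - S \<omega> = (1 / \<sigma>) * (v \<bullet> (W \<omega> - J *v Z \<omega>))"
            by (simp add: inner_diff_right diff_divide_distrib)
          then have "\<bar>v \<bullet> ((1 / \<sigma>) *\<^sub>R W \<omega>) - S \<omega>\<bar> = (1 / \<sigma>) * \<bar>v \<bullet> (W \<omega> - J *v Z \<omega>)\<bar>"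
            using \<sigma>_pos by (simp add: abs_mult)
          also have "\<dots> \<le> (1 / \<sigma>) * (norm v * (C * \<delta> * norm (Z \<omega>)))"
            using \<sigma>_pos path(1)[OF \<omega> False]
            by (intro mult_left_mono order_trans[OF Cauchy_Schwarz_ineq2]) auto
          also have "\<dots> = s * C * \<delta> * norm (Z \<omega>)" by (simp add: s_def)
          \<comment> \<open>Passing to 1 + |Z|^2 lets the second moment of the score
            suffice.\<close>
          also have "\<dots> \<le> s * C * \<delta> * (1 + (norm (Z \<omega>))\<^sup>2)"
          proof (rule mult_left_mono)
            have "0 \<le> (norm (Z \<omega>) - 1)\<^sup>2 + (norm (Z \<omega>))\<^sup>2 + 1" by simp
            then show "norm (Z \<omega>) \<le> 1 + (norm (Z \<omega>))\<^sup>2" by (simp add: power2_diff)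
          qed (use s C \<delta>(1) in simp)
          finally have "cmod (iexp (v \<bullet> ((1 / \<sigma>) *\<^sub>R W \<omega>)) - iexp (S \<omega>)) \<le> s * C * \<delta> * (1 + (norm (Z \<omega>))\<^sup>2)"
            by (rule order_trans[OF iexp_lipschitz])
          moreover have "indicator bad \<omega> = (0::real)" using False by simp
          ultimately show ?thesis by (simp only: mult_zero_right add_0)
        qed
      qed (intro integrable_intros int_S int_W int_bad eZ(1))+
      also have "\<dots> = 2 * prob bad + s * C * \<delta> * (1 + expectation (\<lambda>\<omega>. (norm (Z \<omega>))\<^sup>2))"
        using eZ(1) int_bad by (simp add: prob_space bad_space)
      also have "\<dots> \<le> 2 * \<rho> + s * C * \<delta> * Q"
        unfolding Q_def using bad eZ(2) s C \<delta>(1) by (intro add_mono mult_left_mono) auto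
      also have "s * C * \<delta> * Q \<le> \<epsilon> / 5" using \<delta>(5) by (simp add: mult_ac)
      finally show ?thesis by simp
    qed
    have d: "cmod ((\<integral>\<omega>. iexp (S \<omega>) \<partial>M) - complex_of_real (exp (- q))) \<le> E * \<rho> + 2 * \<epsilon> / 5"
    proof -
      define I where "I = (\<integral>\<omega>. iexp (S \<omega>) \<partial>M)"
      \<comment> \<open>As q >= 0, multiplying back by exp (- q) only shrinks the error.\<close>
      have "I - complex_of_real (exp (- q)) = exp (- q) * (exp q * I - 1)"
        by (simp add: right_diff_distrib mult.assoc[symmetric] of_real_mult[symmetric] exp_add[symmetric] del: of_real_mult)
      then have "cmod (I - complex_of_real (exp (- q))) = exp (- q) * cmod (exp q * I - 1)"
        by (simp add: norm_mult)
      also have "\<dots> \<le> 1 * cmod (exp q * I - 1)" using q0 by (intro mult_right_mono) auto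
      also have "\<dots> = cmod ((exp q * I - (\<integral>\<omega>. exp (\<i> * S \<omega> + V \<omega>) \<partial>M)) + ((\<integral>\<omega>. exp (\<i> * S \<omega> + V \<omega>) \<partial>M) - 1))"
        by simp
      also have "\<dots> \<le> (E * \<rho> + \<epsilon> / 5) + \<epsilon> / 5"
        unfolding I_def by (rule norm_triangle_mono[OF b a])
      finally show ?thesis by (simp add: I_def)
    qed
    have "cmod ((\<integral>\<omega>. iexp (v \<bullet> ((1 / \<sigma>) *\<^sub>R W \<omega>)) \<partial>M) - complex_of_real (exp (- q)))
      \<le> (2 * \<rho> + \<epsilon> / 5) + (E * \<rho> + 2 * \<epsilon> / 5)"
      using norm_triangle_mono[OF c d] by simp
    also have "\<dots> = (2 + E) * \<rho> + 3 * \<epsilon> / 5" by (simp add: algebra_simps)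
    also have "(2 + E) * \<rho> = \<epsilon> / 5" using E1 by (simp add: \<rho>_def divide_simps)
    also have "\<epsilon> / 5 + 3 * \<epsilon> / 5 < \<epsilon>" using \<open>\<epsilon> > 0\<close> by simp
    finally show "cmod ((\<integral>\<omega>. iexp (v \<bullet> ((1 / \<sigma>) *\<^sub>R ar_pivot \<theta> (noise_path \<omega>) \<sigma> h)) \<partial>M)
        - complex_of_real (exp (- (v \<bullet> v) / 2))) < \<epsilon>"
      by (simp add: W_def q_def)
  qed
qed

text \<open>On the good event the pivot is at most a constant times the normalised score, whose
  second moment is bounded; Chebyshev does the rest. Here delta is one admissible value for all
  error levels.\<close>

lemma pivot_tight:
  fixes K :: "(real^'p::{finite,wellorder}) set"
  assumes K: "compact K" "K \<subseteq> Lambda_tilde" and "\<epsilon> > 0"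
  shows "\<exists>R h0. \<forall>h\<ge>h0. \<forall>\<theta>\<in>K. prob {\<omega> \<in> space M. norm ((1 / \<sigma>) *\<^sub>R ar_pivot \<theta> (noise_path \<omega>) \<sigma> h) > R} \<le> \<epsilon>"
proof -
  from pivot_approx[OF K] obtain m g A C where g: "g > 0" and A: "A > 0" and C: "C > 0"
    and approx: "\<forall>\<delta> \<rho>. 0 < \<delta> \<and> \<delta> \<le> \<sigma>\<^sup>2 \<and> A * \<delta> \<le> g / 2 \<and> 0 < \<rho> \<longrightarrow>
    (\<exists>\<eta>. \<exists>h0>0. \<forall>h\<ge>h0. \<forall>\<theta>\<in>K. prob (space M - good_event \<theta> m \<delta> \<eta> h) \<le> \<rho> \<and>
      pivot_approximation \<theta> m \<delta> \<eta> g A C h)"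
    by (elim exE conjE)
  define \<delta> where "\<delta> = min (\<sigma>\<^sup>2) (g / (2 * A))"
  have \<delta>: "\<delta> > 0" "\<delta> \<le> \<sigma>\<^sup>2" using g A \<sigma>_pos by (auto simp: \<delta>_def)
  have "\<delta> \<le> g / (2 * A)" by (simp add: \<delta>_def)
  then have A\<delta>: "A * \<delta> \<le> g / 2" using A by (simp add: field_simps)
  define c where "c = (1 / sqrt g + C * \<delta>) / \<sigma>"
  have c: "c > 0" using g C \<delta> \<sigma>_pos by (simp add: c_def add_pos_pos)
  define Q where "Q = real CARD('p) * (2 * \<sigma>\<^sup>2 * \<sigma>\<^sup>2)"
  have Q: "Q > 0" using \<sigma>_pos by (simp add: Q_def)
  \<comment> \<open>Chebyshev then gives Q / L^2 = eps / 2; the other half is left for the bad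
    event.\<close>
  define L where "L = sqrt (2 * Q / \<epsilon>)"
  have L: "L > 0" "L\<^sup>2 = 2 * Q / \<epsilon>" using Q \<open>\<epsilon> > 0\<close> by (simp_all add: L_def)
  have "\<exists>\<eta>. \<exists>h0>0. \<forall>h\<ge>h0. \<forall>\<theta>\<in>K. prob (space M - good_event \<theta> m \<delta> \<eta> h) \<le> \<epsilon> / 2 \<and> pivot_approximation \<theta> m \<delta> \<eta> g A C h"
    by (rule approx[rule_format]) (use \<delta> A\<delta> \<open>\<epsilon> > 0\<close> in simp)
  then obtain \<eta> h0 where h0: "h0 > 0"
    and good: "\<forall>h\<ge>h0. \<forall>\<theta>\<in>K. prob (space M - good_event \<theta> m \<delta> \<eta> h) \<le> \<epsilon> / 2 \<and> pivot_approximation \<theta> m \<delta> \<eta> g A C h"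
    by (elim exE conjE)
  show ?thesis
  proof (rule exI[of _ "c * L"], rule exI[of _ h0], intro allI impI ballI)
    fix h \<theta> assume h: "h0 \<le> h" and \<theta>: "\<theta> \<in> K"
    have hp: "h > 0" using h h0 by simp
    note gd = good[rule_format, OF h \<theta>]
    from gd have "pivot_approximation \<theta> m \<delta> \<eta> g A C h" ..
    then obtain J G where J: "\<forall>z. norm (J *v z) \<le> norm z / sqrt g"
      and path: "\<forall>\<omega>\<in>good_event \<theta> m \<delta> \<eta> h.
            norm (ar_pivot \<theta> (noise_path \<omega>) \<sigma> h - J *v ((1 / sqrt h) *\<^sub>R score \<theta> m \<delta> h \<omega>))
              \<le> C * \<delta> * norm ((1 / sqrt h) *\<^sub>R score \<theta> m \<delta> h \<omega>)
          \<and> (\<forall>\<mu>. \<bar>(\<Sum>k<m * nat \<lceil>h\<rceil> + 1. (\<mu> \<bullet> truncated_X \<theta> (noise_path \<omega>) (h * \<sigma>\<^sup>2) (\<delta> * h) k)\<^sup>2) / h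
              - \<mu> \<bullet> (G *v \<mu>)\<bar> \<le> A * \<delta> * (norm \<mu>)\<^sup>2)"
      unfolding pivot_approximation_def by (elim exE conjE)
    let ?W = "\<lambda>\<omega>. ar_pivot \<theta> (noise_path \<omega>) \<sigma> h" and ?S = "\<lambda>\<omega>. score \<theta> m \<delta> h \<omega>"
    have "{\<omega> \<in> space M. norm ((1 / \<sigma>) *\<^sub>R ?W \<omega>) > c * L}
      \<subseteq> (space M - good_event \<theta> m \<delta> \<eta> h) \<union> {\<omega> \<in> space M. norm (?S \<omega>) > L * sqrt h}"
    proof
      fix \<omega> assume \<omega>: "\<omega> \<in> {\<omega> \<in> space M. norm ((1 / \<sigma>) *\<^sub>R ?W \<omega>) > c * L}"
      show "\<omega> \<in> (space M - good_event \<theta> m \<delta> \<eta> h) \<union> {\<omega> \<in> space M. norm (?S \<omega>) > L * sqrt h}"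
      proof (cases "\<omega> \<in> good_event \<theta> m \<delta> \<eta> h")
        case True
        define Z where "Z = (1 / sqrt h) *\<^sub>R ?S \<omega>"
        have "norm (?W \<omega>) \<le> norm (J *v Z) + norm (?W \<omega> - J *v Z)"
          by (metis add.commute diff_add_cancel norm_triangle_ineq)
        also have "\<dots> \<le> norm Z / sqrt g + C * \<delta> * norm Z"
          using J path[THEN bspec, OF True, THEN conjunct1] unfolding Z_def by (intro add_mono) blast+
        also have "\<dots> = \<sigma> * (c * norm Z)" using \<sigma>_pos by (simp add: c_def distrib_right)
        finally have "norm ((1 / \<sigma>) *\<^sub>R ?W \<omega>) \<le> c * norm Z" using \<sigma>_pos by (simp add: divide_le_eq mult.commute)
        then have "c * L < c * norm Z" using \<omega> by simp
        then have "L < norm Z" using c by simp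
        also have "norm Z = norm (?S \<omega>) / sqrt h" using hp by (simp add: Z_def)
        finally have "L * sqrt h < norm (?S \<omega>)" using hp by (simp add: pos_less_divide_eq)
        then show ?thesis using \<omega> by simp
      qed (use \<omega> in simp)
    qed
    then have "prob {\<omega> \<in> space M. norm ((1 / \<sigma>) *\<^sub>R ?W \<omega>) > c * L}
      \<le> prob ((space M - good_event \<theta> m \<delta> \<eta> h) \<union> {\<omega> \<in> space M. norm (?S \<omega>) > L * sqrt h})"
      by (intro finite_measure_mono) measurable
    also have "\<dots> \<le> prob (space M - good_event \<theta> m \<delta> \<eta> h) + prob {\<omega> \<in> space M. norm (?S \<omega>) > L * sqrt h}"
      by (intro measure_Un_le) measurable
    also have "prob {\<omega> \<in> space M. norm (?S \<omega>) > L * sqrt h} \<le> Q * h / (L * sqrt h)\<^sup>2"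
      unfolding Q_def using hp \<delta> L by (intro score_tail) auto
    also have "Q * h / (L * sqrt h)\<^sup>2 = \<epsilon> / 2"
      using hp Q \<open>\<epsilon> > 0\<close> by (simp add: power_mult_distrib L(2) field_simps)
    also have "prob (space M - good_event \<theta> m \<delta> \<eta> h) \<le> \<epsilon> / 2" using gd by blast
    finally show "prob {\<omega> \<in> space M. norm ((1 / \<sigma>) *\<^sub>R ?W \<omega>) > c * L} \<le> \<epsilon>" by simp
  qed
qed

lemma pivot_uniformly_normal:
  fixes K :: "(real^'p::{finite,wellorder}) set"
  assumes K: "compact K" "K \<subseteq> Lambda_tilde" and "\<epsilon> > 0"
  shows "\<exists>h0. \<forall>h\<ge>h0. \<forall>\<theta>\<in>K. \<forall>t. \<bar>prob {\<omega> \<in> space M. \<forall>i. ar_pivot \<theta> (noise_path \<omega>) \<sigma> h $ i \<le> t $ i}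
    - (\<Prod>i\<in>UNIV. Phi (t $ i / \<sigma>))\<bar> < \<epsilon>"
proof -
  \<comment> \<open>Eventually along this product means for all large h and all parameters in K at
    once, so uniformity in the parameter becomes convergence along one filter.\<close>
  define F where "F = (at_top :: real filter) \<times>\<^sub>F principal K"
  have ev: "\<forall>\<^sub>F x in F. Q (fst x) (snd x)" if "\<exists>h0. \<forall>h\<ge>h0. \<forall>\<theta>\<in>K. Q h \<theta>" for Q
  proof -
    from that obtain h0 where h0: "\<forall>h\<ge>h0. \<forall>\<theta>\<in>K. Q h \<theta>" by blast
    have "\<forall>\<^sub>F h in at_top. h \<ge> h0" "\<forall>\<^sub>F \<theta> in principal K. \<theta> \<in> K"
      by (auto simp: eventually_ge_at_top eventually_principal)
    from eventually_prodI[OF this] show ?thesis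
      unfolding F_def by eventually_elim (use h0 in auto)
  qed
  define W where "W x \<omega> = (1 / \<sigma>) *\<^sub>R ar_pivot (snd x) (noise_path \<omega>) \<sigma> (fst x)" for x :: "real \<times> (real^'p::{finite,wellorder})" and \<omega>
  have "\<forall>\<^sub>F x in F. \<forall>t. \<bar>prob {\<omega> \<in> space M. \<forall>j. W x \<omega> $ j \<le> t $ j} - (\<Prod>j\<in>UNIV. Phi (t $ j))\<bar> < \<epsilon>"
  proof (rule uniform_normal_convergence[OF _ _ _ \<open>\<epsilon> > 0\<close>])
    show "W x \<in> borel_measurable M" for x unfolding W_def by measurable
    show "((\<lambda>x. \<integral>\<omega>. iexp (v \<bullet> W x \<omega>) \<partial>M) \<longlongrightarrow> complex_of_real (exp (- (v \<bullet> v) / 2))) F" for v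
    proof (rule tendstoI)
      fix e :: real assume "e > 0"
      show "\<forall>\<^sub>F x in F. dist (\<integral>\<omega>. iexp (v \<bullet> W x \<omega>) \<partial>M) (complex_of_real (exp (- (v \<bullet> v) / 2))) < e"
        unfolding W_def dist_norm by (rule ev) (rule pivot_char[OF K \<open>e > 0\<close>])
    qed
    fix e :: real assume "e > 0"
    from pivot_tight[OF K this] obtain R where
      "\<exists>h0. \<forall>h\<ge>h0. \<forall>\<theta>\<in>K. prob {\<omega> \<in> space M. norm ((1 / \<sigma>) *\<^sub>R ar_pivot \<theta> (noise_path \<omega>) \<sigma> h) > R} \<le> e" ..
    then show "\<exists>R. \<forall>\<^sub>F x in F. prob {\<omega> \<in> space M. norm (W x \<omega>) > R} \<le> e"
      unfolding W_def by (intro exI[of _ R]) (rule ev)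
  qed
  then obtain P1 P2 where P: "eventually P1 at_top" "eventually P2 (principal K)"
    and Pt: "\<And>h \<theta>. P1 h \<Longrightarrow> P2 \<theta> \<Longrightarrow> \<forall>t. \<bar>prob {\<omega> \<in> space M. \<forall>j. W (h, \<theta>) \<omega> $ j \<le> t $ j} - (\<Prod>j\<in>UNIV. Phi (t $ j))\<bar> < \<epsilon>"
    unfolding F_def eventually_prod_filter by blast
  obtain h0 where h0: "\<And>h. h \<ge> h0 \<Longrightarrow> P1 h" using P(1) unfolding eventually_at_top_linorder by blast
  show ?thesis
  proof (rule exI[of _ h0], intro allI impI ballI)
    fix h \<theta> and t :: "real^'p::{finite,wellorder}" assume "h0 \<le> h" "\<theta> \<in> K"
    then have "P1 h" "P2 \<theta>" using h0 P(2) by (auto simp: eventually_principal)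
    from Pt[OF this, rule_format, of "(1 / \<sigma>) *\<^sub>R t"]
    show "\<bar>prob {\<omega> \<in> space M. \<forall>i. ar_pivot \<theta> (noise_path \<omega>) \<sigma> h $ i \<le> t $ i} - (\<Prod>i\<in>UNIV. Phi (t $ i / \<sigma>))\<bar> < \<epsilon>"
      using \<sigma>_pos by (simp add: W_def divide_le_cancel)
  qed
qed

end

theorem theorem2p1:
  fixes M :: "'a measure" and eps :: "nat \<Rightarrow> 'a \<Rightarrow> real" and \<sigma> :: real
    and K :: "(real^'p::{finite,wellorder}) set"
  assumes "prob_space M"
    and "\<forall>n\<ge>1. eps n \<in> borel_measurable M"
    and "prob_space.indep_vars M (\<lambda>_. borel) eps {1..}"
    and "\<forall>n\<ge>1. distr M borel (eps n) = distr M borel (eps 1)"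
    and "integrable M (eps 1)" and "integral\<^sup>L M (eps 1) = 0"
    and "integrable M (\<lambda>\<omega>. (eps 1 \<omega>)\<^sup>2)"
    and "integral\<^sup>L M (\<lambda>\<omega>. (eps 1 \<omega>)\<^sup>2) = \<sigma>\<^sup>2" and "\<sigma> > 0"
    and "compact K" and "K \<subseteq> Lambda_tilde"
  shows "\<forall>\<epsilon>>0. \<exists>h0. \<forall>h\<ge>h0. \<forall>\<theta>\<in>K. \<forall>t::real^'p::{finite,wellorder}.
    \<bar>measure M {\<omega>\<in>space M.
        let e = (\<lambda>n. eps n \<omega>); \<tau> = ar_tau \<theta> e \<sigma> h in
        \<forall>i. (msqrt (ar_M \<theta> e \<tau>) *v (ar_lse \<theta> e \<tau> - \<theta>)) $ i \<le> t $ i}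
     - (\<Prod>i\<in>UNIV. Phi (t $ i / \<sigma>))\<bar> < \<epsilon>"
proof -
  interpret iid_noise M eps \<sigma>
    by (rule iid_noise.intro[OF assms(1) iid_noise_axioms.intro])
      (use assms(2,4) in blast, rule assms, use assms(2,4) in blast, (rule assms)+)
  show ?thesis
    using pivot_uniformly_normal[OF assms(10,11)] unfolding ar_pivot_def Let_def by simp
qed

end
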